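(* Let $f\colon\mathbb{R}^n\to\mathbb{R}^n$, $g\colon\mathbb{R}^n\to\mathbb{R}^{n,m}$, $h\colon\mathbb{R}^n\to\mathbb{R}^m$ be continuous with $f(0)=0$, let $\hat{\mathcal{H}}$ be the value function described in the context, and assume that the set of admissible controls $\mathcal{U}_{\mathrm{ad}}(z_0)$ is nonempty for all $z_0\in\mathbb{R}^n$, that $\hat{\mathcal{H}}$ is continuously differentiable, and that $u^*(z)=-\mathbf{R}^{-1}g(z)^{\mathsf T}\nabla\hat{\mathcal{H}}(z)$ is an optimal feedback law. Assume that the plant $\dot z=f(z)+g(z)u$, $y=h(z)$ is passive with storage function $\mathcal{H}$, and that for some $k\ge2$ we have $\mathcal{H}\in C^{k+2}$, $\hat{\mathcal{H}}\in C^k$, $\mathcal{H}(0)=\hat{\mathcal{H}}(0)=0$, $\nabla\mathcal{H}(0)=0$ and $\nabla^2\mathcal{H}(0)\succ0$, $\nabla^2\hat{\mathcal{H}}(0)\succ0$. Let $V$, $\phi$, $\hat{\mathsf{H}}$, $D$, $T$ be as in the context, and assume that $\theta\colon V\to\theta(V)$, $\bar z\mapsto T(\bar z)^{\mathsf T}\bar z$, is a $C^{k-2}$-isomorphism. Then $\psi:=\theta\circ\phi\colon\phi^{-1}(V)\to\theta(V)$, $z\mapsto\tilde z$, is a $C^{k-2}$-isomorphism with $\psi(0)=0$ and $$(\mathcal{H}\circ\psi^{-1})(\tilde z)=\frac12\tilde z^{\mathsf T}\tilde z,\qquad(\hat{\mathcal{H}}\circ\psi^{-1})(\tilde z)=\frac12\tilde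 z^{\mathsf T}\Sigma(\tilde z)\tilde z\qquad\text{for }\tilde z\in\theta(V),$$ where $\Sigma\colon\theta(V)\to\mathbb{R}^{n,n}$ is $C^{k-2}$ and pointwise diagonal with positive entries.
   Context: The plant is $\dot z=f(z)+g(z)u$, $z(0)=z_0$, $y=h(z)$; standing assumption: solutions exist on $[0,\infty)$ in the sense of Carathéodory. It is passive with storage function $\mathcal{H}\colon\mathbb{R}^n\to\mathbb{R}_{\ge0}$ if $\mathcal{H}(z(t_1))-\mathcal{H}(z(t_0))\le\int_{t_0}^{t_1}y^{\mathsf T}u\,\mathrm{d}t$ for all $t_1\ge t_0\ge0$ and all controls $u$ along solutions. The value function $\hat{\mathcal{H}}\colon\mathbb{R}^n\to\mathbb{R}_{\ge0}$ is $\hat{\mathcal{H}}(z_0)=\inf_{u\in\mathcal{U}_{\mathrm{ad}}(z_0)}\frac12\int_0^\infty y^{\mathsf T}\mathbf{Q}y+u^{\mathsf T}\mathbf{R}u\,\mathrm{d}t$ subject to the plant dynamics with $z(0)=z_0$, where $\mathbf{Q},\mathbf{R}\in\mathbb{R}^{m,m}$ are symmetric positive semidefinite with $\mathbf{R}$ invertible, and $\mathcal{U}_{\mathrm{ad}}(z_0)$ is the set of $u\in L^2([0,\infty),\mathbb{R}^m)$ rendering the integral finite. A $C^j$-isomorphism is a bijective $C^j$ map whose inverse is $C^j$ (a homeomorphism if $j=0$). Under the stated hypotheses on $\mathcal{H}$ and $\hat{\mathcal{H}}$ there exist an open set $V\subseteq\mathbb{R}^n$ with $0\in V$, a $C^k$-isomorphism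 $\phi\colon\phi^{-1}(V)\to V$, $z\mapsto\bar z$, from an open neighbourhood of $0$ onto $V$ with $\phi(0)=0$, and a pointwise symmetric positive definite $C^{k-2}$ function $\hat{\mathsf{H}}\colon V\to\mathbb{R}^{n,n}$ such that on $V$ $$(\mathcal{H}\circ\phi^{-1})(\bar z)=\tfrac12\bar z^{\mathsf T}\bar z,\qquad(\hat{\mathcal{H}}\circ\phi^{-1})(\bar z)=\tfrac12\bar z^{\mathsf T}\hat{\mathsf{H}}(\bar z)\bar z.$$ These are fixed. Further, $D,T\colon V\to\mathbb{R}^{n,n}$ collect the eigenvalues and eigenvectors of $\hat{\mathsf{H}}$: $\hat{\mathsf{H}}(\bar z)=T(\bar z)D(\bar z)T(\bar z)^{\mathsf T}$ with $D$ pointwise diagonal and $T$ pointwise orthogonal. *)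

theory Defs
  imports "HOL-Analysis.Analysis"
begin

section \<open>Maps of class C^k and isomorphisms\<close>

text \<open>Full derivatives (\<open>at x\<close>) are used, so \<open>Ck_on k f S\<close> is the usual notion for open \<open>S\<close>.
  In finite dimension, continuity of all directional derivatives amounts to continuity of the
  derivative as a map into the space of linear maps.\<close>

fun Ck_on :: "nat \<Rightarrow> ('a::real_normed_vector \<Rightarrow> 'b::real_normed_vector) \<Rightarrow> 'a set \<Rightarrow> bool" where
  "Ck_on 0 f S \<longleftrightarrow> continuous_on S f"
| "Ck_on (Suc k) f S \<longleftrightarrow>
     (\<forall>x\<in>S. f differentiable (at x)) \<and> (\<forall>v. Ck_on k (\<lambda>x. frechet_derivative f (at x) v) S)"

text \<open>The inverse is the one on \<open>W\<close>. If \<open>S\<close> is open then so is \<open>W\<close>, by invariance of domain.\<close>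

definition Ck_iso :: "nat \<Rightarrow> ('a::euclidean_space \<Rightarrow> 'a) \<Rightarrow> 'a set \<Rightarrow> 'a set \<Rightarrow> bool" where
  "Ck_iso k F S W \<longleftrightarrow> bij_betw F S W \<and> Ck_on k F S \<and> Ck_on k (inv_into S F) W"

definition grad :: "(real^'n \<Rightarrow> real) \<Rightarrow> real^'n \<Rightarrow> real^'n" where
  "grad F x = (\<chi> i. frechet_derivative F (at x) (axis i 1))"

definition hess :: "(real^'n \<Rightarrow> real) \<Rightarrow> real^'n \<Rightarrow> real^'n^'n" where
  "hess F x = (\<chi> i j. frechet_derivative (\<lambda>y. grad F y $ j) (at x) (axis i 1))"


section \<open>Matrices\<close>

definition sym_pos_semidef :: "real^'n^'n \<Rightarrow> bool" where
  "sym_pos_semidef A \<longleftrightarrow> transpose A = A \<and> (\<forall>x. x \<bullet> (A *v x) \<ge> 0)"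

definition sym_pos_def :: "real^'n^'n \<Rightarrow> bool" where
  "sym_pos_def A \<longleftrightarrow> transpose A = A \<and> (\<forall>x. x \<noteq> 0 \<longrightarrow> x \<bullet> (A *v x) > 0)"

definition diag_mat :: "real^'n^'n \<Rightarrow> bool" where
  "diag_mat A \<longleftrightarrow> (\<forall>i j. i \<noteq> j \<longrightarrow> A $ i $ j = 0)"


section \<open>Caratheodory solutions\<close>

definition abs_cont_on :: "real \<Rightarrow> real \<Rightarrow> (real \<Rightarrow> 'a::real_normed_vector) \<Rightarrow> bool" where
  "abs_cont_on a b z \<longleftrightarrow>
     (\<forall>\<epsilon>>0. \<exists>\<delta>>0. \<forall>d. d division_of \<Union>d \<and> \<Union>d \<subseteq> {a..b} \<and> (\<Sum>K\<in>d. Sup K - Inf K) < \<delta>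
        \<longrightarrow> (\<Sum>K\<in>d. norm (z (Sup K) - z (Inf K))) < \<epsilon>)"

definition caratheodory_solution :: "(real \<Rightarrow> real^'n \<Rightarrow> real^'n) \<Rightarrow> real^'n \<Rightarrow> (real \<Rightarrow> real^'n) \<Rightarrow> bool" where
  "caratheodory_solution F z0 z \<longleftrightarrow>
     z 0 = z0 \<and> (\<forall>b\<ge>0. abs_cont_on 0 b z) \<and>
     (AE t in lebesgue_on {0..}. (z has_vector_derivative F t (z t)) (at t))"


section \<open>The plant\<close>

definition L2_controls :: "(real \<Rightarrow> real^'m) set" where
  "L2_controls = {u. u \<in> borel_measurable (lebesgue_on {0..}) \<and>
                     integrable (lebesgue_on {0..}) (\<lambda>t. (norm (u t))\<^sup>2)}"

definition plant_solution ::
  "(real^'n \<Rightarrow> real^'n) \<Rightarrow> (real^'n \<Rightarrow> real^'m^'n) \<Rightarrow> real^'n \<Rightarrow> (real \<Rightarrow> real^'m) \<Rightarrow> (real \<Rightarrow> real^'n) \<Rightarrow> bool" where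
  "plant_solution f g z0 u z \<longleftrightarrow> caratheodory_solution (\<lambda>t x. f x + g x *v u t) z0 z"

definition is_passive ::
  "(real^'n \<Rightarrow> real^'n) \<Rightarrow> (real^'n \<Rightarrow> real^'m^'n) \<Rightarrow> (real^'n \<Rightarrow> real^'m) \<Rightarrow> (real^'n \<Rightarrow> real) \<Rightarrow> bool" where
  "is_passive f g h H \<longleftrightarrow> (\<forall>x. 0 \<le> H x) \<and>
     (\<forall>z0. \<forall>u\<in>L2_controls. \<forall>z. plant_solution f g z0 u z \<longrightarrow>
        (\<forall>t0 t1. 0 \<le> t0 \<and> t0 \<le> t1 \<longrightarrow>
           H (z t1) - H (z t0) \<le> integral\<^sup>L (lebesgue_on {t0..t1}) (\<lambda>t. h (z t) \<bullet> u t)))"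


section \<open>The optimal control problem\<close>

definition running_cost ::
  "(real^'n \<Rightarrow> real^'m) \<Rightarrow> real^'m^'m \<Rightarrow> real^'m^'m \<Rightarrow> (real \<Rightarrow> real^'n) \<Rightarrow> (real \<Rightarrow> real^'m) \<Rightarrow> real \<Rightarrow> real" where
  "running_cost h Q R z u t = h (z t) \<bullet> (Q *v h (z t)) + u t \<bullet> (R *v u t)"

text \<open>The running cost is nonnegative for positive semidefinite weights, so its integral is finite
  iff it is integrable. Solutions need not be unique for merely continuous data; therefore
  trajectories are kept explicit.\<close>

definition finite_cost where
  "finite_cost h Q R z u \<longleftrightarrow> integrable (lebesgue_on {0..}) (running_cost h Q R z u)"

definition cost where
  "cost h Q R z u = 1/2 * integral\<^sup>L (lebesgue_on {0..}) (running_cost h Q R z u)"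

definition admissible ::
  "(real^'n \<Rightarrow> real^'n) \<Rightarrow> (real^'n \<Rightarrow> real^'m^'n) \<Rightarrow> (real^'n \<Rightarrow> real^'m) \<Rightarrow> real^'m^'m \<Rightarrow> real^'m^'m
     \<Rightarrow> real^'n \<Rightarrow> (real \<Rightarrow> real^'m) set" where
  "admissible f g h Q R z0 =
     {u \<in> L2_controls. \<exists>z. plant_solution f g z0 u z \<and> finite_cost h Q R z u}"

definition value_fun ::
  "(real^'n \<Rightarrow> real^'n) \<Rightarrow> (real^'n \<Rightarrow> real^'m^'n) \<Rightarrow> (real^'n \<Rightarrow> real^'m) \<Rightarrow> real^'m^'m \<Rightarrow> real^'m^'m
     \<Rightarrow> real^'n \<Rightarrow> real" where
  "value_fun f g h Q R z0 =
     Inf {cost h Q R z u | u z. u \<in> admissible f g h Q R z0 \<and> plant_solution f g z0 u z \<and>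
                                finite_cost h Q R z u}"

definition optimal_feedback ::
  "(real^'n \<Rightarrow> real^'n) \<Rightarrow> (real^'n \<Rightarrow> real^'m^'n) \<Rightarrow> (real^'n \<Rightarrow> real^'m) \<Rightarrow> real^'m^'m \<Rightarrow> real^'m^'m
     \<Rightarrow> (real^'n \<Rightarrow> real^'m) \<Rightarrow> bool" where
  "optimal_feedback f g h Q R k \<longleftrightarrow>
     (\<forall>z0. (\<exists>z. caratheodory_solution (\<lambda>t x. f x + g x *v k x) z0 z) \<and>
           (\<forall>z. caratheodory_solution (\<lambda>t x. f x + g x *v k x) z0 z \<longrightarrow>
                (\<lambda>t. k (z t)) \<in> admissible f g h Q R z0 \<and>
                finite_cost h Q R z (\<lambda>t. k (z t)) \<and>
                cost h Q R z (\<lambda>t. k (z t)) = value_fun f g h Q R z0))"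

end

theory Submission
  imports Defs "HOL-Library.Landau_Symbols"
begin

text \<open>Write \<open>W = \<theta>(V)\<close>, \<open>r = k - 2\<close>, \<open>z = \<theta>\<^sup>-\<^sup>1\<close>, \<open>N = M \<circ> z\<close> and \<open>q(w) = z(w) \<bullet> N(w) z(w)\<close>. Since \<open>z(w) = T w\<close> with \<open>T\<close>
  orthogonal, \<open>q(w) = \<Sum> D\<^sub>i w\<^sub>i\<^sup>2\<close>; but \<open>T\<close> and \<open>D\<close> are not assumed continuous, so \<open>D\<close> itself need not be
  the desired \<open>\<Sigma>\<close>. Away from the origin \<open>(q / |w|\<^sup>2) I\<close> will do, and a cutoff reduces the problem to a
  neighbourhood of \<open>0\<close>.

  There, the spectral projections \<open>\<Pi>\<close> of \<open>N\<close> near the eigenvalues of \<open>M(0)\<close> are \<open>C\<^sup>r\<close>, and \<open>z \<bullet> \<Pi> z\<close> is a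
  continuous function whose values are subset sums of the \<open>w\<^sub>i\<^sup>2\<close>. The subset does not depend on \<open>w\<close>:
  otherwise the homeomorphism \<open>z\<close> would be null-homotopic on small spheres, as a map into the space
  without the origin. Hence there is a \<open>C\<^sup>r\<close> matrix function \<open>K\<close> with \<open>K(0) = N(0)\<close> and
  \<open>z \<bullet> K z = \<Sum> \<kappa>\<^sub>i w\<^sub>i\<^sup>2\<close> for constants \<open>\<kappa>\<^sub>i\<close>. As \<open>N - K\<close> and \<open>z\<close> vanish at \<open>0\<close>, the remainder
  \<open>E = z \<bullet> (N - K) z\<close> is a polynomial \<open>p\<close> up to \<open>o(|w|\<^sup>r\<^sup>+\<^sup>2)\<close>, compatibly with derivatives up to order \<open>r\<close>.
  On the lines \<open>w = t \<epsilon>\<close> with \<open>\<epsilon>\<^sub>i = \<plusminus>1\<close>, \<open>E\<close> is \<open>t\<^sup>2 (tr N - \<Sum> \<kappa>\<^sub>i)\<close>, and comparing parities in \<open>\<epsilon>\<close> shows that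
  the squarefree monomials of degree at most \<open>r + 2\<close> do not occur in \<open>p\<close>. So \<open>p = \<Sum> s\<^sub>i w\<^sub>i\<^sup>2\<close> up to higher order,
  and the rest, divided by \<open>|w|\<^sup>2\<close>, is \<open>C\<^sup>r\<close> and may be added to every coefficient.\<close>

section \<open>Calculus of maps of class \<open>C\<^sup>k\<close>\<close>

text \<open>The obstacle is one missing order of vanishing. Dividing by |w|^2 within C^r takes a
  remainder of order o(|w|^(r+2)), but \<open>z\<close> is only C^r: its Taylor error o(|w|^r) times
  the second factor \<open>z\<close> gives just o(|w|^(r+1)). A third factor that vanishes at the
  origin supplies the missing power, and this is why \<open>K\<close> is split off. Subtracting the
  constant matrix \<open>N 0\<close> would produce such a factor too, but its form in
  \<open>z\<close> has no reason to be diagonal in \<open>w\<close>; the projections in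
  \<open>K\<close> share the eigenvectors \<open>T w\<close> of \<open>N w\<close>, so their forms
  are. The remainder need not be C^(r+2). Hence its size is recorded by bounds on derivatives away
  from the origin, not by derivatives at the origin. Since eigenvectors may jump, the regularity of
  a projection is read off from algebraic equations between matrices: |A| is the square root of A^2,
  and |A| sgn(A) = A. For r = 0 the map \<open>z\<close> may fail to be differentiable at the
  origin, so no linearization can identify the subsets; topology replaces it.\<close>

lemma Ck_on_subset:
  assumes "Ck_on k f S" "T \<subseteq> S"
  shows "Ck_on k f T"
  using assms by (induction k arbitrary: f) (auto intro: continuous_on_subset)

lemma frechet_derivative_eq:
  "(f has_derivative f') (at x) \<Longrightarrow> frechet_derivative f (at x) = f'"
  by (metis frechet_derivative_at)

lemma Ck_on_cong:
  assumes "Ck_on k f S" "open S" "\<And>x. x \<in> S \<Longrightarrow> f x = g x"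
  shows "Ck_on k g S"
  using assms(1,3)
proof (induction k arbitrary: f g)
  case 0
  then show ?case by (metis Ck_on.simps(1) continuous_on_eq)
next
  case (Suc k)
  have d: "(g has_derivative frechet_derivative f (at x)) (at x)" if "x \<in> S" for x
    by (rule has_derivative_transform_within_open[where s = S and f = f])
      (use Suc.prems assms(2) that in \<open>auto simp: frechet_derivative_works\<close>)
  show ?case
  proof (unfold Ck_on.simps, intro conjI ballI allI)
    show "g differentiable (at x)" if "x \<in> S" for x
      using d[OF that] by (auto simp: differentiable_def)
    show "Ck_on k (\<lambda>x. frechet_derivative g (at x) v) S" for v
      by (rule Suc.IH[of "\<lambda>x. frechet_derivative f (at x) v"])
        (use Suc.prems(1) frechet_derivative_eq[OF d] in auto)
  qed
qed

lemma Ck_on_imp_continuous_on: "Ck_on k f S \<Longrightarrow> continuous_on S f"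
  by (cases k)
    (auto intro!: continuous_at_imp_continuous_on differentiable_imp_continuous_within)

lemma Ck_on_SucD: "Ck_on (Suc k) f S \<Longrightarrow> Ck_on k f S"
proof (induction k arbitrary: f)
  case 0
  then show ?case using Ck_on_imp_continuous_on[of "Suc 0" f S] by (simp del: Ck_on.simps(2))
next
  case (Suc k)
  then show ?case by (metis Ck_on.simps(2))
qed

lemma Ck_on_le: "Ck_on k f S \<Longrightarrow> j \<le> k \<Longrightarrow> Ck_on j f S"
  by (induction k) (auto simp: le_Suc_eq dest: Ck_on_SucD simp del: Ck_on.simps)

lemma Ck_on_SucI:
  assumes "open S" "\<And>x. x \<in> S \<Longrightarrow> (f has_derivative f' x) (at x)"
    "\<And>v. Ck_on k (\<lambda>x. f' x v) S"
  shows "Ck_on (Suc k) f S"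
proof -
  have "Ck_on k (\<lambda>x. frechet_derivative f (at x) v) S" for v
    by (rule Ck_on_cong[OF assms(3)[of v] assms(1)])
      (simp add: frechet_derivative_eq[OF assms(2)])
  then show ?thesis using assms(2) by (auto simp: differentiable_def)
qed

lemma Ck_on_SucE:
  assumes "Ck_on (Suc k) f S" "x \<in> S"
  shows "(f has_derivative frechet_derivative f (at x)) (at x)"
  using assms by (simp add: frechet_derivative_works)

lemma Ck_on_const [simp]: "Ck_on k (\<lambda>x. c) S"
  by (induction k arbitrary: c) auto

lemma Ck_on_bounded_linear:
  assumes L: "bounded_linear L" and S: "open S" and "Ck_on k f S"
  shows "Ck_on k (\<lambda>x. L (f x)) S"
  using assms(3)
proof (induction k arbitrary: f)
  case 0
  then show ?case using bounded_linear.continuous_on[OF L] by auto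
next
  case (Suc k)
  show ?case
    by (rule Ck_on_SucI[OF S bounded_linear.has_derivative[OF L Ck_on_SucE[OF Suc.prems]]])
      (use Suc in auto)
qed

lemma Ck_on_ident: 
  assumes S: "open S" 
  shows "Ck_on k (\<lambda>x. x) S"
proof (cases k)
  case (Suc j)
  then show ?thesis using Ck_on_SucI[OF S has_derivative_ident] by simp
qed auto

lemma Ck_on_linear:
  "bounded_linear L \<Longrightarrow> open S \<Longrightarrow> Ck_on k L S"
  using Ck_on_bounded_linear[OF _ _ Ck_on_ident] by blast

lemma Ck_on_add:
  assumes S: "open S" and "Ck_on k f S" "Ck_on k g S"
  shows "Ck_on k (\<lambda>x. f x + g x) S"
  using assms(2,3)
proof (induction k arbitrary: f g)
  case 0
  then show ?case by (auto intro: continuous_intros)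
next
  case (Suc k)
  show ?case
    by (rule Ck_on_SucI[OF S has_derivative_add[OF Ck_on_SucE[OF Suc.prems(1)] Ck_on_SucE[OF Suc.prems(2)]]])
      (use Suc in auto)
qed

lemma Ck_on_uminus: "open S \<Longrightarrow> Ck_on k f S \<Longrightarrow> Ck_on k (\<lambda>x. - f x) S"
  by (rule Ck_on_bounded_linear) (auto intro: bounded_linear_minus bounded_linear_ident)

lemma Ck_on_diff:
  "open S \<Longrightarrow> Ck_on k f S \<Longrightarrow> Ck_on k g S \<Longrightarrow> Ck_on k (\<lambda>x. f x - g x) S"
  using Ck_on_add[of S k f "\<lambda>x. - g x"] Ck_on_uminus[of S k g] by simp

lemma Ck_on_sum:
  "open S \<Longrightarrow> (\<And>i. i \<in> I \<Longrightarrow> Ck_on k (f i) S) \<Longrightarrow> Ck_on k (\<lambda>x. \<Sum>i\<in>I. f i x) S"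
  by (induction I rule: infinite_finite_induct) (auto intro: Ck_on_add)

lemma Ck_on_bilinear:
  assumes B: "bounded_bilinear bil" and S: "open S" and "Ck_on k f S" "Ck_on k g S"
  shows "Ck_on k (\<lambda>x. bil (f x) (g x)) S"
  using assms(3,4)
proof (induction k arbitrary: f g)
  case 0
  then show ?case using bounded_bilinear.continuous_on[OF B] by auto
next
  case (Suc k)
  note k = Suc.prems[THEN Ck_on_SucD]
  show ?case
    by (rule Ck_on_SucI[OF S bounded_bilinear.FDERIV[OF B Ck_on_SucE[OF Suc.prems(1)] Ck_on_SucE[OF Suc.prems(2)]]])
      (use Suc k in \<open>auto intro!: Ck_on_add S\<close>)
qed

lemmas Ck_on_mult = Ck_on_bilinear[OF bounded_bilinear_mult]
lemmas Ck_on_scaleR = Ck_on_bilinear[OF bounded_bilinear_scaleR]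
lemmas Ck_on_inner = Ck_on_bilinear[OF bounded_bilinear_inner]

lemma Ck_on_compose:
  fixes f :: "'b::euclidean_space \<Rightarrow> 'c::real_normed_vector" and g :: "'a::real_normed_vector \<Rightarrow> 'b"
  assumes S: "open S" and T: "open T" and "Ck_on k g S" "g ` S \<subseteq> T" "Ck_on k f T"
  shows "Ck_on k (\<lambda>x. f (g x)) S"
  using assms(3,5)
proof (induction k arbitrary: f)
  case 0
  then show ?case using assms(4) by (auto intro: continuous_on_compose2)
next
  case (Suc k)
  let ?f' = "\<lambda>x. frechet_derivative f (at x)" and ?g' = "\<lambda>x. frechet_derivative g (at x)"
  have f: "(f has_derivative ?f' (g x)) (at (g x))" if "x \<in> S" for x
    using Ck_on_SucE[OF Suc.prems(2)] that assms(4) by auto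
  have "((\<lambda>x. f (g x)) has_derivative (\<lambda>v. ?f' (g x) (?g' x v))) (at x)" if "x \<in> S" for x
    by (rule has_derivative_compose[OF Ck_on_SucE[OF Suc.prems(1) that] f[OF that]])
  \<comment> \<open>\<open>Ck_on\<close> controls derivatives in fixed directions only, while
    \<open>?g' x v\<close> moves with \<open>x\<close>; the expansion in \<open>Basis\<close> shifts
    this dependence into scalar coefficients.\<close>
  moreover have "?f' (g x) (?g' x v) = (\<Sum>b\<in>Basis. (?g' x v \<bullet> b) *\<^sub>R ?f' (g x) b)" if "x \<in> S" for x v
  proof -
    interpret bounded_linear "?f' (g x)" using f[OF that] by (rule has_derivative_bounded_linear)
    have "?f' (g x) (?g' x v) = ?f' (g x) (\<Sum>b\<in>Basis. (?g' x v \<bullet> b) *\<^sub>R b)"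
      by (simp add: euclidean_representation)
    also have "\<dots> = (\<Sum>b\<in>Basis. (?g' x v \<bullet> b) *\<^sub>R ?f' (g x) b)" by (simp add: sum scaleR)
    finally show ?thesis .
  qed
  ultimately have *: "((\<lambda>x. f (g x)) has_derivative
      (\<lambda>v. \<Sum>b\<in>Basis. (?g' x v \<bullet> b) *\<^sub>R ?f' (g x) b)) (at x)" if "x \<in> S" for x
    using that by simp
  show ?case
    by (rule Ck_on_SucI[OF S *])
      (use Suc Ck_on_SucD[OF Suc.prems(1)] in \<open>auto intro!: Ck_on_sum S Ck_on_scaleR Ck_on_inner
        Suc.IH[of "\<lambda>x. frechet_derivative f (at x) b" for b]\<close>)
qed

lemma Ck_on_local:
  assumes "\<And>x. x \<in> S \<Longrightarrow> \<exists>U. open U \<and> x \<in> U \<and> Ck_on k f U"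
  shows "Ck_on k f S"
  using assms
proof (induction k arbitrary: f)
  case 0
  then show ?case
    by (metis Ck_on.simps(1) continuous_at_imp_continuous_on continuous_on_eq_continuous_at)
next
  case (Suc k)
  then show ?case by (metis Ck_on.simps(2))
qed

lemma Ck_on_inverse:
  fixes f :: "'a::real_normed_vector \<Rightarrow> real"
  assumes S: "open S" and "Ck_on k f S" and nz: "\<And>x. x \<in> S \<Longrightarrow> f x \<noteq> 0"
  shows "Ck_on k (\<lambda>x. inverse (f x)) S"
  using assms(2)
proof (induction k)
  case 0
  then show ?case using nz by (auto intro!: continuous_intros)
next
  case (Suc k)
  have "((\<lambda>x. inverse (f x)) has_derivative
     (\<lambda>v. - (inverse (f x) * frechet_derivative f (at x) v * inverse (f x)))) (at x)" if "x \<in> S" for x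
    using Deriv.has_derivative_inverse[OF nz[OF that] Ck_on_SucE[OF Suc.prems that]] by simp
  then show ?case
    by (rule Ck_on_SucI[OF S])
      (use Suc Ck_on_SucD[OF Suc.prems] in \<open>auto intro!: Ck_on_uminus S Ck_on_mult\<close>)
qed

lemma Ck_on_divide:
  fixes f g :: "'a::real_normed_vector \<Rightarrow> real"
  assumes "open S" "Ck_on k f S" "Ck_on k g S" "\<And>x. x \<in> S \<Longrightarrow> g x \<noteq> 0"
  shows "Ck_on k (\<lambda>x. f x / g x) S"
  unfolding divide_inverse using assms by (intro Ck_on_mult Ck_on_inverse)

lemma Ck_on_nth: "open S \<Longrightarrow> Ck_on k f S \<Longrightarrow> Ck_on k (\<lambda>x. f x $ i) S"
  by (rule Ck_on_bounded_linear[OF bounded_linear_vec_nth])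

lemma Ck_on_vec:
  fixes f :: "'a::real_normed_vector \<Rightarrow> ('b::euclidean_space)^'n"
  assumes S: "open S" and "\<And>i. Ck_on k (\<lambda>x. f x $ i) S"
  shows "Ck_on k f S"
proof -
  have L: "bounded_linear (\<lambda>y::'b. (\<chi> j. if j = i then y else 0)::'b^'n)" for i
    unfolding linear_conv_bounded_linear[symmetric] by (rule linearI) (auto simp: vec_eq_iff)
  have "Ck_on k (\<lambda>x. \<Sum>i\<in>UNIV. (\<chi> j. if j = i then f x $ i else 0)::'b^'n) S"
    by (intro Ck_on_sum S Ck_on_bounded_linear[OF L] assms)
  moreover have "(\<Sum>i\<in>UNIV. (\<chi> j. if j = i then y $ i else 0)) = y" for y :: "'b^'n"
    by (simp add: vec_eq_iff)
  ultimately show ?thesis by simp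
qed

text \<open>Raw material for a cutoff of finite smoothness. The derivative is a multiple of the
  previous power, so only the difference quotient at 0 needs an argument.\<close>

lemma Ck_on_max0_power: "Ck_on k (\<lambda>x::real. max 0 x ^ Suc k) UNIV"
proof (induction k)
  case 0
  then show ?case by (auto intro!: continuous_intros)
next
  case (Suc k)
  have "((\<lambda>x. max 0 x ^ Suc (Suc k)) has_field_derivative (real (Suc (Suc k)) * max 0 x ^ Suc k)) (at x)"
    for x :: real
  proof -
    consider "x < 0" | "x > 0" | "x = 0" by linarith
    then show ?thesis
    proof cases
      case 1
      show ?thesis
        by (rule has_field_derivative_transform_within_open[where S="{..<0}" and f = "\<lambda>x. 0"])
          (use 1 in auto)
    next
      case 2
      have "((\<lambda>x. x ^ Suc (Suc k)) has_field_derivative (real (Suc (Suc k)) * x ^ Suc k)) (at x)"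
        by (rule derivative_eq_intros refl | simp)+
      then have "((\<lambda>x. x ^ Suc (Suc k)) has_field_derivative (real (Suc (Suc k)) * max 0 x ^ Suc k)) (at x)"
        using 2 by simp
      then show ?thesis
        by (rule has_field_derivative_transform_within_open[where S="{0<..}"]) (use 2 in auto)
    next
      case 3
      have "((\<lambda>h::real. max 0 h ^ Suc k) \<longlongrightarrow> max 0 0 ^ Suc k) (at 0)"
        by (intro tendsto_power tendsto_max tendsto_const tendsto_ident_at)
      moreover have "max 0 h ^ Suc k = max 0 h ^ Suc (Suc k) / h" if "h \<noteq> 0" for h :: real
        using that by (cases "h > 0") (auto simp: max_def)
      then have "\<forall>\<^sub>F h::real in at 0. max 0 h ^ Suc k = max 0 h ^ Suc (Suc k) / h"
        by (auto simp: eventually_at_filter intro!: always_eventually simp del: power_Suc)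
      ultimately have "((\<lambda>h::real. max 0 h ^ Suc (Suc k) / h) \<longlongrightarrow> max 0 0 ^ Suc k) (at 0)"
        by (rule Lim_transform_eventually)
      then show ?thesis using 3 by (simp add: has_field_derivative_iff)
    qed
  qed
  then show ?case
    unfolding has_field_derivative_def
    by (rule Ck_on_SucI[OF open_UNIV]) (intro Ck_on_mult open_UNIV Ck_on_const Suc)
qed

lemma bounded_bilinear_matrix_vector_mult:
  "bounded_bilinear (\<lambda>(A::real^'n^'m) (x::real^'n). A *v x)"
proof (rule bilinear_conv_bounded_bilinear[THEN iffD1])
  show "bilinear (\<lambda>(A::real^'n^'m) (x::real^'n). A *v x)"
    unfolding bilinear_def linear_iff
    by (auto simp: matrix_vector_right_distrib matrix_vector_mult_add_rdistrib
        matrix_vector_mult_def vec_eq_iff sum_distrib_left algebra_simps sum.distrib)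
qed

lemma bounded_bilinear_matrix_matrix_mult:
  "bounded_bilinear (\<lambda>(A::real^'n^'m) (B::real^'p^'n). A ** B)"
proof (rule bilinear_conv_bounded_bilinear[THEN iffD1])
  show "bilinear (\<lambda>(A::real^'n^'m) (B::real^'p^'n). A ** B)"
    unfolding bilinear_def linear_iff
    by (auto simp: matrix_matrix_mult_def vec_eq_iff sum_distrib_left algebra_simps sum.distrib)
qed

lemmas Ck_on_matrix_vector_mult = Ck_on_bilinear[OF bounded_bilinear_matrix_vector_mult]
lemmas Ck_on_matrix_mult = Ck_on_bilinear[OF bounded_bilinear_matrix_matrix_mult]

section \<open>Differentiability of spectral projections\<close>

text \<open>Differentiability at a zero makes \<open>f\<close> of order \<open>norm (y - a)\<close>,
  and the factor \<open>g\<close> turns this into little-o. It absorbs the error of freezing a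
  coefficient that is merely continuous.\<close>

lemma has_derivative_zero_product:
  assumes f: "(f has_derivative f') (at a)" "f a = 0" and g: "(g \<longlongrightarrow> (0::real)) (at a)" "\<And>y. 0 \<le> g y"
    and e: "\<forall>\<^sub>F y in at a. norm (e y) \<le> norm (f y) * g y" "e a = 0"
  shows "(e has_derivative (\<lambda>_. 0)) (at a)"
proof -
  obtain B where B: "\<And>y. norm (f' y) \<le> norm y * B"
    using bounded_linear.bounded[OF has_derivative_bounded_linear[OF f(1)]] by blast
  have q: "((\<lambda>y. norm (f y - f a - f' (y - a)) / norm (y - a)) \<longlongrightarrow> 0) (at a)"
    using f(1) by (simp add: has_derivative_iff_norm)
  have lim: "((\<lambda>y. (norm (f y - f a - f' (y - a)) / norm (y - a) + B) * g y) \<longlongrightarrow> (0 + B) * 0) (at a)"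
    by (intro tendsto_intros q g(1))
  have "\<forall>\<^sub>F y in at a. norm (e y - e a - 0) / norm (y - a) \<le>
      (norm (f y - f a - f' (y - a)) / norm (y - a) + B) * g y"
    using e(1) eventually_neq_at_within[of a a UNIV]
  proof eventually_elim
    case (elim y)
    have "norm (f y) \<le> norm (f y - f' (y - a)) + norm (f' (y - a))"
      by (metis add.commute norm_triangle_sub)
    also have "\<dots> \<le> norm (f y - f' (y - a)) + norm (y - a) * B" using B by simp
    finally have le: "norm (f y) / norm (y - a) \<le> norm (f y - f' (y - a)) / norm (y - a) + B"
      using elim(2) by (simp add: field_simps)
    have "norm (e y) / norm (y - a) \<le> norm (f y) / norm (y - a) * g y"
      using elim by (simp add: divide_simps)
    also have "\<dots> \<le> (norm (f y - f' (y - a)) / norm (y - a) + B) * g y"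
      by (intro mult_right_mono le g)
    finally show ?case using e(2) f(2) by simp
  qed
  then have "\<forall>\<^sub>F y in at a. norm (norm (e y - e a - 0) / norm (y - a)) \<le>
      (norm (f y - f a - f' (y - a)) / norm (y - a) + B) * g y"
    by simp
  from Lim_null_comparison[OF this] lim
  have "((\<lambda>y. norm (e y - e a - 0) / norm (y - a)) \<longlongrightarrow> 0) (at a)" by simp
  then show ?thesis by (simp add: has_derivative_iff_norm)
qed

lemma coercive_norm_le:
  fixes x r :: "'a::real_inner"
  assumes "\<gamma> > 0" "\<gamma> * (x \<bullet> x) \<le> x \<bullet> r"
  shows "norm x \<le> norm r / \<gamma>"
proof (cases "x = 0")
  case False
  have "\<gamma> * (norm x * norm x) \<le> norm x * norm r"
    using assms(2) norm_cauchy_schwarz[of x r] by (simp add: dot_square_norm power2_eq_square)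
  then show ?thesis using False assms(1) by (simp add: field_simps)
qed (use assms in simp)

lemma coercive_solution_differentiable:
  fixes x R :: "'a::real_normed_vector \<Rightarrow> 'b::euclidean_space" and P :: "'a \<Rightarrow> 'c::real_normed_vector"
  assumes bb: "bounded_bilinear \<beta>" and S: "open S" "a \<in> S" and \<gamma>: "\<gamma> > 0"
    and coercive: "\<And>w X. w \<in> S \<Longrightarrow> \<gamma> * (X \<bullet> X) \<le> X \<bullet> \<beta> (P w) X"
    and eq: "\<And>w. w \<in> S \<Longrightarrow> \<beta> (P w) (x w) = R w"
    and P: "isCont P a" and R: "(R has_derivative R') (at a)" "R a = 0"
  shows "\<exists>x'. (x has_derivative x') (at a) \<and> (\<forall>v. \<beta> (P a) (x' v) = R' v)"
proof -
  interpret bounded_bilinear \<beta> by fact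
  have bound: "norm (x w) \<le> norm (R w) / \<gamma>" if "w \<in> S" for w
    using coercive_norm_le[OF \<gamma>] coercive[OF that, of "x w"] eq[OF that] by simp
  have x0: "x a = 0" using bound[OF S(2)] R(2) by simp
  have lin: "linear (\<beta> (P a))"
    using bounded_linear_right by (rule bounded_linear.linear)
  moreover have "inj (\<beta> (P a))"
  proof (rule linear_injective_0[OF lin, THEN iffD2, rule_format])
    fix X assume "\<beta> (P a) X = 0"
    then show "X = 0"
      using coercive_norm_le[OF \<gamma>, of X 0] coercive[OF S(2), of X] by simp
  qed
  ultimately obtain Li where Li: "linear Li" "\<And>X. Li (\<beta> (P a) X) = X" "\<And>X. \<beta> (P a) (Li X) = X"
    using linear_injective_isomorphism by metis
  define e where "e w = \<beta> (P a - P w) (x w)" for w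
  obtain K where K: "K > 0" "\<And>u v. norm (\<beta> u v) \<le> norm u * norm v * K"
    using pos_bounded by blast
  have "(e has_derivative (\<lambda>_. 0)) (at a)"
  proof (rule has_derivative_zero_product[OF R])
    have "((\<lambda>w. norm (P a - P w) * (K / \<gamma>)) \<longlongrightarrow> norm (P a - P a) * (K / \<gamma>)) (at a)"
      using P unfolding isCont_def by (intro tendsto_intros)
    then show "((\<lambda>w. norm (P a - P w) * (K / \<gamma>)) \<longlongrightarrow> 0) (at a)" by simp
    show "0 \<le> norm (P a - P y) * (K / \<gamma>)" for y using K \<gamma> by simp
    have "norm (e w) \<le> norm (R w) * (norm (P a - P w) * (K / \<gamma>))" if "w \<in> S" for w
    proof -
      have "norm (e w) \<le> norm (P a - P w) * norm (x w) * K" unfolding e_def by (rule K)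
      also have "\<dots> \<le> norm (P a - P w) * (norm (R w) / \<gamma>) * K"
        using K bound[OF that] by (intro mult_right_mono mult_left_mono) auto
      finally show ?thesis by (simp add: field_simps)
    qed
    then show "\<forall>\<^sub>F w in at a. norm (e w) \<le> norm (R w) * (norm (P a - P w) * (K / \<gamma>))"
      using eventually_at_topological S by blast
    show "e a = 0" by (simp add: e_def zero_left)
  qed
  then have "((\<lambda>w. R w + e w) has_derivative (\<lambda>v. R' v + 0)) (at a)"
    using R(1) by (intro has_derivative_add)
  then have "((\<lambda>w. R w + e w) has_derivative R') (at a)" by simp
  then have "((\<lambda>w. \<beta> (P a) (x w)) has_derivative R') (at a)"
    by (rule has_derivative_transform_within_open[OF _ S]) (simp add: e_def diff_left eq)
  then have "((\<lambda>w. Li (\<beta> (P a) (x w))) has_derivative (\<lambda>v. Li (R' v))) (at a)"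
    by (rule bounded_linear.has_derivative[OF linear_conv_bounded_linear[THEN iffD1, OF Li(1)]])
  then show ?thesis using Li by auto
qed

text \<open>Each directional derivative of \<open>x\<close> solves an equation with the same
  coefficient \<open>P\<close>, whose right-hand side involves only \<open>x\<close> and first
  derivatives of the data, so the induction applies to it.\<close>

lemma Ck_on_coercive_solution:
  fixes x R :: "'a::real_normed_vector \<Rightarrow> 'b::euclidean_space" and P :: "'a \<Rightarrow> 'c::real_normed_vector"
  assumes bb: "bounded_bilinear \<beta>" and S: "open S" and \<gamma>: "\<gamma> > 0"
    and coercive: "\<And>w X. w \<in> S \<Longrightarrow> \<gamma> * (X \<bullet> X) \<le> X \<bullet> \<beta> (P w) X"
    and "\<And>w. w \<in> S \<Longrightarrow> \<beta> (P w) (x w) = R w"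
    and "Ck_on k P S" "Ck_on k R S"
  shows "Ck_on k x S"
  using assms(5-)
proof (induction k arbitrary: x R)
  case 0
  interpret bounded_bilinear \<beta> by fact
  have "isCont x a" if a: "a \<in> S" for a
  proof -
    have P: "(P \<longlongrightarrow> P a) (at a)" and R: "(R \<longlongrightarrow> R a) (at a)"
      using 0 a S by (simp_all add: continuous_on_eq_continuous_at isCont_def)
    have "((\<lambda>w. norm (R w - \<beta> (P w) (x a)) / \<gamma>) \<longlongrightarrow> norm (R a - \<beta> (P a) (x a)) / \<gamma>) (at a)"
      using \<gamma> by (intro tendsto_intros R tendsto P) auto
    then have lim: "((\<lambda>w. norm (R w - \<beta> (P w) (x a)) / \<gamma>) \<longlongrightarrow> 0) (at a)"
      using 0(1) a by simp
    have "norm (x w - x a) \<le> norm (R w - \<beta> (P w) (x a)) / \<gamma>" if "w \<in> S" for w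
      using coercive_norm_le[OF \<gamma>] coercive[OF that, of "x w - x a"] 0(1)[OF that]
      by (simp add: diff_right)
    then have "\<forall>\<^sub>F w in at a. norm (x w - x a) \<le> norm (R w - \<beta> (P w) (x a)) / \<gamma>"
      using eventually_at_topological S a by blast
    then have "((\<lambda>w. x w - x a) \<longlongrightarrow> 0) (at a)"
      by (rule Lim_null_comparison[OF _ lim])
    then show ?thesis by (simp add: isCont_def LIM_zero_iff)
  qed
  then show ?case by (simp add: continuous_at_imp_continuous_on)
next
  case (Suc k)
  interpret bounded_bilinear \<beta> by fact
  note kP = Suc.prems(2)[THEN Ck_on_SucD] and kR = Suc.prems(3)[THEN Ck_on_SucD]
  have kx: "Ck_on k x S" using Suc.IH Suc.prems(1) kP kR by blast
  let ?D = "\<lambda>f a. frechet_derivative f (at a)"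
  have *: "\<exists>x'. (x has_derivative x') (at a) \<and>
      (\<forall>v. \<beta> (P a) (x' v) = ?D R a v - \<beta> (?D P a v) (x a))" if a: "a \<in> S" for a
  proof -
    \<comment> \<open>Subtracting the constant \<open>x a\<close> makes the right-hand side vanish
      at \<open>a\<close>, as the pointwise lemma demands.\<close>
    have "\<exists>x'. ((\<lambda>w. x w - x a) has_derivative x') (at a) \<and>
      (\<forall>v. \<beta> (P a) (x' v) = ?D R a v - \<beta> (?D P a v) (x a))"
    proof (rule coercive_solution_differentiable[OF bb S a \<gamma> coercive])
      show "\<beta> (P w) (x w - x a) = R w - \<beta> (P w) (x a)" if "w \<in> S" for w
        using Suc.prems(1)[OF that] by (simp add: diff_right)
      show "isCont P a" using Ck_on_imp_continuous_on[OF kP] S a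
        by (simp add: continuous_on_eq_continuous_at)
      show "((\<lambda>w. R w - \<beta> (P w) (x a)) has_derivative (\<lambda>v. ?D R a v - \<beta> (?D P a v) (x a))) (at a)"
        by (intro has_derivative_diff bounded_linear.has_derivative[OF bounded_linear_left]
            Ck_on_SucE[OF Suc.prems(2) a] Ck_on_SucE[OF Suc.prems(3) a])
      show "R a - \<beta> (P a) (x a) = 0" using Suc.prems(1)[OF a] by simp
    qed auto
    then obtain x' where x': "((\<lambda>w. x w - x a) has_derivative x') (at a)"
      "\<And>v. \<beta> (P a) (x' v) = ?D R a v - \<beta> (?D P a v) (x a)" by blast
    have "((\<lambda>w. (x w - x a) + x a) has_derivative (\<lambda>v. x' v + 0)) (at a)"
      by (intro has_derivative_add x' has_derivative_const)
    then show ?thesis using x'(2) by auto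
  qed
  show ?case
  proof (rule Ck_on_SucI[OF S, of x "?D x"])
    show "(x has_derivative ?D x a) (at a)" if "a \<in> S" for a
      using *[OF that] by (metis frechet_derivative_eq)
    fix v
    show "Ck_on k (\<lambda>a. ?D x a v) S"
    proof (rule Suc.IH[OF _ kP])
      show "\<beta> (P w) (?D x w v) = ?D R w v - \<beta> (?D P w v) (x w)" if "w \<in> S" for w
        using *[OF that] by (metis frechet_derivative_eq)
      show "Ck_on k (\<lambda>w. ?D R w v - \<beta> (?D P w v) (x w)) S"
        using Suc.prems kx by (intro Ck_on_diff S Ck_on_bilinear[OF bb]) auto
    qed
  qed
qed


section \<open>Coercivity of matrix products and regularity of square roots\<close>

lemma inner_matrix_columns:
  fixes X Y :: "real^'n^'m"
  shows "X \<bullet> Y = (\<Sum>j\<in>UNIV. column j X \<bullet> column j Y)"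
  unfolding inner_vec_def column_def by (simp add: inner_real_def) (rule sum.swap)

text \<open>The inner product of matrices is the Frobenius one, and left multiplication acts on each
  column separately; multiplication from the right acts in the same way on rows.\<close>

lemma inner_matrix_mult_left_ge:
  fixes A :: "real^'n^'n" and X :: "real^'p^'n"
  assumes "\<And>x. \<gamma> * (x \<bullet> x) \<le> x \<bullet> (A *v x)"
  shows "\<gamma> * (X \<bullet> X) \<le> X \<bullet> (A ** X)"
proof -
  have "column j (A ** X) = A *v column j X" for j
    by (simp add: column_def matrix_matrix_mult_def matrix_vector_mult_def vec_eq_iff)
  then show ?thesis unfolding inner_matrix_columns sum_distrib_left
    by (auto intro!: sum_mono assms)
qed

lemma inner_matrix_mult_right_ge:
  fixes A :: "real^'n^'n" and X :: "real^'n^'m"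
  assumes "\<And>x. \<gamma> * (x \<bullet> x) \<le> x \<bullet> (A *v x)"
  shows "\<gamma> * (X \<bullet> X) \<le> X \<bullet> (X ** A)"
proof -
  have "\<gamma> * (X $ i \<bullet> X $ i) \<le> X $ i \<bullet> (X ** A) $ i" for i
  proof -
    have "(X ** A) $ i = transpose A *v (X $ i)"
      by (simp add: matrix_matrix_mult_def matrix_vector_mult_def transpose_def vec_eq_iff mult.commute)
    moreover have "X $ i \<bullet> (transpose A *v (X $ i)) = X $ i \<bullet> (A *v (X $ i))"
      by (metis dot_lmul_matrix inner_commute transpose_matrix_vector)
    ultimately show ?thesis using assms[of "X $ i"] by simp
  qed
  then show ?thesis unfolding inner_vec_def[of X] sum_distrib_left by (rule sum_mono)
qed

lemma bounded_bilinear_anticommutator: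
  "bounded_bilinear (\<lambda>(A::real^'n^'n) X. A ** X + X ** A)"
proof (rule bilinear_conv_bounded_bilinear[THEN iffD1])
  show "bilinear (\<lambda>(A::real^'n^'n) X. A ** X + X ** A)"
    unfolding bilinear_def linear_iff
    by (auto simp: matrix_matrix_mult_def vec_eq_iff sum_distrib_left algebra_simps sum.distrib)
qed

text \<open>The difference of two squares is half the anticommutator of the sum and the difference.
  The coefficient of that equation contains the unknown \<open>P\<close>, but only its continuity is
  used, and this comes from the same coercive bound. Once \<open>P\<close> is differentiable, P P' +
  P' P = Q' raises the regularity by one order.\<close>

lemma Ck_on_matrix_sqrt:
  fixes P :: "'a::real_normed_vector \<Rightarrow> real^'n^'n"
  assumes S: "open S" and \<gamma>: "\<gamma> > 0"
    and pos: "\<And>w x. w \<in> S \<Longrightarrow> \<gamma> * (x \<bullet> x) \<le> x \<bullet> (P w *v x)"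
    and "Ck_on k (\<lambda>w. P w ** P w) S"
  shows "Ck_on k P S"
proof -
  let ?\<beta> = "\<lambda>(A::real^'n^'n) X. A ** X + X ** A"
  interpret b: bounded_bilinear ?\<beta> by (rule bounded_bilinear_anticommutator)
  interpret m: bounded_bilinear "\<lambda>(A::real^'n^'n) (B::real^'n^'n). A ** B"
    by (rule bounded_bilinear_matrix_matrix_mult)
  define Q where "Q w = P w ** P w" for w
  \<comment> \<open>Left and right multiplication contribute \<gamma> each; the coefficient
    \<open>P w + P a\<close> below doubles this again.\<close>
  have coer: "(2 * \<gamma>) * (X \<bullet> X) \<le> X \<bullet> ?\<beta> (P w) X" if "w \<in> S" for w X
    using inner_matrix_mult_left_ge[OF pos[OF that], of X] inner_matrix_mult_right_ge[OF pos[OF that], of X]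
    by (simp add: inner_add_right)
  have coer2: "(4 * \<gamma>) * (X \<bullet> X) \<le> X \<bullet> ?\<beta> (P w + P a) X" if "w \<in> S" "a \<in> S" for w a X
  proof -
    have "?\<beta> (P w + P a) X = ?\<beta> (P w) X + ?\<beta> (P a) X" by (rule b.add_left)
    then show ?thesis using coer[OF that(1), of X] coer[OF that(2), of X]
      by (simp add: inner_add_right)
  qed
  \<comment> \<open>a linear equation for the increment of \<open>P\<close>, in which \<open>Q\<close> is already known to be smooth\<close>
  have eq: "?\<beta> (P w + P a) (P w - P a) = 2 *\<^sub>R (Q w - Q a)" for w a
    by (simp add: Q_def m.add_left m.add_right m.diff_left m.diff_right scaleR_2)
  have g4: "4 * \<gamma> > 0" and g2: "2 * \<gamma> > 0" using \<gamma> by auto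
  have base: "isCont P a" if a: "a \<in> S" and Q: "isCont Q a" for a
  proof -
    have "((\<lambda>w. norm (2 *\<^sub>R (Q w - Q a)) / (4 * \<gamma>)) \<longlongrightarrow> norm (2 *\<^sub>R (Q a - Q a)) / (4 * \<gamma>)) (at a)"
      using \<gamma> Q unfolding isCont_def by (intro tendsto_intros) auto
    then have lim: "((\<lambda>w. norm (2 *\<^sub>R (Q w - Q a)) / (4 * \<gamma>)) \<longlongrightarrow> 0) (at a)" by simp
    have "norm (P w - P a) \<le> norm (2 *\<^sub>R (Q w - Q a)) / (4 * \<gamma>)" if "w \<in> S" for w
      using coercive_norm_le[OF g4] coer2[OF that a, of "P w - P a"] eq by metis
    then have "\<forall>\<^sub>F w in at a. norm (P w - P a) \<le> norm (2 *\<^sub>R (Q w - Q a)) / (4 * \<gamma>)"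
      using eventually_at_topological S a by blast
    then have "((\<lambda>w. P w - P a) \<longlongrightarrow> 0) (at a)"
      by (rule Lim_null_comparison[OF _ lim])
    then show ?thesis by (simp add: isCont_def LIM_zero_iff)
  qed
  show ?thesis
    using assms(4)
  proof (induction k)
    case 0
    then have "isCont Q a" if "a \<in> S" for a
      using S that by (simp add: continuous_on_eq_continuous_at Q_def[abs_def])
    then show ?case using base by (simp add: continuous_at_imp_continuous_on)
  next
    case (Suc k)
    have Qk: "Ck_on (Suc k) Q S" using Suc.prems by (simp add: Q_def[abs_def])
    have Pk: "Ck_on k P S" using Suc.IH Ck_on_SucD[OF Suc.prems] by blast
    have cont: "isCont P a" if "a \<in> S" for a
      using Ck_on_imp_continuous_on[OF Pk] S that by (simp add: continuous_on_eq_continuous_at)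
    let ?D = "\<lambda>f a. frechet_derivative f (at a)"
    have *: "\<exists>P'. (P has_derivative P') (at a) \<and> (\<forall>v. ?\<beta> (P a) (P' v) = ?D Q a v)" if a: "a \<in> S" for a
    proof -
      have "\<exists>x'. ((\<lambda>w. P w - P a) has_derivative x') (at a) \<and>
        (\<forall>v. ?\<beta> (P a + P a) (x' v) = 2 *\<^sub>R ?D Q a v)"
      proof (rule coercive_solution_differentiable[OF bounded_bilinear_anticommutator S a g4,
            where P = "\<lambda>w. P w + P a" and R = "\<lambda>w. 2 *\<^sub>R (Q w - Q a)"])
        show "4 * \<gamma> * (X \<bullet> X) \<le> X \<bullet> ?\<beta> (P w + P a) X" if "w \<in> S" for w X
          by (rule coer2[OF that a])
        show "?\<beta> (P w + P a) (P w - P a) = 2 *\<^sub>R (Q w - Q a)" for w by (rule eq)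
        show "isCont (\<lambda>w. P w + P a) a" using cont[OF a] by (intro continuous_intros)
        have "((\<lambda>w. 2 *\<^sub>R (Q w - Q a)) has_derivative (\<lambda>v. 2 *\<^sub>R (?D Q a v - 0))) (at a)"
          by (intro derivative_intros Ck_on_SucE[OF Qk a])
        then show "((\<lambda>w. 2 *\<^sub>R (Q w - Q a)) has_derivative (\<lambda>v. 2 *\<^sub>R ?D Q a v)) (at a)" by simp
      qed simp
      then obtain x' where x': "((\<lambda>w. P w - P a) has_derivative x') (at a)"
        "\<And>v. ?\<beta> (P a + P a) (x' v) = 2 *\<^sub>R ?D Q a v" by blast
      have "((\<lambda>w. (P w - P a) + P a) has_derivative (\<lambda>v. x' v + 0)) (at a)"
        by (intro has_derivative_add x' has_derivative_const)
      moreover have "?\<beta> (P a) (x' v) = ?D Q a v" for v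
      proof -
        have "2 *\<^sub>R ?\<beta> (P a) (x' v) = 2 *\<^sub>R ?D Q a v"
          using x'(2)[of v] unfolding m.add_left m.add_right scaleR_2 by (simp add: add_ac)
        then show ?thesis by simp
      qed
      ultimately show ?thesis by auto
    qed
    show ?case
    proof (rule Ck_on_SucI[OF S, of P "?D P"])
      show "(P has_derivative ?D P a) (at a)" if "a \<in> S" for a
        using *[OF that] by (metis frechet_derivative_eq)
      show "Ck_on k (\<lambda>a. ?D P a v) S" for v
      proof (rule Ck_on_coercive_solution[OF bounded_bilinear_anticommutator S g2, where P = P and R = "\<lambda>w. ?D Q w v"])
        show "(2 * \<gamma>) * (X \<bullet> X) \<le> X \<bullet> ?\<beta> (P w) X" if "w \<in> S" for w X
          by (rule coer[OF that])
        show "Ck_on k P S" by (rule Pk)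
        show "?\<beta> (P w) (?D P w v) = ?D Q w v" if "w \<in> S" for w
          using *[OF that] by (metis frechet_derivative_eq)
        show "Ck_on k (\<lambda>w. ?D Q w v) S" using Qk by simp
      qed
    qed
  qed
qed

section \<open>Functional calculus in a moving eigenbasis\<close>

text \<open>Algebra of matrices with a common eigenbasis reduces to pointwise operations on
  \<open>d\<close>, so identities can be checked for each \<open>w\<close> although \<open>T\<close>
  and \<open>d\<close> may be discontinuous in \<open>w\<close>.\<close>

definition spec_mat :: "real^'n^'n \<Rightarrow> ('n \<Rightarrow> real) \<Rightarrow> real^'n^'n" where
  "spec_mat T d = T ** (\<chi> i j. if i = j then d i else 0) ** transpose T"

lemma orthogonal_matrixD:
  fixes T :: "real^'n^'n"
  assumes "orthogonal_matrix T"
  shows "T ** transpose T = mat 1" "transpose T ** T = mat 1"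
    "T *v (transpose T *v x) = x" "transpose T *v (T *v x) = x"
    "norm (transpose T *v x) = norm x" "norm (T *v x) = norm x"
proof -
  show *: "T ** transpose T = mat 1" "transpose T ** T = mat 1"
    using assms by (auto simp: orthogonal_matrix_def)
  show "T *v (transpose T *v x) = x" "transpose T *v (T *v x) = x"
    by (simp_all add: matrix_vector_mul_assoc * del: transpose_matrix_vector)
  have "orthogonal_transformation (\<lambda>x. T *v x)" "orthogonal_transformation (\<lambda>x. transpose T *v x)"
    using assms by (auto simp: orthogonal_transformation_matrix simp del: transpose_matrix_vector)
  then show "norm (transpose T *v x) = norm x" "norm (T *v x) = norm x"
    by (auto intro: orthogonal_transformation_norm)
qed

lemma spec_mat_mv:
  fixes T :: "real^'n^'n"
  shows "spec_mat T d *v x = T *v (\<chi> i. d i * (transpose T *v x) $ i)"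
proof -
  have "((\<chi> i j. if i = j then d i else 0) :: real^'n^'n) *v y = (\<chi> i. d i * y $ i)" for y :: "real^'n"
    by (simp add: matrix_vector_mult_def vec_eq_iff if_distrib if_distribR cong: if_cong)
  then show ?thesis by (simp add: spec_mat_def flip: matrix_vector_mul_assoc)
qed

lemma spec_mat_inner:
  "x \<bullet> (spec_mat T d *v y) = (\<Sum>i\<in>UNIV. d i * (transpose T *v x) $ i * (transpose T *v y) $ i)"
proof -
  have "x \<bullet> (T *v u) = (transpose T *v x) \<bullet> u" for u
    by (simp add: dot_lmul_matrix)
  then show ?thesis by (simp add: spec_mat_mv inner_vec_def mult_ac)
qed

lemma spec_mat_mult:
  assumes "orthogonal_matrix T"
  shows "spec_mat T d ** spec_mat T e = spec_mat T (\<lambda>i. d i * e i)"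
  unfolding matrix_eq matrix_vector_mul_assoc[symmetric] spec_mat_mv orthogonal_matrixD[OF assms]
  by (simp add: mult_ac)

lemma spec_mat_const:
  assumes "orthogonal_matrix T"
  shows "spec_mat T (\<lambda>i. c) = mat c"
  unfolding matrix_eq spec_mat_mv
proof
  fix x
  have "(\<chi> i. c * (transpose T *v x) $ i) = c *\<^sub>R (transpose T *v x)" by (simp add: vec_eq_iff)
  moreover have "mat c *v x = c *\<^sub>R x"
    by (simp add: mat_def matrix_vector_mult_def vec_eq_iff if_distrib if_distribR cong: if_cong)
  ultimately show "T *v (\<chi> i. c * (transpose T *v x) $ i) = mat c *v x"
    by (simp add: matrix_vector_mult_scaleR orthogonal_matrixD(3)[OF assms] del: transpose_matrix_vector)
qed

lemma spec_mat_add: "spec_mat T d + spec_mat T e = spec_mat T (\<lambda>i. d i + e i)"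
proof -
  have "(\<chi> i j. if i = j then d i + e i else 0) =
      (\<chi> i j. if i = j then d i else 0) + (\<chi> i j. if i = j then e i else (0::real))"
    by (simp add: vec_eq_iff)
  then show ?thesis
    by (simp add: spec_mat_def matrix_add_ldistrib bounded_bilinear.add_left[OF bounded_bilinear_matrix_matrix_mult])
qed

lemma spec_mat_scaleR: "c *\<^sub>R spec_mat T d = spec_mat T (\<lambda>i. c * d i)"
proof -
  have "(\<chi> i j. if i = j then c * d i else 0) = c *\<^sub>R (\<chi> i j. if i = j then d i else 0)"
    by (simp add: vec_eq_iff)
  then show ?thesis
    by (simp add: spec_mat_def bounded_bilinear.scaleR_left[OF bounded_bilinear_matrix_matrix_mult]
        bounded_bilinear.scaleR_right[OF bounded_bilinear_matrix_matrix_mult])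
qed

text \<open>With A the given matrix, |A| is the square root of A^2, sgn(A) solves the coercive
  equation |A| X = A, and the projection is (1 + sgn(A)) / 2. The gap is what makes |A| coercive.
  This takes the place of a contour integral of the resolvent.\<close>

lemma Ck_on_spectral_projection:
  fixes T :: "'a::real_normed_vector \<Rightarrow> real^'n^'n"
  assumes S: "open S" and \<gamma>: "\<gamma> > 0"
    and T: "\<And>w. w \<in> S \<Longrightarrow> orthogonal_matrix (T w)"
    and gap: "\<And>w i. w \<in> S \<Longrightarrow> \<gamma> \<le> \<bar>E w i\<bar>"
    and C: "Ck_on k (\<lambda>w. spec_mat (T w) (E w)) S"
  shows "Ck_on k (\<lambda>w. spec_mat (T w) (\<lambda>i. if E w i > 0 then 1 else 0)) S"
proof -
  let ?P = "\<lambda>w. spec_mat (T w) (\<lambda>i. \<bar>E w i\<bar>)" and ?S = "\<lambda>w. spec_mat (T w) (\<lambda>i. sgn (E w i))"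
  have pos: "\<gamma> * (x \<bullet> x) \<le> x \<bullet> (?P w *v x)" if "w \<in> S" for w x
  proof -
    let ?y = "transpose (T w) *v x"
    have "x \<bullet> x = ?y \<bullet> ?y"
      using orthogonal_matrixD(5)[OF T[OF that]] by (simp add: dot_square_norm)
    then show ?thesis
      using gap[OF that] unfolding spec_mat_inner
      by (simp add: inner_vec_def sum_distrib_left mult.assoc sum_mono mult_right_mono del: transpose_matrix_vector)
  qed
  have "Ck_on k (\<lambda>w. spec_mat (T w) (E w) ** spec_mat (T w) (E w)) S"
    by (intro Ck_on_matrix_mult S C)
  then have "Ck_on k (\<lambda>w. ?P w ** ?P w) S"
    by (rule Ck_on_cong[OF _ S]) (simp add: spec_mat_mult T)
  then have P: "Ck_on k ?P S" by (rule Ck_on_matrix_sqrt[OF S \<gamma>, rotated]) (rule pos)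
  have "Ck_on k ?S S"
  proof (rule Ck_on_coercive_solution[OF bounded_bilinear_matrix_matrix_mult S \<gamma> _ _ P C])
    show "\<gamma> * (X \<bullet> X) \<le> X \<bullet> (?P w ** X)" if "w \<in> S" for w and X :: "real^'n^'n"
      by (rule inner_matrix_mult_left_ge[OF pos[OF that]])
    show "?P w ** ?S w = spec_mat (T w) (E w)" if "w \<in> S" for w
      using spec_mat_mult[OF T[OF that]] by (simp add: abs_mult_sgn)
  qed
  then have "Ck_on k (\<lambda>w. (1/2) *\<^sub>R (mat 1 + ?S w)) S"
    by (intro Ck_on_scaleR Ck_on_add S Ck_on_const)
  then show ?thesis
  proof (rule Ck_on_cong[OF _ S])
    fix w assume w: "w \<in> S"
    have "sgn (E w i) = 2 * (if E w i > 0 then 1 else 0) - 1" for i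
      using gap[OF w, of i] \<gamma> by (auto simp: sgn_if)
    then have "(\<lambda>i. (1/2) * (1 + sgn (E w i))) = (\<lambda>i. if E w i > 0 then 1 else 0)"
      by (auto simp: fun_eq_iff)
    then show "(1/2) *\<^sub>R (mat 1 + ?S w) = spec_mat (T w) (\<lambda>i. if E w i > 0 then 1 else 0)"
      using spec_mat_const[OF T[OF w], of 1, symmetric] by (simp add: spec_mat_add spec_mat_scaleR)
  qed
qed

section \<open>Essential splittings of spheres\<close>

text \<open>If \<open>f\<close> fell below its initial value, let \<open>c\<close> be the last time
  at which \<open>f\<close> is at least an intermediate value \<open>y\<close>. A branch with value
  at least \<open>y\<close> at \<open>c\<close> stays above \<open>f\<close> afterwards; one below
  \<open>y\<close> at \<open>c\<close> is separated from \<open>f\<close> by continuity for a short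
  time. Being finitely many, the branches all miss \<open>f\<close> just after
  \<open>c\<close>.\<close>

lemma finite_monotone_branches_le:
  fixes f :: "real \<Rightarrow> real" and g :: "'i \<Rightarrow> real \<Rightarrow> real"
  assumes ab: "a \<le> b" and f: "continuous_on {a..b} f" and I: "finite I"
    and g: "\<And>i. i \<in> I \<Longrightarrow> continuous_on {a..b} (g i)"
    and mono: "\<And>i x y. i \<in> I \<Longrightarrow> a \<le> x \<Longrightarrow> x \<le> y \<Longrightarrow> y \<le> b \<Longrightarrow> g i x \<le> g i y"
    and branch: "\<And>t. t \<in> {a..b} \<Longrightarrow> \<exists>i\<in>I. f t = g i t"
  shows "f a \<le> f b"
proof (rule ccontr)
  assume "\<not> f a \<le> f b"
  then obtain y where y: "f b < y" "y < f a" using dense by (metis not_le)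
  define K where "K = {t \<in> {a..b}. y \<le> f t}"
  have "compact K"
    unfolding K_def using continuous_on_closed_Collect_le[OF continuous_on_const f]
    by (metis (no_types, lifting) Collect_cong closed_atLeastAtMost compact_eq_bounded_closed
        bounded_closed_interval bounded_subset mem_Collect_eq subsetI)
  moreover have "a \<in> K" using y ab by (simp add: K_def)
  ultimately obtain c where c: "c \<in> K" "\<And>t. t \<in> K \<Longrightarrow> t \<le> c"
    using compact_attains_sup[of K] by blast
  have cb: "a \<le> c" "c < b" using c(1) y by (auto simp: K_def less_le)
  have right: "f t < y" if "c < t" "t \<le> b" for t
    using c(2)[of t] that cb by (force simp: K_def)
  let ?F = "at c within {c<..<b}"
  have F: "(h \<longlongrightarrow> h c) ?F" if "continuous_on {a..b} h" for h :: "real \<Rightarrow> real"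
    using that cb
    by (auto simp: continuous_on_def intro: tendsto_within_subset[where S = "{a..b}"])
  have "\<forall>\<^sub>F t in ?F. \<forall>i\<in>I. f t \<noteq> g i t"
  proof (rule eventually_ball_finite[OF I], rule)
    fix i assume i: "i \<in> I"
    show "\<forall>\<^sub>F t in ?F. f t \<noteq> g i t"
    proof (cases "y \<le> g i c")
      case True
      have "f t \<noteq> g i t" if "t \<in> {c<..<b}" for t
        using mono[OF i, of c t] right[of t] that cb True by auto
      then show ?thesis by (auto simp: eventually_at_filter intro: always_eventually)
    next
      case False
      then have "g i c < f c" using c(1) by (simp add: K_def)
      then have "\<forall>\<^sub>F t in ?F. 0 < f t - g i t"
        by (intro order_tendstoD[OF tendsto_diff[OF F[OF f] F[OF g[OF i]]]]) simp
      then show ?thesis by eventually_elim simp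
    qed
  qed
  moreover have "\<forall>\<^sub>F t in ?F. t \<in> {c<..<b}" by (simp add: eventually_at_filter)
  ultimately have "\<forall>\<^sub>F t in ?F. False"
  proof eventually_elim
    case (elim t)
    then show ?case using branch[of t] cb by auto
  qed
  moreover have "?F \<noteq> bot"
    using islimpt_greaterThanLessThan1[OF cb(2)] by (simp add: trivial_limit_within)
  ultimately show False by simp
qed

text \<open>The box is spanned by 0 and \<open>w\<close>. Along the segment from \<open>u\<close> to
  \<open>w\<close> no coordinate decreases in absolute value, so every subset sum of squares is
  monotone there.\<close>

definition in_box :: "real^'n \<Rightarrow> real^'n \<Rightarrow> bool" where
  "in_box u w \<longleftrightarrow> (\<forall>j. 0 \<le> u $ j \<and> u $ j \<le> w $ j \<or> w $ j \<le> u $ j \<and> u $ j \<le> 0)"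

text \<open>\<open>\<rho> w\<close> is a subset sum of the squares of the coordinates of \<open>w\<close>. A priori the subset varies
  with \<open>w\<close>; essentiality of \<open>a + b\<close> forces it to be constant.\<close>

lemma norm_axis_real [simp]: "norm (axis i (x::real)) = \<bar>x\<bar>"
  by (simp add: norm_eq_sqrt_inner inner_axis_axis)

locale essential_splitting =
  fixes s :: real and a b :: "real^'n \<Rightarrow> real^'n" and \<rho> :: "real^'n \<Rightarrow> real"
  assumes s: "0 < s"
    and cont_a: "continuous_on (cball 0 s) a" and cont_b: "continuous_on (cball 0 s) b"
    and cont_\<rho>: "continuous_on (cball 0 s) \<rho>"
    and orth: "\<And>v w. v \<in> cball 0 s \<Longrightarrow> w \<in> cball 0 s \<Longrightarrow> a v \<bullet> b w = 0"
    and essential: "\<And>c. \<not> homotopic_with_canon (\<lambda>_. True) (sphere 0 s) (- {0}) (\<lambda>w. a w + b w) (\<lambda>_. c)"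
    and subset_sum: "\<And>w. w \<in> cball 0 s \<Longrightarrow> \<exists>A. \<rho> w = (\<Sum>i\<in>A. (w $ i)\<^sup>2)"
    and a_zero: "\<And>w. w \<in> cball 0 s \<Longrightarrow> a w = 0 \<longleftrightarrow> \<rho> w = 0"
    and b_zero: "\<And>w. w \<in> cball 0 s \<Longrightarrow> b w = 0 \<longleftrightarrow> \<rho> w = (norm w)\<^sup>2"
begin

lemma norm2_eq_sum: "(norm (w :: real^'n))\<^sup>2 = (\<Sum>i\<in>UNIV. (w $ i)\<^sup>2)"
  unfolding power2_norm_eq_inner inner_vec_def by (simp add: power2_eq_square)

text \<open>Complementation of the subset exchanges \<open>a\<close> and \<open>b\<close>. Every
  fact about \<open>\<rho> w = 0\<close> thus yields one about
  \<open>\<rho> w = (norm w)\<^sup>2\<close>.\<close>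

lemma swap: "essential_splitting s b a (\<lambda>w. (norm w)\<^sup>2 - \<rho> w)"
proof
  show "\<exists>A. (norm w)\<^sup>2 - \<rho> w = (\<Sum>i\<in>A. (w $ i)\<^sup>2)" if w: "w \<in> cball 0 s" for w
  proof -
    obtain A where "\<rho> w = (\<Sum>i\<in>A. (w $ i)\<^sup>2)" using subset_sum[OF w] by blast
    then have "(norm w)\<^sup>2 - \<rho> w = (\<Sum>i\<in>-A. (w $ i)\<^sup>2)"
      using sum.subset_diff[of A UNIV "\<lambda>i. (w $ i)\<^sup>2"] by (simp add: norm2_eq_sum Compl_eq_Diff_UNIV)
    then show ?thesis by blast
  qed
qed (use s cont_a cont_b cont_\<rho> orth essential a_zero b_zero
    in \<open>auto simp: inner_commute add.commute intro!: continuous_intros\<close>)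

lemma \<rho>_bounds: "w \<in> cball 0 s \<Longrightarrow> 0 \<le> \<rho> w" "w \<in> cball 0 s \<Longrightarrow> \<rho> w \<le> (norm w)\<^sup>2"
  using subset_sum[of w] unfolding norm2_eq_sum by (auto intro!: sum_nonneg sum_mono2)

text \<open>On the segment from \<open>u\<close> to \<open>w\<close> the function
  \<open>\<rho>\<close> always lies on one of finitely many nondecreasing subset sums, whichever
  subsets it switches between.\<close>

lemma \<rho>_mono:
  assumes u: "u \<in> cball 0 s" and w: "w \<in> cball 0 s" and box: "in_box u w"
  shows "\<rho> u \<le> \<rho> w"
proof -
  define p where "p t = (1 - t) *\<^sub>R u + t *\<^sub>R w" for t :: real
  have p: "p t \<in> cball 0 s" if "t \<in> {0..1}" for t
    using convexD_alt[OF convex_cball u w, of t] that by (simp add: p_def)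
  have contp: "continuous_on {0..1} p" unfolding p_def by (intro continuous_intros)
  have "\<rho> (p 0) \<le> \<rho> (p 1)"
  proof (rule finite_monotone_branches_le[where I = UNIV and g = "\<lambda>A t. \<Sum>i\<in>A. (p t $ i)\<^sup>2" and f = "\<lambda>t. \<rho> (p t)"])
    show "continuous_on {0..1} (\<lambda>t. \<rho> (p t))"
      using continuous_on_compose2[OF cont_\<rho> contp] p by blast
    show "continuous_on {0..1} (\<lambda>t. \<Sum>i\<in>A. (p t $ i)\<^sup>2)" for A
      unfolding p_def by (intro continuous_intros)
    show "(\<Sum>i\<in>A. (p x $ i)\<^sup>2) \<le> (\<Sum>i\<in>A. (p y $ i)\<^sup>2)" if "0 \<le> x" "x \<le> y" "y \<le> 1" for A x y
    proof (rule sum_mono)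
      fix i
      have pi: "p t $ i = u $ i + t * (w $ i - u $ i)" for t by (simp add: p_def algebra_simps)
      show "(p x $ i)\<^sup>2 \<le> (p y $ i)\<^sup>2"
      proof (cases "0 \<le> u $ i \<and> u $ i \<le> w $ i")
        case True
        then show ?thesis unfolding pi using that
          by (intro power_mono add_left_mono mult_right_mono) auto
      next
        case False
        then have "w $ i \<le> u $ i" "u $ i \<le> 0" using box by (auto simp: in_box_def)
        then have "(- u $ i + x * (u $ i - w $ i))\<^sup>2 \<le> (- u $ i + y * (u $ i - w $ i))\<^sup>2"
          using that by (intro power_mono add_left_mono mult_right_mono add_nonneg_nonneg mult_nonneg_nonneg) auto
        moreover have "(- u $ i + t * (u $ i - w $ i))\<^sup>2 = (p t $ i)\<^sup>2" for t
          unfolding pi power2_eq_square by (simp add: algebra_simps)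
        ultimately show ?thesis by simp
      qed
    qed
    show "\<exists>A\<in>UNIV. \<rho> (p t) = (\<Sum>i\<in>A. (p t $ i)\<^sup>2)" if "t \<in> {0..1}" for t
      using subset_sum[OF p[OF that]] by simp
  qed auto
  then show ?thesis by (simp add: p_def)
qed

lemma zero_shrink:
  "u \<in> cball 0 s \<Longrightarrow> w \<in> cball 0 s \<Longrightarrow> in_box u w \<Longrightarrow> \<rho> w = 0 \<Longrightarrow> \<rho> u = 0"
  using \<rho>_mono[of u w] \<rho>_bounds(1)[of u] by simp

lemma full_shrink:
  "u \<in> cball 0 s \<Longrightarrow> w \<in> cball 0 s \<Longrightarrow> in_box u w \<Longrightarrow> \<rho> w = (norm w)\<^sup>2 \<Longrightarrow> \<rho> u = (norm u)\<^sup>2"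
  using essential_splitting.zero_shrink[OF swap, of u w] by simp

text \<open>If no such \<open>w\<close> and \<open>t\<close> existed, moving the argument of \<open>a\<close> to \<open>u\<close> and then contracting \<open>b\<close>
  would make \<open>a + b\<close> null-homotopic.\<close>

lemma essential_witness:
  assumes u: "u \<in> sphere 0 s" "\<rho> u \<noteq> 0"
  shows "\<exists>w t. w \<in> sphere 0 s \<and> 0 \<le> t \<and> t \<le> 1 \<and> \<rho> w = (norm w)\<^sup>2 \<and>
    \<rho> ((1 - t) *\<^sub>R w + t *\<^sub>R u) = 0 \<and> (1 - t) *\<^sub>R w + t *\<^sub>R u \<in> cball 0 s"
proof (rule ccontr)
  assume contra: "\<not> ?thesis"
  have in_ball: "(1 - t) *\<^sub>R w + t *\<^sub>R u \<in> cball 0 s" if "w \<in> sphere 0 s" "0 \<le> t" "t \<le> 1" for w t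
    using convexD_alt[OF convex_cball, of w 0 s u t] that u by auto
  \<comment> \<open>Orthogonality holds for independent arguments \<open>v\<close> and
    \<open>w\<close>; hence the sum vanishes only if both terms do.\<close>
  have nz: "a v + b w \<noteq> 0" if "v \<in> cball 0 s" "w \<in> cball 0 s" "a v \<noteq> 0 \<or> b w \<noteq> 0" for v w
  proof
    assume *: "a v + b w = 0"
    have "a v \<bullet> (a v + b w) = a v \<bullet> a v" "(a v + b w) \<bullet> b w = b w \<bullet> b w"
      using orth[OF that(1,2)] by (simp_all add: inner_add_right inner_add_left)
    then show False using * that(3) by simp
  qed
  have cont1: "continuous_on ({0..1} \<times> sphere 0 s) (\<lambda>(t, w). a ((1 - t) *\<^sub>R w + t *\<^sub>R u) + b w)"
    unfolding case_prod_beta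
    by (intro continuous_on_add continuous_on_compose2[OF cont_a] continuous_on_compose2[OF cont_b] continuous_intros)
      (use in_ball in auto)
  have "homotopic_with_canon (\<lambda>_. True) (sphere 0 s) (- {0}) (\<lambda>w. a w + b w) (\<lambda>w. a u + b w)"
    unfolding homotopic_with_def
  proof (intro exI[of _ "\<lambda>(t, w). a ((1 - t) *\<^sub>R w + t *\<^sub>R u) + b w"] conjI)
    have "a ((1 - t) *\<^sub>R w + t *\<^sub>R u) + b w \<noteq> 0" if "w \<in> sphere 0 s" "0 \<le> t" "t \<le> 1" for w t
    proof (rule nz)
      have w: "w \<in> cball 0 s" using that by simp
      have "\<not> (\<rho> w = (norm w)\<^sup>2 \<and> \<rho> ((1 - t) *\<^sub>R w + t *\<^sub>R u) = 0)"
        using contra in_ball[OF that] that by blast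
      then show "a ((1 - t) *\<^sub>R w + t *\<^sub>R u) \<noteq> 0 \<or> b w \<noteq> 0"
        using a_zero b_zero in_ball[OF that] w by blast
    qed (use that in_ball in auto)
    then show "continuous_map (prod_topology (top_of_set {0..1}) (top_of_set (sphere 0 s))) (top_of_set (- {0}))
       (\<lambda>(t, w). a ((1 - t) *\<^sub>R w + t *\<^sub>R u) + b w)"
      using cont1 by (auto simp: continuous_map_subtopology_eu subtopology_Times[symmetric] euclidean_product_topology)
  qed auto
  moreover have "homotopic_with_canon (\<lambda>_. True) (sphere 0 s) (- {0}) (\<lambda>w. a u + b w) (\<lambda>w. a u)"
  proof (rule homotopic_with_linear)
    show "continuous_on (sphere 0 s) (\<lambda>w. a u + b w)"
      by (intro continuous_intros continuous_on_subset[OF cont_b]) auto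
    show "closed_segment (a u + b w) (a u) \<subseteq> - {0}" if "w \<in> sphere 0 s" for w
    proof -
      have au: "a u \<noteq> 0" using a_zero[of u] u by auto
      have "(1 - t) *\<^sub>R (a u + b w) + t *\<^sub>R a u \<noteq> 0" for t
      proof
        assume "(1 - t) *\<^sub>R (a u + b w) + t *\<^sub>R a u = 0"
        then have "a u \<bullet> ((1 - t) *\<^sub>R (a u + b w) + t *\<^sub>R a u) = 0" by simp
        then have "a u \<bullet> a u = 0"
          using orth[of u w] u that by (simp add: inner_add_right algebra_simps)
        then show False using au by simp
      qed
      then show ?thesis by (auto simp: closed_segment_def)
    qed
  qed auto
  ultimately have "homotopic_with_canon (\<lambda>_. True) (sphere 0 s) (- {0}) (\<lambda>w. a w + b w) (\<lambda>w. a u)"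
    by (rule homotopic_with_trans)
  then show False using essential by blast
qed

lemma \<rho>_axis: "\<bar>\<sigma>\<bar> \<le> s \<Longrightarrow> \<rho> (axis i \<sigma>) = 0 \<or> \<rho> (axis i \<sigma>) = \<sigma>\<^sup>2"
proof -
  assume "\<bar>\<sigma>\<bar> \<le> s"
  then obtain A where "\<rho> (axis i \<sigma>) = (\<Sum>j\<in>A. (axis i \<sigma> $ j)\<^sup>2)"
    using subset_sum[of "axis i \<sigma>"] by auto
  also have "\<dots> = (\<Sum>j\<in>A. if j = i then \<sigma>\<^sup>2 else 0)" by (rule sum.cong) (auto simp: axis_def)
  also have "\<dots> = (if i \<in> A then \<sigma>\<^sup>2 else 0)" by simp
  finally show ?thesis by simp
qed

lemma in_box_axis: "\<tau> = (1 - t) * w $ j \<Longrightarrow> 0 \<le> t \<Longrightarrow> t \<le> 1 \<Longrightarrow> in_box (axis j \<tau>) w"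
proof -
  assume \<tau>: "\<tau> = (1 - t) * w $ j" "0 \<le> t" "t \<le> 1"
  have "0 \<le> \<tau> \<and> \<tau> \<le> w $ j \<or> w $ j \<le> \<tau> \<and> \<tau> \<le> 0"
  proof (cases "0 \<le> w $ j")
    case True
    then show ?thesis using \<tau> by (simp add: mult_left_le_one_le)
  next
    case False
    then have "0 \<le> t * - (w $ j)" "(1 - t) * w $ j \<le> 0"
      using \<tau> by (auto intro: mult_nonneg_nonpos mult_nonneg_nonneg)
    then show ?thesis using \<tau> by (simp add: algebra_simps)
  qed
  then show ?thesis by (auto simp: in_box_def axis_def)
qed

text \<open>Take the witness \<open>w\<close> and the point \<open>?y\<close> on the segment from
  \<open>w\<close> to \<open>axis i \<sigma>\<close>. A coordinate of \<open>?y\<close> off the axis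
  is a shrunken coordinate of \<open>w\<close>, so it is full because of \<open>w\<close> and null
  because of \<open>?y\<close>, hence 0. Thus \<open>w\<close> lies on the axis, and both of its
  possible positions are excluded.\<close>

lemma axis_opposite:
  assumes \<sigma>: "\<bar>\<sigma>\<bar> = s" and full: "\<rho> (axis i \<sigma>) \<noteq> 0"
  shows "\<rho> (axis i (- \<sigma>)) \<noteq> 0"
proof
  assume opp: "\<rho> (axis i (- \<sigma>)) = 0"
  let ?u = "axis i \<sigma>"
  have "?u \<in> sphere 0 s" using \<sigma> by simp
  from essential_witness[OF this full] obtain w t where w: "w \<in> sphere 0 s" "0 \<le> t" "t \<le> 1"
    "\<rho> w = (norm w)\<^sup>2" and y: "\<rho> ((1 - t) *\<^sub>R w + t *\<^sub>R ?u) = 0" "(1 - t) *\<^sub>R w + t *\<^sub>R ?u \<in> cball 0 s"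
    by blast
  let ?y = "(1 - t) *\<^sub>R w + t *\<^sub>R ?u"
  have y0: "?y $ j = 0" if "j \<noteq> i" for j
  proof -
    let ?v = "axis j (?y $ j)"
    have yj: "?y $ j = (1 - t) * w $ j" using that by (simp add: axis_def)
    have v: "?v \<in> cball 0 s" using y(2) component_le_norm_cart[of ?y j] by simp
    have wb: "w \<in> cball 0 s" using w(1) by simp
    have "\<rho> ?v = (norm ?v)\<^sup>2" by (rule full_shrink[OF v wb in_box_axis[OF yj w(2,3)] w(4)])
    moreover have "in_box ?v ?y" by (rule in_box_axis[of _ 0]) auto
    then have "\<rho> ?v = 0" by (rule zero_shrink[OF v y(2) _ y(1)])
    ultimately have "(?y $ j)\<^sup>2 = 0" by (simp only: norm_axis_real power2_abs)
    then show ?thesis by (simp only: power_eq_0_iff)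
  qed
  have t: "t \<noteq> 1" using y(1) full by auto
  then have "w $ j = 0" if "j \<noteq> i" for j using y0[OF that] that by (simp add: axis_def)
  then have wi: "w = axis i (w $ i)" by (auto simp: vec_eq_iff axis_def)
  then have "\<bar>w $ i\<bar> = \<bar>\<sigma>\<bar>" using w(1) \<sigma> by (metis mem_sphere_0 norm_axis_real)
  then consider "w = ?u" | "w = axis i (- \<sigma>)" using wi by (metis abs_eq_iff)
  then show False
  proof cases
    case 1
    then have "?y = ?u" by (simp add: algebra_simps flip: scaleR_add_left)
    then show False using y(1) full by simp
  next
    case 2
    then show False using opp w(1,4) s by simp
  qed
qed

text \<open>For a point \<open>u\<close> of the sphere in the subspace of \<open>A\<close> that is
  not full, the swapped witness \<open>w\<close> is null and so has no coordinates in
  \<open>A\<close>, while the full point on the segment has none outside \<open>A\<close>. Since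
  \<open>u\<close> has none there either, \<open>w\<close> would be 0.\<close>

lemma coordinate_subspace:
  assumes zero: "\<And>i \<tau>. i \<notin> A \<Longrightarrow> \<bar>\<tau>\<bar> \<le> s \<Longrightarrow> \<rho> (axis i \<tau>) = 0"
    and full: "\<And>i \<tau>. i \<in> A \<Longrightarrow> \<bar>\<tau>\<bar> \<le> s \<Longrightarrow> \<rho> (axis i \<tau>) = \<tau>\<^sup>2"
    and w: "w \<in> cball 0 s"
  shows "(\<Sum>i\<in>A. (w $ i)\<^sup>2) \<le> \<rho> w"
proof -
  interpret sw: essential_splitting s b a "\<lambda>w. (norm w)\<^sup>2 - \<rho> w" by (rule swap)
  have sphere: "\<rho> u = (norm u)\<^sup>2" if u: "u \<in> sphere 0 s" and uA: "\<And>j. j \<notin> A \<Longrightarrow> u $ j = 0" for u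
  proof (rule ccontr)
    assume nfull: "\<rho> u \<noteq> (norm u)\<^sup>2"
    then have "(norm u)\<^sup>2 - \<rho> u \<noteq> 0" by simp
    from sw.essential_witness[OF u this] obtain w t where w': "w \<in> sphere 0 s" "0 \<le> t" "t \<le> 1"
      "(norm w)\<^sup>2 - \<rho> w = (norm w)\<^sup>2"
      and y': "(norm ((1 - t) *\<^sub>R w + t *\<^sub>R u))\<^sup>2 - \<rho> ((1 - t) *\<^sub>R w + t *\<^sub>R u) = 0"
        "(1 - t) *\<^sub>R w + t *\<^sub>R u \<in> cball 0 s"
      by (elim exE conjE)
    have w: "w \<in> sphere 0 s" "0 \<le> t" "t \<le> 1" "\<rho> w = 0" using w' by simp_all
    have y: "\<rho> ((1 - t) *\<^sub>R w + t *\<^sub>R u) = (norm ((1 - t) *\<^sub>R w + t *\<^sub>R u))\<^sup>2"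
        "(1 - t) *\<^sub>R w + t *\<^sub>R u \<in> cball 0 s" using y' by simp_all
    let ?y = "(1 - t) *\<^sub>R w + t *\<^sub>R u"
    have le: "\<bar>v $ j\<bar> \<le> s" if "v \<in> cball 0 s" for v :: "real^'n" and j
      using component_le_norm_cart[of v j] that by simp
    have w0: "w $ j = 0" if "j \<in> A" for j
    proof -
      have "in_box (axis j (w $ j)) w" by (rule in_box_axis[of _ 0]) auto
      then have "\<rho> (axis j (w $ j)) = 0"
        using zero_shrink[OF _ _ _ w(4)] w(1) le[of w j] by simp
      then show ?thesis using full[OF that le[of w j]] w(1) by simp
    qed
    have y0: "?y $ j = 0" if "j \<notin> A" for j
    proof -
      have "in_box (axis j (?y $ j)) ?y" by (rule in_box_axis[of _ 0]) auto
      then have "\<rho> (axis j (?y $ j)) = (norm (axis j (?y $ j)))\<^sup>2"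
        using full_shrink[OF _ y(2) _ y(1)] le[OF y(2), of j] by simp
      then show ?thesis using zero[OF that le[OF y(2)]] by simp
    qed
    have t: "t \<noteq> 1" using y(1) nfull by auto
    have "w $ j = 0" for j
      using w0 y0[of j] uA[of j] t by (cases "j \<in> A") auto
    then have "w = 0" by (simp add: vec_eq_iff)
    then show False using w(1) s by simp
  qed
  \<comment> \<open>For general \<open>w\<close>, project to the subspace of \<open>A\<close> and
    stretch to the sphere: fullness shrinks back from the sphere to \<open>v\<close>, and
    monotonicity carries the bound from \<open>v\<close> to \<open>w\<close>.\<close>
  define v where "v = (\<chi> j. if j \<in> A then w $ j else 0)"
  have v2: "(norm v)\<^sup>2 = (\<Sum>i\<in>A. (w $ i)\<^sup>2)"
    unfolding norm2_eq_sum by (rule sum.mono_neutral_cong_right) (auto simp: v_def)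
  have box: "in_box v w" by (auto simp: in_box_def v_def)
  have "(norm v)\<^sup>2 \<le> (norm w)\<^sup>2"
    unfolding v2 norm2_eq_sum[of w] by (rule sum_mono2) auto
  then have nv: "norm v \<le> norm w" by simp
  then have v: "v \<in> cball 0 s" using w by simp
  have "\<rho> v = (norm v)\<^sup>2"
  proof (cases "v = 0")
    case True
    then show ?thesis using \<rho>_bounds[OF v] by simp
  next
    case False
    let ?u = "(s / norm v) *\<^sub>R v"
    have u: "?u \<in> sphere 0 s" using s False by simp
    have fu: "\<rho> ?u = (norm ?u)\<^sup>2" by (rule sphere[OF u]) (simp add: v_def)
    have bu: "in_box v ?u"
    proof -
      have v_eq: "v $ j = (1 - (1 - norm v / s)) * ?u $ j" for j using s False by simp
      have box_j: "in_box (axis j (v $ j)) ?u" for j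
        by (rule in_box_axis[OF v_eq]) (use s v in \<open>auto simp: field_simps\<close>)
      show ?thesis unfolding in_box_def
      proof
        show "0 \<le> v $ j \<and> v $ j \<le> ?u $ j \<or> ?u $ j \<le> v $ j \<and> v $ j \<le> 0" for j
          using box_j[of j, unfolded in_box_def, rule_format, of j] by (simp add: axis_def)
      qed
    qed
    have "?u \<in> cball 0 s" using u by (simp only: mem_sphere_0 mem_cball_0)
    from full_shrink[OF v this bu fu] show ?thesis .
  qed
  then show ?thesis using \<rho>_mono[OF v w box] v2 by simp
qed

text \<open>The lower bounds for \<open>A\<close> and, after swapping, for its complement add up to
  \<open>(norm w)\<^sup>2\<close>, so both are equalities. \<open>axis_opposite\<close> ensures that
  the test at \<open>axis i s\<close> decides both half-axes.\<close>

theorem subset_constant: "\<exists>A. \<forall>w\<in>cball 0 s. \<rho> w = (\<Sum>i\<in>A. (w $ i)\<^sup>2)"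
proof -
  interpret sw: essential_splitting s b a "\<lambda>w. (norm w)\<^sup>2 - \<rho> w" by (rule swap)
  define A where "A = {i. \<rho> (axis i s) \<noteq> 0}"
  have box: "in_box (axis i \<tau>) (axis i (if \<tau> \<ge> 0 then s else - s))" if "\<bar>\<tau>\<bar> \<le> s" for i :: 'n and \<tau>
    using that s by (auto simp: in_box_def axis_def)
  have zero: "\<rho> (axis i \<tau>) = 0" if "i \<notin> A" "\<bar>\<tau>\<bar> \<le> s" for i \<tau>
  proof -
    have "\<rho> (axis i s) = 0" "\<rho> (axis i (- s)) = 0"
      using that(1) axis_opposite[of "- s" i] s by (auto simp: A_def)
    then show ?thesis using zero_shrink[OF _ _ box[OF that(2), of i]] that(2) s by auto
  qed
  have full: "\<rho> (axis i \<tau>) = \<tau>\<^sup>2" if "i \<in> A" "\<bar>\<tau>\<bar> \<le> s" for i \<tau>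
  proof -
    have "\<rho> (axis i s) \<noteq> 0" "\<rho> (axis i (- s)) \<noteq> 0"
      using that(1) axis_opposite[of s i] s by (auto simp: A_def)
    then have "\<rho> (axis i s) = s\<^sup>2" "\<rho> (axis i (- s)) = s\<^sup>2"
      using \<rho>_axis[of s i] \<rho>_axis[of "- s" i] s by auto
    then show ?thesis using full_shrink[OF _ _ box[OF that(2), of i]] that(2) s by auto
  qed
  have "\<rho> w = (\<Sum>i\<in>A. (w $ i)\<^sup>2)" if w: "w \<in> cball 0 s" for w
  proof (rule antisym)
    have "(\<Sum>i\<in>-A. (w $ i)\<^sup>2) \<le> (norm w)\<^sup>2 - \<rho> w"
      by (rule sw.coordinate_subspace[OF _ _ w]) (use zero full in auto)
    moreover have "(norm w)\<^sup>2 = (\<Sum>i\<in>-A. (w $ i)\<^sup>2) + (\<Sum>i\<in>A. (w $ i)\<^sup>2)"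
      unfolding norm2_eq_sum using sum.subset_diff[of A UNIV] by (simp add: Compl_eq_Diff_UNIV)
    ultimately show "\<rho> w \<le> (\<Sum>i\<in>A. (w $ i)\<^sup>2)" by simp
    show "(\<Sum>i\<in>A. (w $ i)\<^sup>2) \<le> \<rho> w" by (rule coordinate_subspace[OF zero full w])
  qed
  then show ?thesis by blast
qed

end


section \<open>Maps of spheres that are not null-homotopic\<close>

text \<open>Radial retraction to the sphere followed by composition with the inverse would turn a
  null-homotopy of \<open>z\<close> into a contraction of the sphere.\<close>

lemma homeomorphism_sphere_essential:
  fixes z z' :: "'a::euclidean_space \<Rightarrow> 'a"
  assumes s: "0 < s" and z: "homeomorphism (sphere 0 s) (sphere 0 s) z z'"
  shows "\<not> homotopic_with_canon (\<lambda>_. True) (sphere 0 s) (- {0}) z (\<lambda>_. c)"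
proof
  let ?S = "sphere (0::'a) s" and ?r = "\<lambda>x::'a. (s / norm x) *\<^sub>R x"
  assume h: "homotopic_with_canon (\<lambda>_. True) ?S (- {0}) z (\<lambda>_. c)"
  have r: "continuous_on (- {0}) ?r" "?r \<in> - {0} \<rightarrow> ?S"
    using s by (auto intro!: continuous_intros)
  have "homotopic_with_canon (\<lambda>_. True) ?S ?S (?r \<circ> z) (?r \<circ> (\<lambda>_. c))"
    by (rule homotopic_with_compose_continuous_left[OF h r])
  then have "homotopic_with_canon (\<lambda>_. True) ?S ?S ((?r \<circ> z) \<circ> z') ((?r \<circ> (\<lambda>_. c)) \<circ> z')"
    by (rule homotopic_with_compose_continuous_right)
      (use z in \<open>auto simp: homeomorphism_def\<close>)
  then have "homotopic_with_canon (\<lambda>_. True) ?S ?S id (\<lambda>_. ?r c)"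
    by (rule homotopic_with_eq) (use z s in \<open>auto simp: homeomorphism_def\<close>)
  then have "contractible ?S" unfolding contractible_def by blast
  then show False using s by (simp add: contractible_sphere)
qed

text \<open>The straight segment from \<open>z w\<close>, of norm \<open>s\<close>, to
  \<open>f w\<close> is too short to reach the origin, so \<open>f\<close> and \<open>z\<close> are
  homotopic.\<close>

lemma near_homeomorphism_sphere_essential:
  fixes z z' f :: "'a::euclidean_space \<Rightarrow> 'a"
  assumes s: "0 < s" and z: "homeomorphism (sphere 0 s) (sphere 0 s) z z'"
    and f: "continuous_on (sphere 0 s) f" "\<And>w. w \<in> sphere 0 s \<Longrightarrow> norm (f w - z w) < s"
  shows "\<not> homotopic_with_canon (\<lambda>_. True) (sphere 0 s) (- {0}) f (\<lambda>_. c)"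
proof
  assume "homotopic_with_canon (\<lambda>_. True) (sphere 0 s) (- {0}) f (\<lambda>_. c)"
  moreover have "homotopic_with_canon (\<lambda>_. True) (sphere 0 s) (- {0}) z f"
  proof (rule homotopic_with_linear)
    show "continuous_on (sphere 0 s) z" using z by (simp add: homeomorphism_def)
    show "closed_segment (z w) (f w) \<subseteq> - {0}" if w: "w \<in> sphere 0 s" for w
    proof -
      have zw: "norm (z w) = s" using z w by (auto simp: homeomorphism_def)
      have "(1 - t) *\<^sub>R z w + t *\<^sub>R f w \<noteq> 0" if "0 \<le> t" "t \<le> 1" for t
      proof
        assume "(1 - t) *\<^sub>R z w + t *\<^sub>R f w = 0"
        then have "z w = - (t *\<^sub>R (f w - z w))" by (simp add: algebra_simps eq_neg_iff_add_eq_0)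
        then have "s = t * norm (f w - z w)" using zw that by (metis abs_of_nonneg norm_minus_cancel norm_scaleR)
        also have "\<dots> \<le> norm (f w - z w)" using that by (simp add: mult_left_le_one_le)
        finally show False using f(2)[OF w] by simp
      qed
      then show ?thesis by (auto simp: closed_segment_def)
    qed
  qed (use f in auto)
  ultimately show False
    using homeomorphism_sphere_essential[OF s z] homotopic_with_trans by blast
qed

section \<open>Orders of vanishing with derivatives\<close>

text \<open>The flag lets one set of rules serve both Landau symbols; the product of a big and a
  little one is little. The exponent is real since each derivative lowers it, possibly below
  0.\<close>

definition ord_set :: "bool \<Rightarrow> real \<Rightarrow> ('a::real_normed_vector \<Rightarrow> real) set" where
  "ord_set l m = (if l then o[at 0](\<lambda>w. norm w powr m) else O[at 0](\<lambda>w. norm w powr m))"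

lemma ord_set_mult:
  "f \<in> ord_set l m \<Longrightarrow> g \<in> ord_set l' m' \<Longrightarrow> (\<lambda>w. f w * g w) \<in> ord_set (l \<or> l') (m + m')"
  by (auto simp: ord_set_def powr_add landau_o.big_mult landau_o.small_mult
      landau_o.big_small_mult landau_o.small_big_mult split: if_splits)

lemma ord_set_add: "f \<in> ord_set l m \<Longrightarrow> g \<in> ord_set l m \<Longrightarrow> (\<lambda>w. f w + g w) \<in> ord_set l m"
  by (auto simp: ord_set_def sum_in_bigo sum_in_smallo)

lemma eventually_norm_less_1: "\<forall>\<^sub>F w in at (0::'a::real_normed_vector). 0 < norm w \<and> norm w < 1"
  unfolding eventually_at by (rule exI[of _ 1]) auto

lemma ord_set_mono:
  assumes f: "f \<in> ord_set l m" and m: "m' \<le> m" and l: "l' \<Longrightarrow> l \<or> m' < m"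
  shows "f \<in> ord_set l' m'"
proof -
  have big: "(\<lambda>w::'a. norm w powr m) \<in> O[at 0](\<lambda>w. norm w powr m')"
    by (rule landau_o.big_mono, rule eventually_mono[OF eventually_norm_less_1])
      (use m in \<open>auto intro!: powr_mono'\<close>)
  show ?thesis
  proof (cases "l' \<and> \<not> l")
    case True
    then have lt: "m' < m" using l by simp
    have "((\<lambda>w::'a. norm w powr (m - m')) \<longlongrightarrow> 0 powr (m - m')) (at 0)"
      using lt by (intro tendsto_powr2) (auto intro!: tendsto_norm_zero tendsto_ident_at)
    then have "(\<lambda>w::'a. norm w powr (m - m')) \<in> o[at 0](\<lambda>_. 1)"
      using lt by (intro smalloI_tendsto) auto
    then have "(\<lambda>w::'a. norm w powr (m - m') * norm w powr m') \<in> o[at 0](\<lambda>w. 1 * norm w powr m')"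
      by (intro landau_o.small_big_mult landau_o.big_refl)
    then have "(\<lambda>w::'a. norm w powr m) \<in> o[at 0](\<lambda>w. norm w powr m')"
      by (simp flip: powr_add)
    then show ?thesis using f True by (auto simp: ord_set_def intro: landau_o.big_small_trans)
  next
    case False
    then show ?thesis using f big
      by (auto simp: ord_set_def intro: landau_o.big_trans landau_o.small_big_trans landau_o.small_imp_big split: if_splits)
  qed
qed

text \<open>\<open>Ord_on l j m f S\<close>: away from the origin \<open>f\<close> is \<open>C\<^sup>j\<close>, and its derivatives of order \<open>i \<le> j\<close>
  are \<open>O(|w|\<^sup>m\<^sup>-\<^sup>i)\<close> at the origin, or \<open>o(|w|\<^sup>m\<^sup>-\<^sup>i)\<close> if \<open>l\<close> holds.\<close>

fun Ord_on :: "bool \<Rightarrow> nat \<Rightarrow> real \<Rightarrow> ('a::euclidean_space \<Rightarrow> real) \<Rightarrow> 'a set \<Rightarrow> bool" where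
  "Ord_on l 0 m f S \<longleftrightarrow> continuous_on (S - {0}) f \<and> f \<in> ord_set l m"
| "Ord_on l (Suc j) m f S \<longleftrightarrow> (\<forall>x\<in>S - {0}. f differentiable (at x)) \<and> f \<in> ord_set l m \<and>
     (\<forall>v. Ord_on l j (m - 1) (\<lambda>x. frechet_derivative f (at x) v) S)"

lemma Ord_on_ord_set: "Ord_on l j m f S \<Longrightarrow> f \<in> ord_set l m"
  by (cases j) auto

lemma eventually_at_0_in:
  assumes "open S" "(0::'a::real_normed_vector) \<in> S"
  shows "\<forall>\<^sub>F w in at 0. w \<in> S - {0}"
  using eventually_at_topological assms by blast

lemma ord_set_cong:
  fixes f :: "'a::real_normed_vector \<Rightarrow> real"
  assumes "open S" "0 \<in> S" "\<And>x. x \<in> S - {0} \<Longrightarrow> f x = g x"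
  shows "f \<in> ord_set l m \<longleftrightarrow> g \<in> ord_set l m"
proof -
  have ev: "\<forall>\<^sub>F w in at 0. f w = g w"
    using eventually_at_0_in[OF assms(1,2)] by eventually_elim (rule assms(3))
  show ?thesis
    unfolding ord_set_def using landau_o.big.in_cong[OF ev] landau_o.small.in_cong[OF ev]
    by (cases l) simp_all
qed

lemma Ord_on_cong:
  assumes "Ord_on l j m f S" and S: "open S" "0 \<in> S" and "\<And>x. x \<in> S - {0} \<Longrightarrow> f x = g x"
  shows "Ord_on l j m g S"
  using assms(1,4)
proof (induction j arbitrary: m f g)
  case 0
  have "f \<in> ord_set l m \<longleftrightarrow> g \<in> ord_set l m" by (rule ord_set_cong[OF S 0(2)])
  moreover have "continuous_on (S - {0}) f \<longleftrightarrow> continuous_on (S - {0}) g"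
    by (rule continuous_on_cong[OF refl 0(2)])
  ultimately show ?case using 0(1) by simp
next
  case (Suc j)
  have d: "(g has_derivative frechet_derivative f (at x)) (at x)" if "x \<in> S - {0}" for x
    by (rule has_derivative_transform_within_open[where s = "S - {0}" and f = f])
      (use Suc.prems S that in \<open>auto simp: frechet_derivative_works\<close>)
  have "Ord_on l j (m - 1) (\<lambda>x. frechet_derivative g (at x) v) S" for v
    by (rule Suc.IH[of "m - 1" "\<lambda>x. frechet_derivative f (at x) v"])
      (use Suc.prems(1) frechet_derivative_eq[OF d] in auto)
  moreover have "f \<in> ord_set l m \<longleftrightarrow> g \<in> ord_set l m" by (rule ord_set_cong[OF S Suc.prems(2)])
  ultimately show ?case using d Suc.prems(1) by (auto simp: differentiable_def)
qed

lemma Ord_on_SucI: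
  assumes S: "open S" "0 \<in> S" and d: "\<And>x. x \<in> S - {0} \<Longrightarrow> (f has_derivative f' x) (at x)"
    and "f \<in> ord_set l m" and "\<And>v. Ord_on l j (m - 1) (\<lambda>x. f' x v) S"
  shows "Ord_on l (Suc j) m f S"
proof -
  have "Ord_on l j (m - 1) (\<lambda>x. frechet_derivative f (at x) v) S" for v
    by (rule Ord_on_cong[OF assms(5)[of v] S]) (simp add: frechet_derivative_eq[OF d])
  then show ?thesis using assms(4) d by (auto simp: differentiable_def)
qed

lemma Ord_on_SucE:
  "Ord_on l (Suc j) m f S \<Longrightarrow> x \<in> S - {0} \<Longrightarrow> (f has_derivative frechet_derivative f (at x)) (at x)"
  by (simp add: frechet_derivative_works)

lemma Ord_on_SucD: "Ord_on l (Suc j) m f S \<Longrightarrow> Ord_on l j m f S"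
proof (induction j arbitrary: m f)
  case 0
  then show ?case
    by (auto intro!: continuous_at_imp_continuous_on differentiable_imp_continuous_within)
next
  case (Suc j)
  then show ?case by (metis Ord_on.simps(2))
qed

lemma Ord_on_mono:
  assumes "Ord_on l j m f S" "m' \<le> m" "l' \<Longrightarrow> l \<or> m' < m"
  shows "Ord_on l' j m' f S"
  using assms
proof (induction j arbitrary: m m' f)
  case 0
  then show ?case using ord_set_mono by fastforce
next
  case (Suc j)
  have "Ord_on l' j (m' - 1) (\<lambda>x. frechet_derivative f (at x) v) S" for v
    by (rule Suc.IH[of "m - 1"]) (use Suc.prems in auto)
  then show ?case using Suc.prems ord_set_mono[of f l m m' l'] by simp
qed

lemma Ord_on_zero: "Ord_on l j m (\<lambda>_. 0) S"
  by (induction j arbitrary: m) (auto simp: ord_set_def)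

lemma Ord_on_add:
  assumes S: "open S" "0 \<in> S" and "Ord_on l j m f S" "Ord_on l j m g S"
  shows "Ord_on l j m (\<lambda>x. f x + g x) S"
  using assms(3,4)
proof (induction j arbitrary: m f g)
  case 0
  then show ?case by (auto intro: continuous_intros ord_set_add)
next
  case (Suc j)
  show ?case
    by (rule Ord_on_SucI[OF S has_derivative_add[OF Ord_on_SucE[OF Suc.prems(1)] Ord_on_SucE[OF Suc.prems(2)]]])
      (use Suc in \<open>auto intro: ord_set_add\<close>)
qed

lemma Ord_on_mult:
  assumes S: "open S" "0 \<in> S" and "Ord_on l j m f S" "Ord_on l' j m' g S"
  shows "Ord_on (l \<or> l') j (m + m') (\<lambda>x. f x * g x) S"
  using assms(3,4)
proof (induction j arbitrary: m m' f g)
  case 0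
  then show ?case by (auto intro: continuous_intros ord_set_mult)
next
  case (Suc j)
  note j = Suc.prems[THEN Ord_on_SucD]
  have 1: "Ord_on (l \<or> l') j (m + m' - 1) (\<lambda>x. f x * frechet_derivative g (at x) v) S" for v
    using Suc.IH[OF j(1), of "m' - 1" "\<lambda>x. frechet_derivative g (at x) v"] Suc.prems(2)
    by (simp add: algebra_simps)
  have 2: "Ord_on (l \<or> l') j (m + m' - 1) (\<lambda>x. frechet_derivative f (at x) v * g x) S" for v
    using Suc.IH[OF _ j(2), of "m - 1" "\<lambda>x. frechet_derivative f (at x) v"] Suc.prems(1)
    by (simp add: algebra_simps)
  show ?case
    by (rule Ord_on_SucI[OF S bounded_bilinear.FDERIV[OF bounded_bilinear_mult Ord_on_SucE[OF Suc.prems(1)] Ord_on_SucE[OF Suc.prems(2)]]])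
      (use Suc.prems[THEN Ord_on_ord_set] 1 2 in \<open>auto intro: ord_set_mult Ord_on_add S\<close>)
qed

lemma Ord_on_sum:
  assumes "open S" "0 \<in> S" "\<And>i. i \<in> I \<Longrightarrow> Ord_on l j m (f i) S"
  shows "Ord_on l j m (\<lambda>x. \<Sum>i\<in>I. f i x) S"
  using assms(3) by (induction I rule: infinite_finite_induct) (auto intro: Ord_on_add Ord_on_zero assms)

lemma Ck_on_imp_ord_set_0:
  fixes f :: "'a::real_normed_vector \<Rightarrow> real"
  assumes "Ck_on j f S" "open S" "0 \<in> S"
  shows "f \<in> ord_set False 0"
proof -
  have "isCont f 0"
    using Ck_on_imp_continuous_on[OF assms(1)] assms by (simp add: continuous_on_eq_continuous_at)
  then have "f \<in> O[at 0](\<lambda>_. 1)"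
    unfolding isCont_def by (intro bigoI_tendsto[where c = "f 0"]) auto
  moreover have "ord_set False 0 = O[at (0::'a)](\<lambda>_. 1)"
    unfolding ord_set_def
    by (simp, rule landau_o.big.cong, rule eventually_mono[OF eventually_norm_less_1]) auto
  ultimately show ?thesis by simp
qed

lemma Ck_on_imp_Ord_on_0:
  assumes "Ck_on j f S" and S: "open S" "0 \<in> S"
  shows "Ord_on False j 0 f S"
  using assms(1)
proof (induction j arbitrary: f)
  case 0
  then show ?case using Ck_on_imp_ord_set_0[OF 0 S] continuous_on_subset by fastforce
next
  case (Suc j)
  have "Ord_on False j (0 - 1) (\<lambda>x. frechet_derivative f (at x) v) S" for v
    by (rule Ord_on_mono[OF Suc.IH]) (use Suc.prems in auto)
  then show ?case using Ck_on_imp_ord_set_0[OF Suc.prems S] Suc.prems by simp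
qed

text \<open>Beyond the value itself nothing is to be gained: first derivatives are bounded near 0,
  and higher ones may even blow up. For \<open>j = 0\<close> the bound on the value does not follow
  from \<open>f 0 = 0\<close>.\<close>

lemma Ck_on_imp_Ord_on_1:
  assumes "Ck_on j f S" and S: "open S" "0 \<in> S" and f: "f \<in> ord_set False 1"
  shows "Ord_on False j 1 f S"
proof (cases j)
  case 0
  then show ?thesis using assms continuous_on_subset by fastforce
next
  case (Suc i)
  then show ?thesis using assms Ck_on_imp_Ord_on_0[OF _ S, of i] by simp
qed

lemma ord_set_1_iff: "f \<in> ord_set True (1::real) \<longleftrightarrow> ((\<lambda>w. f w / norm w) \<longlongrightarrow> 0) (at 0)"
proof -
  have "ord_set True 1 = o[at (0::'a::real_normed_vector)](norm)"
    unfolding ord_set_def by simp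
  then show ?thesis
    by (auto intro!: smalloI_tendsto dest: smalloD_tendsto simp: eventually_at_filter)
qed

lemma ord_set_0_iff: "f \<in> ord_set True (0::real) \<longleftrightarrow> (f \<longlongrightarrow> 0) (at 0)"
proof -
  have "ord_set True 0 = o[at (0::'a::real_normed_vector)](\<lambda>_. 1)"
    unfolding ord_set_def
    by (simp, rule landau_o.small.cong, rule eventually_mono[OF eventually_norm_less_1]) auto
  then show ?thesis
    by (auto intro!: smalloI_tendsto dest: smalloD_tendsto)
qed

lemma differentiable_imp_ord_set_1:
  fixes f :: "'a::real_normed_vector \<Rightarrow> real"
  assumes f: "f differentiable (at 0)" "f 0 = 0"
  shows "f \<in> ord_set False 1"
proof -
  obtain f' where f': "(f has_derivative f') (at 0)" using f by (auto simp: differentiable_def)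
  obtain K where K: "\<And>v. norm (f' v) \<le> norm v * K"
    using bounded_linear.bounded[OF has_derivative_bounded_linear[OF f']] by blast
  have "((\<lambda>w. (f w - f' w) / norm w) \<longlongrightarrow> 0) (at 0)"
  proof (rule Lim_null_comparison)
    show "((\<lambda>w. norm (f w - f 0 - f' (w - 0)) / norm (w - 0)) \<longlongrightarrow> 0) (at 0)"
      using f' by (simp add: has_derivative_iff_norm)
  qed (use f in \<open>simp add: eventually_at_filter\<close>)
  then have "(\<lambda>w. f w - f' w) \<in> ord_set True 1" by (simp add: ord_set_1_iff)
  then have 1: "(\<lambda>w. f w - f' w) \<in> ord_set False 1" by (rule ord_set_mono) auto
  have 2: "f' \<in> ord_set False 1"
    unfolding ord_set_def by (simp, rule bigoI[where c = K]) (use K in \<open>simp add: mult.commute\<close>)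
  show ?thesis using ord_set_add[OF 1 2] by simp
qed

lemma Ord_on_linear:
  assumes L: "bounded_linear L" and S: "open S" "0 \<in> S"
  shows "Ord_on False j 1 L S"
proof (rule Ck_on_imp_Ord_on_1[OF Ck_on_linear[OF L S(1)] S])
  show "L \<in> ord_set False 1"
    using bounded_linear.has_derivative[OF L has_derivative_ident] linear_0[OF bounded_linear.linear[OF L]]
    by (intro differentiable_imp_ord_set_1) (auto simp: differentiable_def)
qed

text \<open>The derivative is a linear function times two factors of the same kind, of total order 1
  - 2 - 2 = -3.\<close>

lemma Ord_on_inverse_norm2:
  assumes S: "open S" "(0::'a::euclidean_space) \<in> S"
  shows "Ord_on False j (-2) (\<lambda>w. inverse (w \<bullet> w)) S"
proof (induction j)
  have ord: "(\<lambda>w::'a. inverse (w \<bullet> w)) \<in> ord_set False (-2)"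
    unfolding ord_set_def
    by (simp, rule landau_o.bigI[of 1])
      (auto simp: eventually_at_filter powr_minus dot_square_norm powr_numeral)
  {
    case 0
    show ?case using ord by (auto intro!: continuous_intros)
  next
    case (Suc j)
    have d: "((\<lambda>w. inverse (w \<bullet> w)) has_derivative
        (\<lambda>v. (-2) * (x \<bullet> v) * (inverse (x \<bullet> x) * inverse (x \<bullet> x)))) (at x)" if "x \<in> S - {0}" for x
      using that by (auto intro!: derivative_eq_intros simp: fun_eq_iff inner_commute)
    have "Ord_on (False \<or> False \<or> False) j (1 + (-2 + -2)) (\<lambda>x. (-2) * (x \<bullet> v) * (inverse (x \<bullet> x) * inverse (x \<bullet> x))) S" for v
      by (intro Ord_on_mult S Suc Ord_on_linear bounded_linear_const_mult bounded_linear_inner_left)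
    then show ?case
      by (intro Ord_on_SucI[OF S d ord]) (auto elim!: Ord_on_mono)
  }
qed

text \<open>As long as derivatives are left, the order is at least 1 with little-o, so the
  derivative at 0 exists and vanishes; at the last stage o(1) is continuity. With big-O the top
  derivatives could oscillate at 0.\<close>

lemma Ord_on_imp_Ck_on:
  assumes "Ord_on True r (real r) f S" and S: "open S" "0 \<in> S" and "f 0 = 0"
  shows "Ck_on r f S"
  using assms(1,4)
proof (induction r arbitrary: f)
  case 0
  have "isCont f x" if "x \<in> S" for x
  proof (cases "x = 0")
    case True
    then show ?thesis using 0 by (auto simp: ord_set_0_iff isCont_def)
  next
    case False
    then show ?thesis using 0 S that by (auto simp: continuous_on_eq_continuous_at open_Diff)
  qed
  then show ?case by (simp add: continuous_at_imp_continuous_on)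
next
  case (Suc r)
  have "f \<in> ord_set True 1"
    by (rule ord_set_mono[OF Ord_on_ord_set[OF Suc.prems(1)]]) auto
  then have "((\<lambda>w. norm (f w / norm w)) \<longlongrightarrow> 0) (at 0)"
    unfolding ord_set_1_iff by (rule tendsto_norm_zero)
  then have d0: "(f has_derivative (\<lambda>_. 0)) (at 0)"
    using Suc.prems(2) by (simp add: has_derivative_iff_norm)
  have "f differentiable (at x)" if "x \<in> S" for x
    using Suc.prems(1) d0 that by (cases "x = 0") (auto simp: differentiable_def)
  moreover have "Ck_on r (\<lambda>x. frechet_derivative f (at x) v) S" for v
    by (rule Suc.IH) (use Suc.prems frechet_derivative_eq[OF d0] in auto)
  ultimately show ?case by simp
qed

section \<open>Symmetry of second derivatives\<close>

lemma has_real_derivative_along_line: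
  fixes f :: "'a::real_normed_vector \<Rightarrow> real"
  assumes "(f has_derivative f') (at (p + s *\<^sub>R u))"
  shows "((\<lambda>s. f (p + s *\<^sub>R u)) has_real_derivative f' u) (at s)"
proof -
  have "((\<lambda>s. p + s *\<^sub>R u) has_derivative (\<lambda>h. h *\<^sub>R u)) (at s)"
    by (auto intro!: derivative_eq_intros)
  from has_derivative_compose[OF this assms]
  have "((\<lambda>s. f (p + s *\<^sub>R u)) has_derivative (\<lambda>h. f' (h *\<^sub>R u))) (at s)" .
  moreover have "f' (h *\<^sub>R u) = f' u * h" for h
    using linear_scale[OF has_derivative_linear[OF assms]] by simp
  ultimately show ?thesis by (simp add: has_field_derivative_def mult_commute_abs)
qed

text \<open>Two applications of the mean value theorem, in direction \<open>u\<close> and then in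
  direction \<open>v\<close>. The left-hand side is symmetric in \<open>u\<close> and
  \<open>v\<close>, the right-hand side is not visibly so.\<close>

lemma second_difference_mean_value:
  fixes f :: "'a::real_normed_vector \<Rightarrow> real"
  assumes f: "Ck_on 2 f S" and S: "ball a e \<subseteq> S" and h: "0 < h" "h * (norm u + norm v) < e"
  shows "\<exists>x. dist a x \<le> h * (norm u + norm v) \<and>
    f (a + h *\<^sub>R u + h *\<^sub>R v) - f (a + h *\<^sub>R u) - f (a + h *\<^sub>R v) + f a =
    h\<^sup>2 * frechet_derivative (\<lambda>y. frechet_derivative f (at y) u) (at x) v"
proof -
  let ?D = "\<lambda>f a. frechet_derivative f (at a)"
  have bound: "norm (s *\<^sub>R u + t *\<^sub>R v) \<le> h * (norm u + norm v)"
    if "0 \<le> s" "s \<le> h" "0 \<le> t" "t \<le> h" for s t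
  proof -
    have "norm (s *\<^sub>R u + t *\<^sub>R v) \<le> s * norm u + t * norm v"
      using norm_triangle_ineq[of "s *\<^sub>R u" "t *\<^sub>R v"] that by simp
    also have "\<dots> \<le> h * norm u + h * norm v" using that by (intro add_mono mult_right_mono) auto
    finally show ?thesis by (simp add: algebra_simps)
  qed
  have mem: "a + s *\<^sub>R u + t *\<^sub>R v \<in> S" if "0 \<le> s" "s \<le> h" "0 \<le> t" "t \<le> h" for s t
  proof -
    have "dist a (a + s *\<^sub>R u + t *\<^sub>R v) = norm (s *\<^sub>R u + t *\<^sub>R v)"
      by (simp add: dist_norm norm_minus_commute add_ac)
    then show ?thesis using bound[OF that] h S by (auto simp: subset_iff)
  qed
  have f1: "Ck_on (Suc (Suc 0)) f S" using f by (simp add: numeral_2_eq_2)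
  note d1 = Ck_on_SucE[OF f1]
  have d2: "((\<lambda>y. ?D f y u) has_derivative ?D (\<lambda>y. ?D f y u) x) (at x)" if "x \<in> S" for x
    by (rule Ck_on_SucE[where k = 0, OF _ that]) (use f1 in simp)
  have "\<exists>\<sigma>>0. \<sigma> < h \<and> (f ((a + h *\<^sub>R v) + h *\<^sub>R u) - f (a + h *\<^sub>R u)) - (f ((a + h *\<^sub>R v) + 0 *\<^sub>R u) - f (a + 0 *\<^sub>R u)) =
     (h - 0) * (?D f ((a + h *\<^sub>R v) + \<sigma> *\<^sub>R u) u - ?D f (a + \<sigma> *\<^sub>R u) u)"
  proof (rule MVT2[OF h(1)])
    fix s assume s: "0 \<le> s" "s \<le> h"
    show "((\<lambda>s. f ((a + h *\<^sub>R v) + s *\<^sub>R u) - f (a + s *\<^sub>R u)) has_real_derivative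
       ?D f ((a + h *\<^sub>R v) + s *\<^sub>R u) u - ?D f (a + s *\<^sub>R u) u) (at s)"
      using mem[of s h] mem[of s 0] s h
      by (intro DERIV_diff has_real_derivative_along_line d1) (auto simp: add_ac)
  qed
  then obtain \<sigma> where \<sigma>: "0 < \<sigma>" "\<sigma> < h" and eq1: "f (a + h *\<^sub>R u + h *\<^sub>R v) - f (a + h *\<^sub>R u) - f (a + h *\<^sub>R v) + f a =
     h * (?D f ((a + \<sigma> *\<^sub>R u) + h *\<^sub>R v) u - ?D f (a + \<sigma> *\<^sub>R u) u)"
    by (auto simp: add_ac algebra_simps)
  have "\<exists>\<tau>>0. \<tau> < h \<and> ?D f ((a + \<sigma> *\<^sub>R u) + h *\<^sub>R v) u - ?D f ((a + \<sigma> *\<^sub>R u) + 0 *\<^sub>R v) u =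
     (h - 0) * ?D (\<lambda>y. ?D f y u) ((a + \<sigma> *\<^sub>R u) + \<tau> *\<^sub>R v) v"
  proof (rule MVT2[OF h(1)])
    fix t assume "0 \<le> t" "t \<le> h"
    then have "(a + \<sigma> *\<^sub>R u) + t *\<^sub>R v \<in> S" using mem[of \<sigma> t] \<sigma> by simp
    from has_real_derivative_along_line[OF d2[OF this]]
    show "((\<lambda>t. ?D f ((a + \<sigma> *\<^sub>R u) + t *\<^sub>R v) u) has_real_derivative
       ?D (\<lambda>y. ?D f y u) ((a + \<sigma> *\<^sub>R u) + t *\<^sub>R v) v) (at t)" .
  qed
  then obtain \<tau> where \<tau>: "0 < \<tau>" "\<tau> < h" and eq2: "?D f ((a + \<sigma> *\<^sub>R u) + h *\<^sub>R v) u - ?D f (a + \<sigma> *\<^sub>R u) u =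
     h * ?D (\<lambda>y. ?D f y u) (a + \<sigma> *\<^sub>R u + \<tau> *\<^sub>R v) v"
    by auto
  have "dist a (a + \<sigma> *\<^sub>R u + \<tau> *\<^sub>R v) \<le> h * (norm u + norm v)"
    using bound[of \<sigma> \<tau>] \<sigma> \<tau> by (simp add: dist_norm norm_minus_commute add_ac)
  then show ?thesis unfolding eq1 eq2 by (auto simp: power2_eq_square)
qed

lemma frechet_derivative_symmetric:
  fixes f :: "'a::real_normed_vector \<Rightarrow> real"
  assumes f: "Ck_on 2 f S" and S: "open S" "a \<in> S"
  shows "frechet_derivative (\<lambda>y. frechet_derivative f (at y) u) (at a) v =
    frechet_derivative (\<lambda>y. frechet_derivative f (at y) v) (at a) u"
proof (rule ccontr)
  define F where "F u v x = frechet_derivative (\<lambda>y. frechet_derivative f (at y) u) (at x) v" for u v x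
  assume "\<not> ?thesis"
  then have eps: "\<bar>F u v a - F v u a\<bar> / 2 > 0" (is "?eps > 0") by (simp add: F_def)
  have "isCont (F u v) a" for u v
    using f S unfolding numeral_2_eq_2 F_def[abs_def] by (simp add: continuous_on_eq_continuous_at)
  then have "\<forall>u v. \<exists>d>0. \<forall>x. dist x a < d \<longrightarrow> dist (F u v x) (F u v a) < ?eps"
    using eps unfolding continuous_at_eps_delta by blast
  then obtain d1 d2 where d: "d1 > 0" "d2 > 0"
    "\<And>x. dist x a < d1 \<Longrightarrow> dist (F u v x) (F u v a) < ?eps"
    "\<And>x. dist x a < d2 \<Longrightarrow> dist (F v u x) (F v u a) < ?eps" by meson
  obtain e where e: "e > 0" "ball a e \<subseteq> S" using S open_contains_ball by blast
  define m where "m = Min {d1, d2, e}"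
  have m: "m > 0" "m \<le> d1" "m \<le> d2" "m \<le> e" using d e by (auto simp: m_def)
  \<comment> \<open>The summand 1 keeps the denominator positive when both directions
    vanish.\<close>
  define h where "h = m / (2 * (norm u + norm v + 1))"
  have nn: "norm u + norm v + 1 > 0" using norm_ge_zero[of u] norm_ge_zero[of v] by linarith
  have h: "h > 0" using m nn by (simp add: h_def)
  have "h * (norm u + norm v) \<le> h * (norm u + norm v + 1)" using h by simp
  also have "\<dots> = m / 2" using nn by (simp add: h_def field_simps)
  finally have hm: "h * (norm u + norm v) < m" using m by simp
  obtain x where x: "dist a x \<le> h * (norm u + norm v)"
    "f (a + h *\<^sub>R u + h *\<^sub>R v) - f (a + h *\<^sub>R u) - f (a + h *\<^sub>R v) + f a = h\<^sup>2 * F u v x"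
    using second_difference_mean_value[OF f e(2) h, of u v] hm m unfolding F_def by fastforce
  obtain y where y: "dist a y \<le> h * (norm v + norm u)"
    "f (a + h *\<^sub>R v + h *\<^sub>R u) - f (a + h *\<^sub>R v) - f (a + h *\<^sub>R u) + f a = h\<^sup>2 * F v u y"
    using second_difference_mean_value[OF f e(2) h, of v u] hm m unfolding F_def by (fastforce simp: add.commute)
  have "h\<^sup>2 * F u v x = h\<^sup>2 * F v u y"
    unfolding x(2)[symmetric] y(2)[symmetric] by (simp add: algebra_simps)
  then have "F u v x = F v u y" using h by simp
  moreover have "dist x a < d1" "dist y a < d2"
    using x(1) y(1) hm m by (auto simp: dist_commute add.commute)
  ultimately show False using d(3)[of x] d(4)[of y] eps
    unfolding dist_real_def by (smt (verit) field_sum_of_halves)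
qed

section \<open>Taylor polynomials\<close>

abbreviation partial :: "'n::finite \<Rightarrow> (real^'n \<Rightarrow> real) \<Rightarrow> real^'n \<Rightarrow> real" where
  "partial i f \<equiv> (\<lambda>x. frechet_derivative f (at x) (axis i 1))"

lemma linear_eq_sum_axis:
  fixes L :: "real^'n \<Rightarrow> real"
  assumes "linear L"
  shows "L v = (\<Sum>i\<in>UNIV. v $ i * L (axis i 1))"
proof -
  have "L v = L (\<Sum>i\<in>UNIV. v $ i *\<^sub>R axis i 1)"
    by (simp add: basis_expansion flip: scalar_mult_eq_scaleR)
  then show ?thesis by (simp add: linear_sum[OF assms] linear_scale[OF assms])
qed

lemma frechet_derivative_partial:
  fixes f :: "real^'n \<Rightarrow> real"
  assumes "f differentiable (at x)"
  shows "frechet_derivative f (at x) v = (\<Sum>i\<in>UNIV. v $ i * partial i f x)"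
  by (rule linear_eq_sum_axis) (use assms in \<open>auto simp: frechet_derivative_works dest: has_derivative_linear\<close>)

text \<open>By the mean value theorem on the segment from 0, \<open>f w\<close> is a sum of
  \<open>CARD('n)\<close> products of a coordinate of \<open>w\<close> with a partial derivative at
  some \<open>t *\<^sub>R w\<close>; the coordinate gains one order. For nonnegative
  \<open>m\<close> the bound at the intermediate point is dominated by that at
  \<open>w\<close>.\<close>

lemma ord_set_integrate:
  fixes f :: "real^'n \<Rightarrow> real"
  assumes S: "open S" "0 \<in> S" and f: "Ck_on 1 f S" "f 0 = 0" and m: "0 \<le> m"
    and d: "\<And>i. partial i f \<in> ord_set True m"
  shows "f \<in> ord_set True (m + 1)"
proof -
  have "f \<in> o[at 0](\<lambda>w. norm w powr (m + 1))"
  proof (rule landau_o.smallI)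
    fix c :: real assume c: "c > 0"
    define c' where "c' = c / CARD('n)"
    have c': "c' > 0" using c by (simp add: c'_def)
    have "\<forall>\<^sub>F w in at 0. \<forall>i\<in>UNIV. \<bar>partial i f w\<bar> \<le> c' * norm w powr m"
    proof (rule eventually_ball_finite, simp, rule)
      fix i
      have "partial i f \<in> o[at 0](\<lambda>w. norm w powr m)" using d[of i] by (simp add: ord_set_def)
      from landau_o.smallD[OF this c']
      show "\<forall>\<^sub>F w in at 0. \<bar>partial i f w\<bar> \<le> c' * norm w powr m" by simp
    qed
    moreover have "\<forall>\<^sub>F w in at 0. w \<in> S" using S by (simp add: eventually_at_topological) blast
    ultimately have "\<forall>\<^sub>F w in at 0. w \<in> S \<and> (\<forall>i. \<bar>partial i f w\<bar> \<le> c' * norm w powr m)"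
      by eventually_elim simp
    then obtain e where e: "e > 0" "\<And>w. w \<noteq> 0 \<Longrightarrow> norm w < e \<Longrightarrow> w \<in> S"
       "\<And>w i. w \<noteq> 0 \<Longrightarrow> norm w < e \<Longrightarrow> \<bar>partial i f w\<bar> \<le> c' * norm w powr m"
      unfolding eventually_at by auto
    have "norm (f w) \<le> c * norm (norm w powr (m + 1))" if w: "w \<noteq> 0" "norm w < e" for w
    proof -
      have inS: "t *\<^sub>R w \<in> S" if "0 \<le> t" "t \<le> 1" for t
      proof (cases "t = 0")
        case False
        have n: "norm (t *\<^sub>R w) \<le> norm w" using that by (simp add: mult_left_le_one_le)
        show ?thesis by (rule e(2)) (use False w in simp, use n w in linarith)
      qed (use S in simp)
      have "\<exists>t>0. t < 1 \<and> f (0 + 1 *\<^sub>R w) - f (0 + 0 *\<^sub>R w) = (1 - 0) * frechet_derivative f (at (0 + t *\<^sub>R w)) w"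
        using f inS by (intro MVT2 has_real_derivative_along_line) (auto simp: frechet_derivative_works)
      then obtain t where t: "0 < t" "t < 1" "f w = frechet_derivative f (at (t *\<^sub>R w)) w"
        using f(2) by auto
      have tw: "norm (t *\<^sub>R w) \<le> norm w" "t *\<^sub>R w \<noteq> 0" using t w by (auto simp: mult_left_le_one_le)
      have "\<bar>f w\<bar> \<le> (\<Sum>i\<in>UNIV. \<bar>w $ i * partial i f (t *\<^sub>R w)\<bar>)"
        unfolding t(3) by (subst frechet_derivative_partial) (use f inS t in auto)
      also have "\<dots> \<le> (\<Sum>i\<in>(UNIV::'n set). norm w * (c' * norm w powr m))"
      proof (rule sum_mono)
        fix i :: 'n
        have "\<bar>partial i f (t *\<^sub>R w)\<bar> \<le> c' * norm (t *\<^sub>R w) powr m"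
          by (rule e(3)[OF tw(2)]) (use tw(1) w(2) in linarith)
        also have "\<dots> \<le> c' * norm w powr m" using c' m tw(1) by (intro mult_left_mono powr_mono2) auto
        finally show "\<bar>w $ i * partial i f (t *\<^sub>R w)\<bar> \<le> norm w * (c' * norm w powr m)"
          unfolding abs_mult using component_le_norm_cart[of w i] by (intro mult_mono) auto
      qed
      also have "\<dots> = c * norm w powr (m + 1)"
        using w by (simp add: c'_def powr_add)
      finally show ?thesis by simp
    qed
    then show "\<forall>\<^sub>F w in at 0. norm (f w) \<le> c * norm (norm w powr (m + 1))"
      using e(1) unfolding eventually_at by (intro exI[of _ e]) auto
  qed
  then show ?thesis by (simp add: ord_set_def)
qed

text \<open>The homogeneous Taylor term of degree \<open>d\<close>. The recursion is Euler's
  identity for homogeneous polynomials, which avoids multi-indices and factorials.\<close>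

fun jet :: "nat \<Rightarrow> (real^'n \<Rightarrow> real) \<Rightarrow> real^'n \<Rightarrow> real" where
  "jet 0 f w = f 0"
| "jet (Suc d) f w = (1 / Suc d) * (\<Sum>i\<in>UNIV. w $ i * jet d (partial i f) w)"

lemma jet_cong:
  assumes S: "open S" "0 \<in> S" and "\<And>x. x \<in> S \<Longrightarrow> f x = g x"
  shows "jet d f w = jet d g w"
  using assms(3)
proof (induction d arbitrary: f g)
  case 0
  then show ?case using S by simp
next
  case (Suc d)
  have "frechet_derivative f (at x) = frechet_derivative g (at x)" if "x \<in> S" for x
  proof -
    have "(f has_derivative F) (at x) \<longleftrightarrow> (g has_derivative F) (at x)" for F
      using has_derivative_transform_within_open[OF _ S(1) that] Suc.prems by metis
    then show ?thesis by (simp add: frechet_derivative_def)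
  qed
  then have "jet d (partial i f) w = jet d (partial i g) w" for i
    by (intro Suc.IH) simp
  then show ?case by simp
qed

text \<open>In the product rule, symmetry of second derivatives lets Euler's recursion be applied
  again to the terms where the jet is differentiated. For the jet of degree d + 2 they give d + 1
  copies of the claim, the coordinate factors one more, and the prefactor 1 / (d + 2)
  cancels.\<close>

lemma has_derivative_jet_Suc:
  assumes S: "open S" "0 \<in> S" and "Ck_on (Suc d) f S"
  shows "(jet (Suc d) f has_derivative (\<lambda>v. \<Sum>i\<in>UNIV. v $ i * jet d (partial i f) w)) (at w)"
  using assms(3)
proof (induction d arbitrary: f)
  case 0
  show ?case by (auto intro!: derivative_eq_intros bounded_linear.has_derivative[OF bounded_linear_vec_nth])
next
  case (Suc d)
  have k: "Ck_on (Suc d) (partial i f) S" for i using Suc.prems by simp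
  have sym: "jet d (partial j (partial i f)) w = jet d (partial i (partial j f)) w" for i j w
    using frechet_derivative_symmetric[OF _ S(1)] Ck_on_le[OF Suc.prems, of 2]
    by (intro jet_cong[OF S]) auto
  have "((\<lambda>w. (1 / Suc (Suc d)) * (\<Sum>i\<in>UNIV. w $ i * jet (Suc d) (partial i f) w)) has_derivative
     (\<lambda>v. (1 / Suc (Suc d)) * (\<Sum>i\<in>UNIV. w $ i * (\<Sum>j\<in>UNIV. v $ j * jet d (partial j (partial i f)) w)
       + v $ i * jet (Suc d) (partial i f) w))) (at w)"
    by (intro has_derivative_mult_right has_derivative_sum has_derivative_mult Suc.IH k
        bounded_linear.has_derivative[OF bounded_linear_vec_nth] has_derivative_ident)
  moreover have "(1 / Suc (Suc d)) * (\<Sum>i\<in>UNIV. w $ i * (\<Sum>j\<in>UNIV. v $ j * jet d (partial j (partial i f)) w)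
       + v $ i * jet (Suc d) (partial i f) w) = (\<Sum>i\<in>UNIV. v $ i * jet (Suc d) (partial i f) w)" for v
  proof -
    have "(\<Sum>i\<in>UNIV. w $ i * (\<Sum>j\<in>UNIV. v $ j * jet d (partial j (partial i f)) w)) =
        (\<Sum>j\<in>UNIV. v $ j * (\<Sum>i\<in>UNIV. w $ i * jet d (partial i (partial j f)) w))"
      unfolding sum_distrib_left by (subst sum.swap) (simp add: sym mult_ac)
    also have "\<dots> = (\<Sum>j\<in>UNIV. v $ j * (real (Suc d) * jet (Suc d) (partial j f) w))"
      by simp
    also have "\<dots> = real (Suc d) * (\<Sum>j\<in>UNIV. v $ j * jet (Suc d) (partial j f) w)"
      unfolding sum_distrib_left by (simp only: mult_ac)
    finally have "(\<Sum>i\<in>UNIV. w $ i * (\<Sum>j\<in>UNIV. v $ j * jet d (partial j (partial i f)) w)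
       + v $ i * jet (Suc d) (partial i f) w) = real (Suc (Suc d)) * (\<Sum>j\<in>UNIV. v $ j * jet (Suc d) (partial j f) w)"
      by (simp add: sum.distrib algebra_simps del: jet.simps)
    then show ?thesis by (simp del: jet.simps)
  qed
  moreover have "jet (Suc (Suc d)) f = (\<lambda>w. (1 / Suc (Suc d)) * (\<Sum>i\<in>UNIV. w $ i * jet (Suc d) (partial i f) w))"
    by (rule ext) (rule jet.simps)
  ultimately show ?case by (simp only:)
qed

definition taylor :: "nat \<Rightarrow> (real^'n \<Rightarrow> real) \<Rightarrow> real^'n \<Rightarrow> real" where
  "taylor r f w = (\<Sum>d\<le>r. jet d f w)"

lemma taylor_at_0: "taylor r f 0 = f 0"
proof -
  have "jet (Suc d) f 0 = 0" for d by simp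
  then show ?thesis by (simp add: taylor_def sum.atMost_shift del: jet.simps(2))
qed

lemma has_derivative_taylor_Suc:
  assumes S: "open S" "0 \<in> S" and f: "Ck_on (Suc r) f S"
  shows "(taylor (Suc r) f has_derivative (\<lambda>v. \<Sum>i\<in>UNIV. v $ i * taylor r (partial i f) w)) (at w)"
proof -
  have "((\<lambda>w. f 0 + (\<Sum>d\<le>r. jet (Suc d) f w)) has_derivative
     (\<lambda>v. 0 + (\<Sum>d\<le>r. \<Sum>i\<in>UNIV. v $ i * jet d (partial i f) w))) (at w)"
    by (intro has_derivative_add has_derivative_const has_derivative_sum has_derivative_jet_Suc[OF S]
        Ck_on_le[OF f]) simp
  moreover have "(\<Sum>d\<le>r. \<Sum>i\<in>UNIV. v $ i * jet d (partial i f) w) = (\<Sum>i\<in>UNIV. v $ i * taylor r (partial i f) w)" for v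
    unfolding taylor_def sum_distrib_left by (rule sum.swap)
  moreover have "taylor (Suc r) f = (\<lambda>w. f 0 + (\<Sum>d\<le>r. jet (Suc d) f w))"
    by (rule ext) (simp only: taylor_def sum.atMost_Suc_shift jet.simps(1))
  ultimately show ?thesis by simp
qed

text \<open>Generation by single coordinate factors fits the recursion of \<open>jet\<close> and the
  way a coordinate toggles one element of the parity class.\<close>

inductive poly_fun :: "(real^'n \<Rightarrow> real) \<Rightarrow> bool" where
  const: "poly_fun (\<lambda>_. c)"
| coord: "poly_fun p \<Longrightarrow> poly_fun (\<lambda>w. w $ i * p w)"
| add: "poly_fun p \<Longrightarrow> poly_fun q \<Longrightarrow> poly_fun (\<lambda>w. p w + q w)"

lemma poly_fun_cmult: "poly_fun p \<Longrightarrow> poly_fun (\<lambda>w. c * p w)"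
proof (induction rule: poly_fun.induct)
  case (const d)
  show ?case by (rule poly_fun.const[of "c * d"])
next
  case (coord p i)
  then show ?case using poly_fun.coord[of "\<lambda>w. c * p w" i] by (simp add: mult_ac)
next
  case (add p q)
  then show ?case using poly_fun.add[of "\<lambda>w. c * p w" "\<lambda>w. c * q w"] by (simp add: algebra_simps)
qed

lemma poly_fun_mult: "poly_fun p \<Longrightarrow> poly_fun q \<Longrightarrow> poly_fun (\<lambda>w. p w * q w)"
proof (induction rule: poly_fun.induct)
  case (const c)
  then show ?case by (rule poly_fun_cmult)
next
  case (coord p i)
  then show ?case using poly_fun.coord[of "\<lambda>w. p w * q w" i] by (simp add: mult_ac)
next
  case (add p q')
  then show ?case using poly_fun.add[of "\<lambda>w. p w * q w" "\<lambda>w. q' w * q w"] by (simp add: algebra_simps)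
qed

lemma poly_fun_sum: "(\<And>i. i \<in> I \<Longrightarrow> poly_fun (p i)) \<Longrightarrow> poly_fun (\<lambda>w. \<Sum>i\<in>I. p i w)"
  by (induction I rule: infinite_finite_induct) (auto intro: poly_fun.intros)

lemma poly_fun_jet: "poly_fun (jet d f)"
proof (induction d arbitrary: f)
  case 0
  show ?case using poly_fun.const[of "f 0"] by (simp add: jet.simps(1)[abs_def])
next
  case (Suc d)
  have "poly_fun (\<lambda>w. (1 / Suc d) * (\<Sum>i\<in>UNIV. w $ i * jet d (partial i f) w))"
    by (intro poly_fun_cmult poly_fun_sum poly_fun.coord Suc)
  then show ?case by (simp add: jet.simps(2)[abs_def])
qed

lemma poly_fun_taylor: "poly_fun (taylor r f)"
  unfolding taylor_def[abs_def] by (intro poly_fun_sum poly_fun_jet)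

lemma poly_fun_Ck_on: "poly_fun p \<Longrightarrow> open S \<Longrightarrow> Ck_on k p S"
  by (induction rule: poly_fun.induct)
    (simp, intro Ck_on_mult Ck_on_linear[OF bounded_linear_vec_nth], auto intro: Ck_on_add)

text \<open>A derivative of the remainder is the remainder of the derivative, so the induction
  hypothesis settles all derivatives, and only the size of the remainder itself has to be
  integrated.\<close>

theorem taylor_remainder:
  assumes S: "open S" "0 \<in> S" and "Ck_on r f S"
  shows "Ord_on True r (real r) (\<lambda>w. f w - taylor r f w) S"
  using assms(3)
proof (induction r arbitrary: f)
  case 0
  have "isCont f 0" using 0 S by (simp add: continuous_on_eq_continuous_at)
  then have "((\<lambda>w. f w - taylor 0 f w) \<longlongrightarrow> 0) (at 0)"
    by (simp add: taylor_def isCont_def LIM_zero_iff)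
  moreover have "continuous_on (S - {0}) (\<lambda>w. f w - taylor 0 f w)"
    using 0 by (auto simp: taylor_def intro!: continuous_intros intro: continuous_on_subset)
  ultimately show ?case by (simp add: ord_set_0_iff)
next
  case (Suc r)
  let ?R = "\<lambda>w. f w - taylor (Suc r) f w"
  have k: "Ck_on r (partial i f) S" for i using Suc.prems by simp
  note IH = Suc.IH[OF k]
  have d: "(?R has_derivative (\<lambda>v. \<Sum>i\<in>UNIV. v $ i * (partial i f x - taylor r (partial i f) x))) (at x)" if "x \<in> S" for x
  proof -
    have "(?R has_derivative (\<lambda>v. frechet_derivative f (at x) v - (\<Sum>i\<in>UNIV. v $ i * taylor r (partial i f) x))) (at x)"
      by (intro has_derivative_diff has_derivative_taylor_Suc[OF S Suc.prems] Ck_on_SucE[OF Suc.prems that])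
    moreover have "frechet_derivative f (at x) v - (\<Sum>i\<in>UNIV. v $ i * taylor r (partial i f) x) =
        (\<Sum>i\<in>UNIV. v $ i * (partial i f x - taylor r (partial i f) x))" for v
      by (subst frechet_derivative_partial)
        (use Suc.prems that in \<open>auto simp: sum_subtractf right_diff_distrib\<close>)
    ultimately show ?thesis by simp
  qed
  have axis_eq: "(\<Sum>i\<in>UNIV. axis j (1::real) $ i * g i) = g j" for g :: "'a \<Rightarrow> real" and j
    by (simp add: axis_def if_distrib if_distribR cong: if_cong)
  have const: "Ord_on False r 0 (\<lambda>_. c) S" for c
    by (rule Ck_on_imp_Ord_on_0[OF Ck_on_const S])
  have "Ord_on (False \<or> True) r (0 + real r) (\<lambda>x. v $ i * (partial i f x - taylor r (partial i f) x)) S" for v :: "real^'a" and i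
    by (rule Ord_on_mult[OF S const IH])
  then have derivs: "Ord_on True r (real r) (\<lambda>x. \<Sum>i\<in>UNIV. v $ i * (partial i f x - taylor r (partial i f) x)) S" for v
    by (intro Ord_on_sum S) simp
  have "?R \<in> ord_set True (real r + 1)"
  proof (rule ord_set_integrate[OF S])
    show "Ck_on 1 ?R S"
      by (intro Ck_on_diff S Ck_on_le[OF Suc.prems] poly_fun_Ck_on poly_fun_taylor) simp
    show "?R 0 = 0" by (simp add: taylor_at_0)
    fix i
    have eq: "partial i ?R x = partial i f x - taylor r (partial i f) x" if "x \<in> S - {0}" for x
      using frechet_derivative_eq[OF d] that by (simp add: axis_eq)
    have "partial i ?R \<in> ord_set True (real r) \<longleftrightarrow>
        (\<lambda>x. partial i f x - taylor r (partial i f) x) \<in> ord_set True (real r)"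
      by (rule ord_set_cong[OF S eq])
    then show "partial i ?R \<in> ord_set True (real r)"
      using Ord_on_ord_set[OF IH] by blast
  qed simp
  then show ?case
    by (intro Ord_on_SucI[OF S d]) (use derivs in \<open>auto simp: add.commute\<close>)
qed

section \<open>Parity and squarefree monomials\<close>

definition sign_vec :: "'n set \<Rightarrow> real^'n" where
  "sign_vec B = (\<chi> i. if i \<in> B then - 1 else 1)"

definition sign_char :: "'n::finite set \<Rightarrow> 'n set \<Rightarrow> real" where
  "sign_char A B = (\<Prod>i\<in>A. sign_vec B $ i)"

text \<open>Up to normalization, the Walsh-Fourier coefficient at the character
  \<open>sign_char A\<close> of the restriction of \<open>g\<close> to the cube vertices scaled by
  \<open>t\<close>.\<close>

definition parity_part :: "'n::finite set \<Rightarrow> (real^'n \<Rightarrow> real) \<Rightarrow> real \<Rightarrow> real" where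
  "parity_part A g t = (\<Sum>B\<in>UNIV. sign_char A B * g (t *\<^sub>R sign_vec B))"

definition toggle :: "'n \<Rightarrow> 'n set \<Rightarrow> 'n set" where
  "toggle k A = (if k \<in> A then A - {k} else insert k A)"

lemma sign_vec_square: "sign_vec B $ i * sign_vec B $ i = 1"
  by (simp add: sign_vec_def)

lemma toggle_toggle: "toggle k (toggle k A) = A"
  by (auto simp: toggle_def)

lemma sign_char_toggle_left:
  "sign_vec B $ k * sign_char A B = sign_char (toggle k A) B" for A :: "'n::finite set"
proof (cases "k \<in> A")
  case True
  then have "sign_char A B = sign_vec B $ k * sign_char (A - {k}) B"
    unfolding sign_char_def by (subst prod.remove[of _ k]) auto
  then have "sign_vec B $ k * sign_char A B = (sign_vec B $ k * sign_vec B $ k) * sign_char (A - {k}) B"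
    by (simp only: mult.assoc)
  then show ?thesis using True by (simp add: sign_vec_square toggle_def)
next
  case False
  then show ?thesis by (simp add: sign_char_def toggle_def)
qed

lemma sum_sign_char: 
  fixes A :: "'n::finite set"
  assumes "A \<noteq> {}" 
  shows "(\<Sum>B\<in>UNIV. sign_char A B) = 0"
proof -
  obtain k where k: "k \<in> A" using assms by blast
  have "sign_char A (toggle k B) = - sign_char A B" for B
  proof -
    have "(\<Prod>i\<in>A - {k}. sign_vec (toggle k B) $ i) = (\<Prod>i\<in>A - {k}. sign_vec B $ i)"
      by (rule prod.cong) (auto simp: sign_vec_def toggle_def)
    moreover have "sign_vec (toggle k B) $ k = - sign_vec B $ k"
      by (simp add: sign_vec_def toggle_def)
    ultimately show ?thesis
      unfolding sign_char_def using k by (subst (1 2) prod.remove[of _ k]) auto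
  qed
  then have "(\<Sum>B\<in>UNIV. - sign_char A B) = (\<Sum>B\<in>UNIV. sign_char A (toggle k B))" by simp
  also have "\<dots> = (\<Sum>B\<in>UNIV. sign_char A B)"
    by (rule sum.reindex_bij_witness[of _ "toggle k" "toggle k"]) (auto simp: toggle_toggle)
  finally show ?thesis by (simp add: sum_negf)
qed

text \<open>Signs common to both sets occur twice and square to 1. With \<open>sum_sign_char\<close>
  this is orthogonality of the characters.\<close>

lemma sign_char_mult: "sign_char A B * sign_char A' B = sign_char ((A - A') \<union> (A' - A)) B"
  for A :: "'n::finite set"
proof -
  have split: "sign_char A B = sign_char (A - A') B * sign_char (A \<inter> A') B" for A A' :: "'n set"
    unfolding sign_char_def by (subst prod.union_disjoint[symmetric]) (auto intro: prod.cong)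
  have sq: "sign_char (A \<inter> A') B * sign_char (A \<inter> A') B = 1"
    unfolding sign_char_def by (simp add: sign_vec_square flip: prod.distrib)
  have "sign_char A B * sign_char A' B = sign_char (A - A') B * sign_char (A' - A) B *
      (sign_char (A \<inter> A') B * sign_char (A \<inter> A') B)"
    using split[of A A'] split[of A' A] by (simp add: Int_commute mult_ac)
  also have "\<dots> = sign_char ((A - A') \<union> (A' - A)) B"
    unfolding sq unfolding sign_char_def by (subst prod.union_disjoint) auto
  finally show ?thesis .
qed

lemma card_UNIV_set: "card (UNIV :: 'n::finite set set) = 2 ^ CARD('n)"
  by (metis Pow_UNIV card_Pow finite)

lemma parity_part_monomial:
  fixes A A' :: "'n::finite set"
  shows "parity_part A (\<lambda>w. \<Prod>i\<in>A'. w $ i) t = (if A = A' then 2 ^ CARD('n) * t ^ card A else 0)"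
proof -
  have "parity_part A (\<lambda>w. \<Prod>i\<in>A'. w $ i) t = t ^ card A' * (\<Sum>B\<in>UNIV. sign_char ((A - A') \<union> (A' - A)) B)"
    unfolding parity_part_def sum_distrib_left
  proof (rule sum.cong[OF refl])
    fix B
    have "(\<Prod>i\<in>A'. (t *\<^sub>R sign_vec B) $ i) = t ^ card A' * sign_char A' B"
      by (simp add: sign_char_def prod.distrib)
    then show "sign_char A B * (\<Prod>i\<in>A'. (t *\<^sub>R sign_vec B) $ i) =
        t ^ card A' * sign_char ((A - A') \<union> (A' - A)) B"
      unfolding sign_char_mult[symmetric] by (simp only: mult_ac)
  qed
  moreover have "(\<Sum>B\<in>UNIV. sign_char ((A - A') \<union> (A' - A)) B) = (if A = A' then 2 ^ CARD('n) else 0)"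
  proof (cases "A = A'")
    case True
    then show ?thesis by (simp add: sign_char_def card_UNIV_set)
  next
    case False
    then have "(A - A') \<union> (A' - A) \<noteq> {}" by blast
    from sum_sign_char[OF this] False show ?thesis by simp
  qed
  ultimately show ?thesis by simp
qed

lemma parity_part_add: "parity_part A (\<lambda>w. f w + g w) t = parity_part A f t + parity_part A g t"
  by (simp add: parity_part_def algebra_simps sum.distrib)

lemma parity_part_diff: "parity_part A (\<lambda>w. f w - g w) t = parity_part A f t - parity_part A g t"
  by (simp add: parity_part_def algebra_simps sum_subtractf)

lemma parity_part_cmult: "parity_part A (\<lambda>w. c * f w) t = c * parity_part A f t"
  by (simp add: parity_part_def sum_distrib_left mult_ac)

lemma parity_part_sum: "parity_part A (\<lambda>w. \<Sum>i\<in>I. f i w) t = (\<Sum>i\<in>I. parity_part A (f i) t)"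
  by (simp add: parity_part_def sum_distrib_left) (rule sum.swap)

lemma parity_part_coord: "parity_part A (\<lambda>w. w $ k * f w) t = t * parity_part (toggle k A) f t"
  for A :: "'n::finite set"
  unfolding parity_part_def sum_distrib_left sign_char_toggle_left[symmetric]
  by (simp add: mult_ac)

text \<open>A coordinate factor changes the parity class by one element and pays for it with a
  factor \<open>t\<close>, so reaching the class \<open>A\<close> from the empty one costs at least
  \<open>card A\<close> factors.\<close>

lemma parity_part_poly_bound:
  assumes "poly_fun (p :: real^'n \<Rightarrow> real)"
  shows "\<exists>C\<ge>0. \<forall>A. \<forall>t\<in>{0..1}. \<bar>parity_part A p t\<bar> \<le> C * t ^ card A"
  using assms
proof induction
  case (const c)
  have "parity_part A (\<lambda>_. c) t = (if A = {} then 2 ^ CARD('n) * c else 0)" for A :: "'n set" and t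
    using parity_part_monomial[of A "{}" t] parity_part_cmult[of A c "\<lambda>_. 1" t] by simp
  then show ?case by (intro exI[of _ "2 ^ CARD('n) * \<bar>c\<bar>"]) (auto simp: abs_mult)
next
  case (coord p k)
  then obtain C where C: "C \<ge> 0" "\<And>A t. t \<in> {0..1} \<Longrightarrow> \<bar>parity_part A p t\<bar> \<le> C * t ^ card A" by blast
  have "\<bar>parity_part A (\<lambda>w. w $ k * p w) t\<bar> \<le> C * t ^ card A" if t: "t \<in> {0..1}" for A :: "'n set" and t
  proof -
    have "card A \<le> Suc (card (toggle k A))"
      by (auto simp: toggle_def card_insert_if card_Diff_singleton)
    then have "t ^ Suc (card (toggle k A)) \<le> t ^ card A" using t by (intro power_decreasing) auto
    moreover have "\<bar>parity_part A (\<lambda>w. w $ k * p w) t\<bar> \<le> t * (C * t ^ card (toggle k A))"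
      using C(2)[OF t, of "toggle k A"] t by (auto simp: parity_part_coord abs_mult intro: mult_left_mono)
    ultimately show ?thesis using C(1) mult_left_mono[of "t ^ Suc (card (toggle k A))" "t ^ card A" C]
      by (simp add: mult_ac)
  qed
  then show ?case using C(1) by blast
next
  case (add p q)
  then obtain C C' where "C \<ge> 0" "\<And>A t. t \<in> {0..1} \<Longrightarrow> \<bar>parity_part A p t\<bar> \<le> C * t ^ card A"
    "C' \<ge> 0" "\<And>A t. t \<in> {0..1} \<Longrightarrow> \<bar>parity_part A q t\<bar> \<le> C' * t ^ card A" by meson
  then have "\<bar>parity_part A (\<lambda>w. p w + q w) t\<bar> \<le> (C + C') * t ^ card A" if "t \<in> {0..1}" for A :: "'n set" and t
    using that unfolding parity_part_add distrib_right by (intro abs_triangle_ineq[THEN order_trans] add_mono) auto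
  then show ?case using \<open>C \<ge> 0\<close> \<open>C' \<ge> 0\<close> by (intro exI[of _ "C + C'"]) auto
qed

text \<open>A monomial is squarefree or divisible by the square of some coordinate. Multiplying a
  squarefree one by a coordinate either keeps it squarefree or creates that square.\<close>

lemma poly_fun_squarefree_form:
  assumes "poly_fun (p :: real^'n \<Rightarrow> real)"
  shows "\<exists>c s. (\<forall>i. poly_fun (s i)) \<and>
    (\<forall>w. p w = (\<Sum>A\<in>UNIV. c A * (\<Prod>i\<in>A. w $ i)) + (\<Sum>i\<in>UNIV. s i w * (w $ i)\<^sup>2))"
  using assms
proof induction
  case (const c)
  have "c = (\<Sum>A\<in>UNIV. (if A = {} then c else 0) * (\<Prod>i\<in>A. w $ i)) + (\<Sum>i\<in>UNIV. 0 * (w $ i)\<^sup>2)" for w :: "real^'n"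
    by (simp add: if_distrib if_distribR cong: if_cong)
  then show ?case using poly_fun.const
    by (intro exI[of _ "\<lambda>A. if A = {} then c else 0"] exI[of _ "\<lambda>_ _. 0"]) auto
next
  case (coord p k)
  then obtain c s where s: "\<And>i. poly_fun (s i)" and
    p: "\<And>w. p w = (\<Sum>A\<in>UNIV. c A * (\<Prod>i\<in>A. w $ i)) + (\<Sum>i\<in>UNIV. s i w * (w $ i)\<^sup>2)" by blast
  let ?c = "\<lambda>A. if k \<in> A then c (A - {k}) else 0"
  \<comment> \<open>The squarefree terms that already contain the coordinate \<open>k\<close>:
    multiplication by it moves them into the coefficient of its square.\<close>
  let ?q = "\<lambda>w. \<Sum>A | k \<in> A. c A * (\<Prod>i\<in>A - {k}. w $ i)"
  let ?s = "\<lambda>i w. w $ k * s i w + (if i = k then 1 else 0) * ?q w"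
  have mon: "poly_fun (\<lambda>w. \<Prod>i\<in>B. w $ i)" for B :: "'n set"
    by (induction B rule: infinite_finite_induct) (auto intro: poly_fun.const poly_fun.coord)
  have "poly_fun (?s i)" for i
    by (intro poly_fun.add poly_fun.coord s poly_fun_cmult poly_fun_sum mon)
  moreover have "w $ k * p w = (\<Sum>A\<in>UNIV. ?c A * (\<Prod>i\<in>A. w $ i)) + (\<Sum>i\<in>UNIV. ?s i w * (w $ i)\<^sup>2)" for w
  proof -
    have UN: "(UNIV :: 'n set set) = {A. k \<in> A} \<union> {A. k \<notin> A}" by auto
    have "w $ k * (\<Sum>A\<in>UNIV. c A * (\<Prod>i\<in>A. w $ i)) =
        (\<Sum>A | k \<in> A. w $ k * (c A * (\<Prod>i\<in>A. w $ i))) + (\<Sum>A | k \<notin> A. w $ k * (c A * (\<Prod>i\<in>A. w $ i)))"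
      unfolding sum_distrib_left by (subst UN, subst sum.union_disjoint) auto
    also have "(\<Sum>A | k \<in> A. w $ k * (c A * (\<Prod>i\<in>A. w $ i))) = ?q w * (w $ k)\<^sup>2"
      unfolding sum_distrib_right
    proof (rule sum.cong[OF refl])
      fix A assume "A \<in> {A. k \<in> A}"
      then have "(\<Prod>i\<in>A. w $ i) = w $ k * (\<Prod>i\<in>A - {k}. w $ i)" by (subst prod.remove[of _ k]) auto
      then show "w $ k * (c A * (\<Prod>i\<in>A. w $ i)) = c A * (\<Prod>i\<in>A - {k}. w $ i) * (w $ k)\<^sup>2"
        by (simp add: power2_eq_square)
    qed
    also have "(\<Sum>A | k \<notin> A. w $ k * (c A * (\<Prod>i\<in>A. w $ i))) = (\<Sum>A | k \<in> A. c (A - {k}) * (\<Prod>i\<in>A. w $ i))"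
      by (rule sum.reindex_bij_witness[of _ "\<lambda>A. A - {k}" "insert k"]) auto
    also have "\<dots> = (\<Sum>A\<in>UNIV. ?c A * (\<Prod>i\<in>A. w $ i))"
      by (rule sum.mono_neutral_cong_left) auto
    finally have "w $ k * (\<Sum>A\<in>UNIV. c A * (\<Prod>i\<in>A. w $ i)) =
      ?q w * (w $ k)\<^sup>2 + (\<Sum>A\<in>UNIV. ?c A * (\<Prod>i\<in>A. w $ i))" .
    moreover have "(\<Sum>i\<in>UNIV. ?s i w * (w $ i)\<^sup>2) = w $ k * (\<Sum>i\<in>UNIV. s i w * (w $ i)\<^sup>2) + ?q w * (w $ k)\<^sup>2"
    proof -
      have "?s i w * (w $ i)\<^sup>2 = w $ k * (s i w * (w $ i)\<^sup>2) + (if i = k then ?q w * (w $ k)\<^sup>2 else 0)" for i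
        by (auto simp: algebra_simps simp del: sum_distrib_left)
      then show ?thesis by (simp add: sum.distrib sum_distrib_left)
    qed
    ultimately show ?thesis unfolding p distrib_left by simp
  qed
  ultimately show ?case by (intro exI[of _ ?c] exI[of _ ?s]) auto
next
  case (add p q)
  then obtain c s c' s' where s: "\<And>i. poly_fun (s i)" "\<And>i. poly_fun (s' i)" and
    p: "\<And>w. p w = (\<Sum>A\<in>UNIV. c A * (\<Prod>i\<in>A. w $ i)) + (\<Sum>i\<in>UNIV. s i w * (w $ i)\<^sup>2)" 
    "\<And>w. q w = (\<Sum>A\<in>UNIV. c' A * (\<Prod>i\<in>A. w $ i)) + (\<Sum>i\<in>UNIV. s' i w * (w $ i)\<^sup>2)" by meson
  show ?case
    by (intro exI[of _ "\<lambda>A. c A + c' A"] exI[of _ "\<lambda>i w. s i w + s' i w"])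
      (auto simp: p distrib_right sum.distrib intro: poly_fun.add s)
qed

lemma norm_sign_vec: "norm (sign_vec B :: real^'n) = sqrt (CARD('n))"
  by (simp add: norm_eq_sqrt_inner inner_vec_def sign_vec_square)

lemma parity_part_small_order:
  fixes g :: "real^'n \<Rightarrow> real"
  assumes "g \<in> ord_set True (real m)"
  shows "((\<lambda>t. parity_part A g t / t ^ m) \<longlongrightarrow> 0) (at_right 0)"
proof -
  have "((\<lambda>t. g (t *\<^sub>R sign_vec B) / t ^ m) \<longlongrightarrow> 0) (at_right 0)" for B
  proof -
    have lim: "filterlim (\<lambda>t. t *\<^sub>R (sign_vec B :: real^'n)) (at 0) (at_right 0)"
      unfolding filterlim_at
    proof
      show "((\<lambda>t. t *\<^sub>R (sign_vec B :: real^'n)) \<longlongrightarrow> 0) (at_right 0)"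
        by (auto intro!: tendsto_eq_intros)
      have "sign_vec B \<noteq> (0 :: real^'n)" using norm_sign_vec[of B] by fastforce
      then show "\<forall>\<^sub>F t in at_right 0. t *\<^sub>R (sign_vec B :: real^'n) \<in> UNIV \<and> t *\<^sub>R (sign_vec B :: real^'n) \<noteq> 0"
        by (simp add: eventually_at_filter)
    qed
    have "g \<in> o[at 0](\<lambda>w. norm w powr real m)" using assms by (simp add: ord_set_def)
    from landau_o.small.compose[OF this lim]
    have "(\<lambda>t. g (t *\<^sub>R sign_vec B)) \<in> o[at_right 0](\<lambda>t. norm (t *\<^sub>R (sign_vec B :: real^'n)) powr real m)" .
    also have "(\<lambda>t. norm (t *\<^sub>R (sign_vec B :: real^'n)) powr real m) \<in> O[at_right 0](\<lambda>t. t ^ m)"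
    \<comment> \<open>All sign vectors have norm \<open>sqrt (CARD('n))\<close>.\<close>
    proof (rule landau_o.bigI[of "sqrt (CARD('n)) ^ m"])
      have "norm (t *\<^sub>R (sign_vec B :: real^'n)) powr real m = sqrt (CARD('n)) ^ m * t ^ m" if "t > 0" for t
        using that by (simp add: norm_sign_vec powr_realpow power_mult_distrib)
      then show "\<forall>\<^sub>F t in at_right 0. norm (norm (t *\<^sub>R (sign_vec B :: real^'n)) powr real m) \<le> sqrt (CARD('n)) ^ m * norm (t ^ m)"
        by (auto simp: eventually_at_filter)
    qed simp
    finally show ?thesis
      by (rule smalloD_tendsto)
  qed
  then have "((\<lambda>t. \<Sum>B\<in>UNIV. sign_char A B * (g (t *\<^sub>R sign_vec B) / t ^ m)) \<longlongrightarrow> (\<Sum>B\<in>UNIV. sign_char A B * 0)) (at_right 0)"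
    by (intro tendsto_sum tendsto_mult tendsto_const)
  then show ?thesis by (simp add: parity_part_def sum_divide_distrib)
qed

text \<open>On the lines through the sign vectors all squares \<open>(w $ i)\<^sup>2\<close> agree, so there \<open>E\<close> is \<open>t\<^sup>2\<close> times a
  \<open>C\<^sup>r\<close> function, whose parity part with respect to \<open>A\<close> is of order \<open>t ^ card A\<close>.\<close>

lemma squarefree_coefficient_zero:
  fixes E :: "real^'n \<Rightarrow> real"
  assumes p: "\<And>w. p w = (\<Sum>A\<in>UNIV. c A * (\<Prod>i\<in>A. w $ i)) + (\<Sum>i\<in>UNIV. s i w * (w $ i)\<^sup>2)"
    and s: "\<And>i. poly_fun (s i)"
    and E: "(\<lambda>w. E w - p w) \<in> ord_set True (real (r + 2))"
    and P: "poly_fun P" and \<tau>: "(\<lambda>w. \<tau> w - P w) \<in> ord_set True (real r)"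
    and line: "\<And>B. \<forall>\<^sub>F t in at_right 0. E (t *\<^sub>R sign_vec B) = t\<^sup>2 * \<tau> (t *\<^sub>R sign_vec B)"
    and A: "card A \<le> r + 2"
  shows "c A = 0"
proof -
  define d where "d = card A"
  have pp: "parity_part A p t = 2 ^ CARD('n) * c A * t ^ d + t\<^sup>2 * (\<Sum>i\<in>UNIV. parity_part A (s i) t)" for t
  proof -
    have "parity_part A (\<lambda>w. s i w * (w $ i)\<^sup>2) t = t\<^sup>2 * parity_part A (s i) t" for i
      using parity_part_coord[of A i "\<lambda>w. w $ i * s i w" t] parity_part_coord[of "toggle i A" i "s i" t]
      by (simp add: toggle_toggle power2_eq_square mult_ac)
    moreover have "(\<Sum>A'\<in>UNIV. c A' * parity_part A (\<lambda>w. \<Prod>i\<in>A'. w $ i) t) = 2 ^ CARD('n) * c A * t ^ d"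
      by (simp add: parity_part_monomial d_def if_distrib cong: if_cong)
    moreover have "parity_part A p t = parity_part A (\<lambda>w. (\<Sum>A\<in>UNIV. c A * (\<Prod>i\<in>A. w $ i)) + (\<Sum>i\<in>UNIV. s i w * (w $ i)\<^sup>2)) t"
      by (simp add: p[abs_def])
    ultimately show ?thesis
      by (simp add: parity_part_add parity_part_sum parity_part_cmult sum_distrib_left)
  qed
  have pE: "\<forall>\<^sub>F t in at_right 0. parity_part A E t = t\<^sup>2 * parity_part A \<tau> t"
  proof -
    have "\<forall>\<^sub>F t in at_right 0. \<forall>B\<in>UNIV. E (t *\<^sub>R sign_vec B) = t\<^sup>2 * \<tau> (t *\<^sub>R sign_vec B)"
      using line by (intro eventually_ball_finite) auto
    then show ?thesis
      by eventually_elim (simp add: parity_part_def sum_distrib_left mult_ac)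
  qed
  have small: "\<forall>\<^sub>F t in at_right 0. 0 < t \<and> t < (1::real)"
    by (auto simp: eventually_at_right[of 0 1] intro!: exI[of _ 1])
  let ?e1 = "\<lambda>t. parity_part A (\<lambda>w. E w - p w) t / t ^ (r + 2)"
  let ?e2 = "\<lambda>t. parity_part A (\<lambda>w. \<tau> w - P w) t / t ^ r"
  have e: "(?e1 \<longlongrightarrow> 0) (at_right 0)" "(?e2 \<longlongrightarrow> 0) (at_right 0)"
    using parity_part_small_order[OF E] parity_part_small_order[OF \<tau>] by auto
  obtain C0 where C0: "C0 \<ge> 0" "\<And>t. t \<in> {0..1} \<Longrightarrow> \<bar>parity_part A P t\<bar> \<le> C0 * t ^ d"
    using parity_part_poly_bound[OF P] unfolding d_def by meson
  have "\<forall>i. \<exists>C. \<forall>t\<in>{0..1}. \<bar>parity_part A (s i) t\<bar> \<le> C * t ^ d"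
    using parity_part_poly_bound[OF s] unfolding d_def by meson
  then obtain C where C: "\<And>i t. t \<in> {0..1} \<Longrightarrow> \<bar>parity_part A (s i) t\<bar> \<le> C i * t ^ d" by metis
  \<comment> \<open>After division by \<open>t ^ d\<close> the squarefree coefficient is constant,
    whereas the parity parts of \<open>P\<close> and of all \<open>s i\<close> are of order
    \<open>t ^ d\<close> and enter with an extra \<open>t\<^sup>2\<close>. The remainders have the
    factor \<open>t ^ (r + 2)\<close>, harmless because \<open>d\<close> is at most
    \<open>r + 2\<close>.\<close>
  define K where "K = C0 + (\<Sum>i\<in>UNIV. C i)"
  have bound: "\<forall>\<^sub>F t in at_right 0. \<bar>2 ^ CARD('n) * c A\<bar> \<le> t\<^sup>2 * K + \<bar>?e1 t\<bar> + \<bar>?e2 t\<bar>"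
    using pE small
  proof eventually_elim
    case (elim t)
    have t: "t \<in> {0..1}" "0 < t" using elim by auto
    have eq: "2 ^ CARD('n) * c A * t ^ d = t\<^sup>2 * parity_part A P t - t\<^sup>2 * (\<Sum>i\<in>UNIV. parity_part A (s i) t)
        + t ^ (r + 2) * (?e2 t - ?e1 t)"
      using elim pp[of t] t by (simp add: parity_part_diff field_simps power_add power2_eq_square)
    have 1: "\<bar>parity_part A P t - (\<Sum>i\<in>UNIV. parity_part A (s i) t)\<bar> \<le> K * t ^ d"
    proof -
      have "\<bar>\<Sum>i\<in>UNIV. parity_part A (s i) t\<bar> \<le> (\<Sum>i\<in>UNIV. C i * t ^ d)"
        by (rule order_trans[OF sum_abs sum_mono[OF C[OF t(1)]]])
      then show ?thesis using C0(2)[OF t(1)] by (simp add: K_def distrib_right sum_distrib_right)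
    qed
    have 2: "t ^ (r + 2) \<le> t ^ d" using A t by (intro power_decreasing) (auto simp: d_def)
    have "\<bar>2 ^ CARD('n) * c A\<bar> * t ^ d = \<bar>2 ^ CARD('n) * c A * t ^ d\<bar>"
      using t by (simp add: abs_mult)
    also have "\<dots> = \<bar>t\<^sup>2 * (parity_part A P t - (\<Sum>i\<in>UNIV. parity_part A (s i) t))
        + t ^ (r + 2) * (?e2 t - ?e1 t)\<bar>"
      unfolding eq by (simp only: right_diff_distrib)
    also have "\<dots> \<le> t\<^sup>2 * (K * t ^ d) + t ^ d * (\<bar>?e1 t\<bar> + \<bar>?e2 t\<bar>)"
    proof (rule order_trans[OF abs_triangle_ineq add_mono])
      show "\<bar>t\<^sup>2 * (parity_part A P t - (\<Sum>i\<in>UNIV. parity_part A (s i) t))\<bar> \<le> t\<^sup>2 * (K * t ^ d)"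
        using 1 by (simp add: abs_mult mult_left_mono)
      have "\<bar>?e2 t - ?e1 t\<bar> \<le> \<bar>?e1 t\<bar> + \<bar>?e2 t\<bar>" by linarith
      then show "\<bar>t ^ (r + 2) * (?e2 t - ?e1 t)\<bar> \<le> t ^ d * (\<bar>?e1 t\<bar> + \<bar>?e2 t\<bar>)"
        unfolding abs_mult using 2 t by (intro mult_mono) auto
    qed
    also have "\<dots> = (t\<^sup>2 * K + \<bar>?e1 t\<bar> + \<bar>?e2 t\<bar>) * t ^ d" by (simp add: algebra_simps)
    finally show ?case using t by simp
  qed
  have lim: "((\<lambda>t. t\<^sup>2 * K + \<bar>?e1 t\<bar> + \<bar>?e2 t\<bar>) \<longlongrightarrow> 0\<^sup>2 * K + \<bar>0\<bar> + \<bar>0\<bar>) (at_right 0)"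
    by (intro tendsto_intros e)
  have "\<bar>2 ^ CARD('n) * c A\<bar> \<le> 0\<^sup>2 * K + \<bar>0\<bar> + \<bar>0\<bar>"
    by (rule tendsto_lowerbound[OF lim bound]) simp
  then show ?thesis by simp
qed

lemma Ord_on_monomial:
  assumes S: "open S" "0 \<in> S"
  shows "Ord_on False j (real (card A)) (\<lambda>w::real^'n. \<Prod>i\<in>A. w $ i) S"
proof (induction A rule: infinite_finite_induct)
  case empty
  show ?case using Ck_on_imp_Ord_on_0[OF Ck_on_const S] by simp
next
  case (insert i A)
  have "Ord_on (False \<or> False) j (1 + real (card A)) (\<lambda>w. w $ i * (\<Prod>i\<in>A. w $ i)) S"
    by (intro Ord_on_mult S insert Ord_on_linear bounded_linear_vec_nth)
  then show ?case using insert by (simp add: add.commute)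
qed simp

theorem weighted_squares:
  fixes E :: "real^'n \<Rightarrow> real"
  assumes S: "open S" "0 \<in> S"
    and p: "poly_fun p" and E: "Ord_on True r (real (r + 2)) (\<lambda>w. E w - p w) S" and E0: "E 0 = 0"
    and \<tau>: "Ck_on r \<tau> S"
    and line: "\<And>B. \<forall>\<^sub>F t in at_right 0. E (t *\<^sub>R sign_vec B) = t\<^sup>2 * \<tau> (t *\<^sub>R sign_vec B)"
  shows "\<exists>b. (\<forall>i. Ck_on r (b i) S) \<and> (\<forall>w\<in>S. E w = (\<Sum>i\<in>UNIV. b i w * (w $ i)\<^sup>2))"
proof -
  obtain c s where s: "\<And>i. poly_fun (s i)" and
    ps: "\<And>w. p w = (\<Sum>A\<in>UNIV. c A * (\<Prod>i\<in>A. w $ i)) + (\<Sum>i\<in>UNIV. s i w * (w $ i)\<^sup>2)"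
    using poly_fun_squarefree_form[OF p] by blast
  have c0: "c A = 0" if "card A \<le> r + 2" for A
    by (rule squarefree_coefficient_zero[OF ps s Ord_on_ord_set[OF E] poly_fun_taylor
          Ord_on_ord_set[OF taylor_remainder[OF S \<tau>]] line that])
  define e where "e w = E w - (\<Sum>i\<in>UNIV. s i w * (w $ i)\<^sup>2)" for w
  \<comment> \<open>Squarefree monomials of degree above \<open>r + 2\<close> may survive in
    \<open>p\<close>, but they are small enough to join the remainder.\<close>
  have mon: "Ord_on True r (real (r + 2)) (\<lambda>w. c A * (\<Prod>i\<in>A. w $ i)) S" for A
  proof (cases "card A \<le> r + 2")
    case True
    then show ?thesis using c0 by (simp add: Ord_on_zero)
  next
    case False
    have "Ord_on (False \<or> False) r (0 + real (card A)) (\<lambda>w. c A * (\<Prod>i\<in>A. w $ i)) S"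
      by (intro Ord_on_mult S Ord_on_monomial Ck_on_imp_Ord_on_0 Ck_on_const)
    then show ?thesis by (rule Ord_on_mono) (use False in auto)
  qed
  have "Ord_on True r (real (r + 2)) (\<lambda>w. (E w - p w) + (\<Sum>A\<in>UNIV. c A * (\<Prod>i\<in>A. w $ i))) S"
    by (intro Ord_on_add S E Ord_on_sum mon)
  then have e: "Ord_on True r (real (r + 2)) e S"
    by (rule Ord_on_cong[OF _ S]) (simp add: ps e_def)
  have e0: "e 0 = 0" by (simp add: e_def E0)
  have "Ord_on (True \<or> False) r (real (r + 2) + (-2)) (\<lambda>w. e w * inverse (w \<bullet> w)) S"
    by (intro Ord_on_mult S e Ord_on_inverse_norm2)
  \<comment> \<open>Since \<open>e 0 = 0\<close>, the quotient has the value 0 at the origin, which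
    is also its limit.\<close>
  then have ek: "Ck_on r (\<lambda>w. e w * inverse (w \<bullet> w)) S"
    by (intro Ord_on_imp_Ck_on S) (auto simp: e0)
  define b where "b i w = s i w + e w * inverse (w \<bullet> w)" for i w
  have "Ck_on r (b i) S" for i
    unfolding b_def[abs_def] by (intro Ck_on_add S poly_fun_Ck_on s ek)
  moreover have "E w = (\<Sum>i\<in>UNIV. b i w * (w $ i)\<^sup>2)" for w
  proof -
    have "w \<bullet> w = (\<Sum>i\<in>UNIV. (w $ i)\<^sup>2)" by (simp add: inner_vec_def power2_eq_square)
    then have "(\<Sum>i\<in>UNIV. b i w * (w $ i)\<^sup>2) = (\<Sum>i\<in>UNIV. s i w * (w $ i)\<^sup>2) + e w * inverse (w \<bullet> w) * (w \<bullet> w)"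
      by (simp add: b_def distrib_right sum.distrib sum_distrib_left)
    also have "e w * inverse (w \<bullet> w) * (w \<bullet> w) = e w" using e0 by (cases "w = 0") auto
    finally show ?thesis by (simp add: e_def)
  qed
  ultimately show ?thesis by blast
qed

section \<open>Spectral projections along a homeomorphism of spheres\<close>

lemma Ord_on_diff:
  assumes S: "open S" "0 \<in> S" and "Ord_on l j m f S" "Ord_on l j m g S"
  shows "Ord_on l j m (\<lambda>x. f x - g x) S"
proof -
  have "Ord_on (False \<or> l) j (0 + m) (\<lambda>x. - 1 * g x) S"
    by (intro Ord_on_mult S assms Ck_on_imp_Ord_on_0 Ck_on_const)
  then show ?thesis using Ord_on_add[OF S assms(3), of "\<lambda>x. - 1 * g x"] by simp
qed

text \<open>The factors are replaced by Taylor polynomials one at a time; each error o(|w|^r) meets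
  two factors of order 1. For \<open>r = 0\<close> the middle factor is merely o(1), but then the
  whole product is already o(|w|^2) and the polynomial 0 serves.\<close>

lemma triple_product_remainder:
  fixes f g h :: "real^'n \<Rightarrow> real"
  assumes S: "open S" "0 \<in> S" and k: "Ck_on r f S" "Ck_on r g S" "Ck_on r h S"
    and f: "f \<in> ord_set False 1" and h: "h \<in> ord_set False 1" and g0: "g 0 = 0"
  shows "\<exists>p. poly_fun p \<and> Ord_on True r (real (r + 2)) (\<lambda>w. f w * g w * h w - p w) S"
proof -
  have F: "Ord_on False r 1 f S" and H: "Ord_on False r 1 h S"
    by (intro Ck_on_imp_Ord_on_1 S k f h)+
  show ?thesis
  proof (cases r)
    case 0
    have "isCont g 0" using k(2) S 0 by (simp add: continuous_on_eq_continuous_at)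
    then have G: "Ord_on True r 0 g S"
      using k(2) 0 g0 by (auto simp: ord_set_0_iff isCont_def intro: continuous_on_subset)
    have "Ord_on ((False \<or> True) \<or> False) r ((1 + 0) + 1) (\<lambda>w. f w * g w * h w) S"
      by (intro Ord_on_mult S F G H)
    then show ?thesis using 0 by (intro exI[of _ "\<lambda>_. 0"] conjI poly_fun.const) simp
  next
    case (Suc r')
    have "g differentiable (at 0)" using k(2) Suc S by simp
    then have G: "Ord_on False r 1 g S"
      by (intro Ck_on_imp_Ord_on_1 S k differentiable_imp_ord_set_1 g0)
    have e: "Ord_on True r (real r) (\<lambda>w. u w - taylor r u w) S" if "Ck_on r u S" for u
      by (rule taylor_remainder[OF S that])
    have t: "Ord_on False r 1 (taylor r u) S" if "Ck_on r u S" "Ord_on False r 1 u S" for u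
    proof -
      have "Ord_on False r 1 (\<lambda>w. u w - taylor r u w) S"
        by (rule Ord_on_mono[OF e[OF that(1)]]) (use Suc in auto)
      from Ord_on_diff[OF S that(2) this] show ?thesis by simp
    qed
    have "Ord_on (True \<or> (False \<or> False)) r (real r + (1 + 1)) (\<lambda>w. (f w - taylor r f w) * (g w * h w)) S"
      by (intro Ord_on_mult S e k G H)
    moreover have "Ord_on (False \<or> (True \<or> False)) r (1 + (real r + 1)) (\<lambda>w. taylor r f w * ((g w - taylor r g w) * h w)) S"
      by (intro Ord_on_mult S e k t F H)
    moreover have "Ord_on (False \<or> (False \<or> True)) r (1 + (1 + real r)) (\<lambda>w. taylor r f w * (taylor r g w * (h w - taylor r h w))) S"
      by (intro Ord_on_mult S e k t F G)
    ultimately have "Ord_on True r (real (r + 2)) (\<lambda>w. ((f w - taylor r f w) * (g w * h w) +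
        taylor r f w * ((g w - taylor r g w) * h w)) + taylor r f w * (taylor r g w * (h w - taylor r h w))) S"
      by (intro Ord_on_add S) (simp_all add: add_ac)
    then have "Ord_on True r (real (r + 2)) (\<lambda>w. f w * g w * h w - taylor r f w * (taylor r g w * taylor r h w)) S"
      by (simp add: algebra_simps)
    then show ?thesis
      by (intro exI[of _ "\<lambda>w. taylor r f w * (taylor r g w * taylor r h w)"] conjI poly_fun_mult poly_fun_taylor)
  qed
qed

text \<open>Preservation of the norm makes the coordinates of \<open>z\<close> of order 1 even for
  \<open>r = 0\<close>, where regularity does not; the entries of \<open>B\<close> are the third
  vanishing factor.\<close>

lemma Ord_on_quadratic_form:
  fixes z :: "real^'n \<Rightarrow> real^'n" and B :: "real^'n \<Rightarrow> real^'n^'n"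
  assumes S: "open S" "0 \<in> S" and z: "Ck_on r z S" "\<And>w. w \<in> S \<Longrightarrow> norm (z w) = norm w"
    and B: "Ck_on r B S" "B 0 = 0"
  shows "\<exists>p. poly_fun p \<and> Ord_on True r (real (r + 2)) (\<lambda>w. z w \<bullet> (B w *v z w) - p w) S"
proof -
  have zi: "(\<lambda>w. z w $ i) \<in> ord_set False 1" for i
  proof -
    have "\<forall>\<^sub>F w in at 0. norm (z w $ i) \<le> 1 * norm (norm w powr 1)"
      using eventually_at_0_in[OF S]
    proof eventually_elim
      case (elim w)
      then show ?case using component_le_norm_cart[of "z w" i] z(2)[of w] by simp
    qed
    from bigoI[OF this] show ?thesis by (simp add: ord_set_def)
  qed
  have ex: "\<exists>p. poly_fun p \<and> Ord_on True r (real (r + 2)) (\<lambda>w. z w $ i * B w $ i $ j * z w $ j - p w) S" for i j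
  proof (rule triple_product_remainder[OF S])
    show "Ck_on r (\<lambda>w. z w $ i) S" "Ck_on r (\<lambda>w. z w $ j) S"
      by (rule Ck_on_nth[OF S(1) z(1)])+
    show "Ck_on r (\<lambda>w. B w $ i $ j) S" by (rule Ck_on_nth[OF S(1) Ck_on_nth[OF S(1) B(1)]])
    show "B 0 $ i $ j = 0" by (simp add: B(2))
  qed (rule zi)+
  define p where "p i j = (SOME p. poly_fun p \<and>
      Ord_on True r (real (r + 2)) (\<lambda>w. z w $ i * B w $ i $ j * z w $ j - p w) S)" for i j
  have p: "poly_fun (p i j)" "Ord_on True r (real (r + 2)) (\<lambda>w. z w $ i * B w $ i $ j * z w $ j - p i j w) S" for i j
    using someI_ex[OF ex[of i j]] unfolding p_def by blast+
  have "Ord_on True r (real (r + 2)) (\<lambda>w. \<Sum>i\<in>UNIV. \<Sum>j\<in>UNIV. z w $ i * B w $ i $ j * z w $ j - p i j w) S"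
    by (intro Ord_on_sum S p)
  moreover have "(\<Sum>i\<in>UNIV. \<Sum>j\<in>UNIV. z w $ i * B w $ i $ j * z w $ j - p i j w) =
      z w \<bullet> (B w *v z w) - (\<Sum>i\<in>UNIV. \<Sum>j\<in>UNIV. p i j w)" for w
    by (simp add: inner_vec_def matrix_vector_mult_def sum_distrib_left sum_subtractf mult.assoc)
  moreover have "poly_fun (\<lambda>w. \<Sum>i\<in>UNIV. \<Sum>j\<in>UNIV. p i j w)" by (intro poly_fun_sum p(1))
  ultimately show ?thesis
    by (intro exI[of _ "\<lambda>w. \<Sum>i\<in>UNIV. \<Sum>j\<in>UNIV. p i j w"] conjI) simp_all
qed

section \<open>Nearby projections and constancy of the subset\<close>

lemma spec_mat_inner_sym: "(spec_mat T d *v x) \<bullet> y = x \<bullet> (spec_mat T d *v y)"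
  by (subst inner_commute) (simp only: spec_mat_inner mult_ac)

lemma spec_mat_projection:
  assumes T: "orthogonal_matrix T" and c: "\<And>i. c i = 0 \<or> c i = (1::real)"
  shows "spec_mat T c *v (spec_mat T c *v x) = spec_mat T c *v x"
    and "(norm (spec_mat T c *v x))\<^sup>2 = x \<bullet> (spec_mat T c *v x)"
proof -
  have idem: "(\<lambda>i. c i * c i) = c"
  proof
    show "c i * c i = c i" for i using c[of i] by auto
  qed
  show *: "spec_mat T c *v (spec_mat T c *v x) = spec_mat T c *v x"
    unfolding matrix_vector_mul_assoc spec_mat_mult[OF T] idem ..
  show "(norm (spec_mat T c *v x))\<^sup>2 = x \<bullet> (spec_mat T c *v x)"
    by (simp add: power2_norm_eq_inner spec_mat_inner_sym * )
qed

text \<open>On the range of the projection, \<open>Q\<close> differs from the identity by at most a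
  quarter, so it annihilates no nonzero vector there; and for a projected vector,
  \<open>x \<bullet> y\<close> is the square of its norm.\<close>

lemma near_projection:
  fixes T Q :: "real^'n^'n" and x :: "real^'n"
  assumes T: "orthogonal_matrix T" and c: "\<And>i. c i = 0 \<or> c i = (1::real)"
    and near: "\<And>x. norm (Q *v x - spec_mat T c *v x) \<le> 1/4 * norm x"
  defines "y \<equiv> spec_mat T c *v x"
  shows "norm (Q *v y - y) \<le> 1/4 * norm y" and "Q *v y = 0 \<longleftrightarrow> x \<bullet> y = 0"
    and "norm y \<le> norm x"
proof -
  note pr = spec_mat_projection[where T = T and c = c and x = x, OF T c, folded y_def]
  show n: "norm (Q *v y - y) \<le> 1/4 * norm y" using near[of y] pr(1) by simp
  have "Q *v y = 0 \<longleftrightarrow> y = 0"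
  proof
    assume "Q *v y = 0"
    then show "y = 0" using n by simp
  qed simp
  then show "Q *v y = 0 \<longleftrightarrow> x \<bullet> y = 0" unfolding pr(2)[symmetric] by simp
  have "norm y * norm y \<le> norm x * norm y"
    using pr(2) norm_cauchy_schwarz[of x y] by (simp add: power2_eq_square)
  then show "norm y \<le> norm x" by (cases "y = 0") (auto simp: mult_le_cancel_right)
qed

lemma matrix_vector_mult_small:
  fixes A :: "'a::real_normed_vector \<Rightarrow> real^'n^'n"
  assumes A: "isCont A a" and e: "e > 0"
  shows "\<forall>\<^sub>F w in nhds a. \<forall>x. norm (A w *v x - A a *v x) \<le> e * norm x"
proof -
  interpret bounded_bilinear "\<lambda>(A::real^'n^'n) (x::real^'n). A *v x"
    by (rule bounded_bilinear_matrix_vector_mult)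
  obtain K where K: "K > 0" "\<And>B x. norm (B *v x) \<le> norm (B :: real^'n^'n) * norm x * K"
    using pos_bounded by blast
  have "\<forall>\<^sub>F w in nhds a. dist (A w) (A a) < e / K"
    using tendstoD[OF A[unfolded isCont_def tendsto_at_iff_tendsto_nhds], of "e / K"] e K by simp
  then show ?thesis
  proof eventually_elim
    case (elim w)
    show ?case
    proof
      fix x
      have "norm (A w *v x - A a *v x) \<le> norm (A w - A a) * norm x * K"
        unfolding diff_left[symmetric] by (rule K)
      also have "\<dots> \<le> (e / K) * norm x * K"
        using elim K by (intro mult_right_mono) (auto simp: dist_norm)
      finally show "norm (A w *v x - A a *v x) \<le> e * norm x" using K by simp
    qed
  qed
qed

text \<open>In the eigenbasis \<open>T w\<close> the vector \<open>z w\<close> has the coordinates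
  of \<open>w\<close>, so the form of the projection is a subset sum; continuity of the projection
  makes it continuous, although \<open>c\<close> may jump.\<close>

lemma projection_subset_constant:
  fixes T :: "real^'n \<Rightarrow> real^'n^'n"
  assumes S: "open S" "0 \<in> S"
    and T: "\<And>w. w \<in> S \<Longrightarrow> orthogonal_matrix (T w)"
    and c: "\<And>w i. c w i = 0 \<or> c w i = (1::real)"
    and P: "continuous_on S (\<lambda>w. spec_mat (T w) (c w))"
    and z: "continuous_on S z" "\<And>w. w \<in> S \<Longrightarrow> z w = T w *v w"
    and sph: "\<delta> > 0" "\<And>s. 0 < s \<Longrightarrow> s < \<delta> \<Longrightarrow> \<exists>z'. homeomorphism (sphere 0 s) (sphere 0 s) z z'"
  shows "\<exists>A. \<forall>\<^sub>F w in nhds 0. z w \<bullet> (spec_mat (T w) (c w) *v z w) = (\<Sum>i\<in>A. (w $ i)\<^sup>2)"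
proof -
  define P where "P w = spec_mat (T w) (c w)" for w
  define P' where "P' w = spec_mat (T w) (\<lambda>i. 1 - c w i)" for w
  have P'_eq: "P' w = mat 1 - P w" if "w \<in> S" for w
  proof -
    have "P w + P' w = spec_mat (T w) (\<lambda>i. 1)" by (simp add: P_def P'_def spec_mat_add)
    then show ?thesis using spec_mat_const[OF T[OF that], of 1] by (simp add: algebra_simps)
  qed
  have c': "1 - c w i = 0 \<or> 1 - c w i = 1" for w i using c[of w i] by auto
  have contP: "continuous_on S P" using P by (simp add: P_def[abs_def])
  then have contP': "continuous_on S P'"
    by (intro continuous_on_eq[of S "\<lambda>w. mat 1 - P w" P'] continuous_on_diff continuous_on_const)
      (auto simp: P'_eq)
  have "isCont P 0" "isCont P' 0" using contP contP' S by (auto simp: continuous_on_eq_continuous_at)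
  then have "\<forall>\<^sub>F w in nhds 0. (\<forall>x. norm (P w *v x - P 0 *v x) \<le> 1/4 * norm x) \<and>
      (\<forall>x. norm (P' w *v x - P' 0 *v x) \<le> 1/4 * norm x) \<and> w \<in> S"
    using S by (intro eventually_conj matrix_vector_mult_small eventually_nhds_in_open) auto
  then obtain e where e: "e > 0" "\<And>w x. norm w < e \<Longrightarrow> norm (P w *v x - P 0 *v x) \<le> 1/4 * norm x"
    "\<And>w x. norm w < e \<Longrightarrow> norm (P' w *v x - P' 0 *v x) \<le> 1/4 * norm x" "\<And>w. norm w < e \<Longrightarrow> w \<in> S"
    unfolding eventually_nhds_metric by auto
  define s where "s = min e \<delta> / 2"
  have s: "0 < s" "s < e" "s < \<delta>" using e(1) sph(1) by (auto simp: s_def)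
  have inS: "w \<in> S" if "w \<in> cball 0 s" for w using e(4)[of w] that s by simp
  note near = near_projection[where T = "T w" and c = "c w" and Q = "P 0" for w, OF T c, folded P_def]
    and near' = near_projection[where T = "T w" and c = "\<lambda>i. 1 - c w i" and Q = "P' 0" for w, OF T c', folded P'_def]
  have nP: "norm (P 0 *v x - P w *v x) \<le> 1/4 * norm x" "norm (P' 0 *v x - P' w *v x) \<le> 1/4 * norm x"
    if "w \<in> cball 0 s" for w x
    using e(2)[of w x] e(3)[of w x] that s by (auto simp: norm_minus_commute)
  have nz: "norm (z w) = norm w" if "w \<in> cball 0 s" for w
    using z(2)[OF inS[OF that]] orthogonal_matrixD(6)[OF T[OF inS[OF that]]] by simp
  have zsplit: "z w = P w *v z w + P' w *v z w" if "w \<in> cball 0 s" for w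
    using P'_eq[OF inS[OF that]] by (simp add: matrix_vector_mult_diff_rdistrib)
  define \<rho> where "\<rho> w = z w \<bullet> (P w *v z w)" for w
  have \<rho>': "z w \<bullet> (P' w *v z w) = (norm w)\<^sup>2 - \<rho> w" if "w \<in> cball 0 s" for w
    using arg_cong[OF zsplit[OF that], of "inner (z w)"] nz[OF that]
    by (simp add: \<rho>_def inner_add_right dot_square_norm)
  \<comment> \<open>The second projection is frozen at the origin, so that \<open>a v\<close> and
    \<open>b w\<close> are orthogonal also for different arguments. Close to the origin it does not
    change where they vanish.\<close>
  define a where "a w = P 0 *v (P w *v z w)" for w
  define b where "b w = P' 0 *v (P' w *v z w)" for w
  have sub: "continuous_on (cball 0 s) h" if "continuous_on S h" for h :: "real^'n \<Rightarrow> 'b::topological_space"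
    using continuous_on_subset[OF that] inS by blast
  note mv = bounded_bilinear.continuous_on[OF bounded_bilinear_matrix_vector_mult]
  interpret essential_splitting s a b \<rho>
  proof
    show "continuous_on (cball 0 s) a" "continuous_on (cball 0 s) b" "continuous_on (cball 0 s) \<rho>"
      unfolding a_def[abs_def] b_def[abs_def] \<rho>_def[abs_def]
      by (intro mv continuous_on_const continuous_on_inner sub contP contP' z(1))+
    show "a v \<bullet> b w = 0" for v w
    proof -
      have "P 0 ** P' 0 = spec_mat (T 0) (\<lambda>i. c 0 i * (1 - c 0 i))"
        unfolding P_def P'_def by (rule spec_mat_mult[OF T[OF S(2)]])
      also have "(\<lambda>i. c 0 i * (1 - c 0 i)) = (\<lambda>i. 0)" using c[of 0] by (auto simp: fun_eq_iff)
      also have "spec_mat (T 0) (\<lambda>i. 0) = 0"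
        using spec_mat_scaleR[of 0 "T 0" "\<lambda>i. 0"] by simp
      finally have "P 0 *v (P' 0 *v x) = 0" for x by (simp add: matrix_vector_mul_assoc)
      then show ?thesis
        unfolding a_def b_def P_def[of 0] spec_mat_inner_sym by (simp flip: P_def)
    qed
    show "\<exists>A. \<rho> w = (\<Sum>i\<in>A. (w $ i)\<^sup>2)" if w: "w \<in> cball 0 s" for w
    proof -
      have "transpose (T w) *v z w = w"
        using z(2)[OF inS[OF w]] orthogonal_matrixD(4)[OF T[OF inS[OF w]]] by simp
      then have "\<rho> w = (\<Sum>i\<in>UNIV. c w i * (w $ i)\<^sup>2)"
        unfolding \<rho>_def P_def spec_mat_inner by (simp add: power2_eq_square mult.assoc)
      also have "\<dots> = (\<Sum>i | c w i = 1. (w $ i)\<^sup>2)"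
        by (rule sum.mono_neutral_cong_right) (use c[of w] in auto)
      finally show ?thesis by blast
    qed
    show "a w = 0 \<longleftrightarrow> \<rho> w = 0" if "w \<in> cball 0 s" for w
      unfolding a_def \<rho>_def by (rule near(2)[OF inS[OF that] nP(1)[OF that]])
    show "b w = 0 \<longleftrightarrow> \<rho> w = (norm w)\<^sup>2" if "w \<in> cball 0 s" for w
      using near'(2)[OF inS[OF that] nP(2)[OF that], of "z w"] \<rho>'[OF that] by (auto simp: b_def)
    obtain z' where z': "homeomorphism (sphere 0 s) (sphere 0 s) z z'" using sph(2) s by blast
    show "\<not> homotopic_with_canon (\<lambda>_. True) (sphere 0 s) (- {0}) (\<lambda>w. a w + b w) (\<lambda>_. k)" for k
    proof (rule near_homeomorphism_sphere_essential[OF s(1) z'])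
      show "continuous_on (sphere 0 s) (\<lambda>w. a w + b w)"
        unfolding a_def[abs_def] b_def[abs_def]
        by (intro continuous_on_add mv continuous_on_const continuous_on_subset[OF sub[OF contP]]
          continuous_on_subset[OF sub[OF contP']] continuous_on_subset[OF sub[OF z(1)]]) auto
      fix w :: "real^'n" assume "w \<in> sphere 0 s"
      then have w: "w \<in> cball 0 s" and nw: "norm w = s" by auto
      let ?y = "P w *v z w" and ?y' = "P' w *v z w"
      have "a w + b w - z w = (P 0 *v ?y - ?y) + (P' 0 *v ?y' - ?y')"
        unfolding a_def b_def by (subst zsplit[OF w]) simp
      then have "norm (a w + b w - z w) \<le> norm (P 0 *v ?y - ?y) + norm (P' 0 *v ?y' - ?y')"
        by (metis norm_triangle_ineq)
      \<comment> \<open>Both parts move by at most a quarter of their norm, so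
        \<open>a w + b w\<close> stays within half the radius of \<open>z w\<close>, which keeps the
        map essential.\<close>
      also have "\<dots> \<le> 1/4 * norm ?y + 1/4 * norm ?y'"
        by (intro add_mono near(1)[OF inS[OF w] nP(1)[OF w]] near'(1)[OF inS[OF w] nP(2)[OF w]])
      also have "\<dots> \<le> 1/4 * norm (z w) + 1/4 * norm (z w)"
        using near(3)[OF inS[OF w] nP(1)[OF w], of "z w"] near'(3)[OF inS[OF w] nP(2)[OF w], of "z w"]
        by (intro add_mono) auto
      also have "\<dots> < s" using nz[OF w] nw s by simp
      finally show "norm (a w + b w - z w) < s" .
    qed
  qed (rule s)
  obtain A where A: "\<And>w. w \<in> cball 0 s \<Longrightarrow> \<rho> w = (\<Sum>i\<in>A. (w $ i)\<^sup>2)" using subset_constant by blast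
  have "\<forall>\<^sub>F w in nhds 0. w \<in> ball (0::real^'n) s" using s by (intro eventually_nhds_in_open) auto
  then have "\<forall>\<^sub>F w in nhds 0. \<rho> w = (\<Sum>i\<in>A. (w $ i)\<^sup>2)" by eventually_elim (use A in auto)
  then show ?thesis by (auto simp: \<rho>_def P_def)
qed

section \<open>Perturbation and separation of eigenvalues\<close>

text \<open>A unit eigenvector of the first matrix for \<open>d i\<close> is an approximate
  eigenvector of the second. If \<open>d i\<close> were farther than \<open>e\<close> from every
  \<open>d0 j\<close>, its expansion in the second eigenbasis would show an error larger than
  \<open>e\<close>.\<close>

lemma eigenvalue_near:
  fixes T T0 :: "real^'n^'n"
  assumes T: "orthogonal_matrix T" "orthogonal_matrix T0"
    and near: "\<And>x. norm (spec_mat T d *v x - spec_mat T0 d0 *v x) \<le> e * norm x"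
  shows "\<exists>j. \<bar>d i - d0 j\<bar> \<le> e"
proof (rule ccontr)
  assume contra: "\<not> ?thesis"
  have e: "e \<ge> 0" using near[of "axis i 1"] norm_ge_zero[of "spec_mat T d *v axis i 1 - spec_mat T0 d0 *v axis i 1"]
    unfolding norm_axis_1 by linarith
  let ?x = "T *v axis i 1"
  let ?y = "transpose T0 *v ?x"
  have nx: "norm ?x = 1" by (simp only: orthogonal_matrixD(6)[OF T(1)] norm_axis_1)
  then have ny: "norm ?y = 1" by (simp only: orthogonal_matrixD(5)[OF T(2)])
  have "spec_mat T d *v ?x = T *v (\<chi> j. d j * axis i 1 $ j)"
    by (simp only: spec_mat_mv orthogonal_matrixD(4)[OF T(1)])
  also have "(\<chi> j. d j * axis i 1 $ j) = d i *\<^sub>R axis i 1" by (simp add: vec_eq_iff axis_def)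
  finally have "spec_mat T d *v ?x = T0 *v (d i *\<^sub>R ?y)"
    by (simp only: matrix_vector_mult_scaleR orthogonal_matrixD(3)[OF T(2)])
  then have eq: "spec_mat T d *v ?x - spec_mat T0 d0 *v ?x = T0 *v (d i *\<^sub>R ?y - (\<chi> j. d0 j * ?y $ j))"
    by (simp only: spec_mat_mv matrix_vector_mult_diff_distrib)
  let ?v = "d i *\<^sub>R ?y - (\<chi> j. d0 j * ?y $ j)"
  have v: "?v $ j = (d i - d0 j) * ?y $ j" for j by (simp only: vector_minus_component vector_scaleR_component vec_lambda_beta real_scaleR_def left_diff_distrib)
  have "norm ?v \<le> e" using near[of ?x] unfolding eq orthogonal_matrixD(6)[OF T(2)] nx by simp
  then have "(norm ?v)\<^sup>2 \<le> e\<^sup>2" by (intro power_mono) auto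
  moreover have "e\<^sup>2 < (norm ?v)\<^sup>2"
  proof -
    have sq: "(norm u)\<^sup>2 = (\<Sum>j\<in>UNIV. (u $ j)\<^sup>2)" for u :: "real^'n"
      unfolding power2_norm_eq_inner inner_vec_def by (simp add: power2_eq_square)
    have "?y \<noteq> 0" using ny by (metis norm_zero zero_neq_one)
    then obtain k where k: "?y $ k \<noteq> 0" by (metis vec_eq_iff zero_index)
    have lt: "e\<^sup>2 < (d i - d0 j)\<^sup>2" for j
    proof -
      have "e < \<bar>d i - d0 j\<bar>" using contra by (simp add: not_le)
      then show ?thesis using power_strict_mono[of e "\<bar>d i - d0 j\<bar>" 2] e by simp
    qed
    have "e\<^sup>2 = e\<^sup>2 * (norm ?y)\<^sup>2" unfolding ny by simp
    also have "\<dots> = (\<Sum>j\<in>UNIV. e\<^sup>2 * (?y $ j)\<^sup>2)" unfolding sq sum_distrib_left ..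
    also have "\<dots> < (\<Sum>j\<in>UNIV. (?v $ j)\<^sup>2)"
    proof (rule sum_strict_mono_ex1)
      show "\<forall>j\<in>UNIV. e\<^sup>2 * (?y $ j)\<^sup>2 \<le> (?v $ j)\<^sup>2"
        unfolding v power_mult_distrib by (intro ballI mult_right_mono less_imp_le[OF lt] zero_le_power2)
      show "\<exists>j\<in>UNIV. e\<^sup>2 * (?y $ j)\<^sup>2 < (?v $ j)\<^sup>2"
        unfolding v power_mult_distrib
        by (intro bexI[of _ k] mult_strict_right_mono lt) (use k in \<open>simp_all del: transpose_matrix_vector\<close>)
    qed simp
    also have "\<dots> = (norm ?v)\<^sup>2" by (rule sq[symmetric])
    finally show ?thesis .
  qed
  ultimately show False by simp
qed

lemma spec_mat_sum: "finite I \<Longrightarrow> (\<Sum>l\<in>I. spec_mat T (d l)) = spec_mat T (\<lambda>i. \<Sum>l\<in>I. d l i)"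
proof (induction I rule: finite_induct)
  case empty
  show ?case using spec_mat_scaleR[of 0 T "\<lambda>i. 0"] by simp
next
  case (insert l I)
  then show ?case by (simp add: spec_mat_add)
qed

lemma trace_spec_mat:
  assumes "orthogonal_matrix (T :: real^'n^'n)"
  shows "trace (spec_mat T d) = (\<Sum>i\<in>UNIV. d i)"
proof -
  have "trace (spec_mat T d) = trace ((\<chi> i j. if i = j then d i else 0) ** (transpose T ** T))"
    unfolding spec_mat_def matrix_mul_assoc[symmetric] by (subst trace_mul_sym) (simp add: matrix_mul_assoc)
  then show ?thesis using orthogonal_matrixD(2)[OF assms] by (simp add: trace_def)
qed

lemma finite_real_separated:
  fixes L :: "real set"
  assumes "finite L"
  shows "\<exists>\<eta>>0. \<forall>x\<in>L. \<forall>y\<in>L. x \<noteq> y \<longrightarrow> 2 * \<eta> \<le> \<bar>x - y\<bar>"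
proof -
  \<comment> \<open>The element 1 keeps the minimum meaningful when \<open>L\<close> has no two
    distinct members.\<close>
  define G where "G = insert 1 ((\<lambda>(x, y). \<bar>x - y\<bar>) ` {p \<in> L \<times> L. fst p \<noteq> snd p})"
  have G: "finite G" "G \<noteq> {}" "\<And>g. g \<in> G \<Longrightarrow> 0 < g" using assms by (auto simp: G_def)
  have "Min G \<le> \<bar>x - y\<bar>" if "x \<in> L" "y \<in> L" "x \<noteq> y" for x y
    by (rule Min_le[OF G(1)]) (use that in \<open>force simp: G_def\<close>)
  moreover have "0 < Min G" using G by simp
  ultimately show ?thesis by (intro exI[of _ "Min G / 2"]) auto
qed

section \<open>The diagonal form\<close>

lemma local_diagonal_form:
  fixes z :: "real^'n \<Rightarrow> real^'n" and T :: "real^'n \<Rightarrow> real^'n^'n" and D :: "real^'n \<Rightarrow> 'n \<Rightarrow> real"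
  assumes W: "open W" "0 \<in> W" and z: "Ck_on r z W" and N: "Ck_on r N W"
    and T: "\<And>w. w \<in> W \<Longrightarrow> orthogonal_matrix (T w)"
    and N_eq: "\<And>w. w \<in> W \<Longrightarrow> N w = spec_mat (T w) (D w)"
    and z_eq: "\<And>w. w \<in> W \<Longrightarrow> z w = T w *v w"
    and sph: "\<delta> > 0" "\<And>s. 0 < s \<Longrightarrow> s < \<delta> \<Longrightarrow> \<exists>z'. homeomorphism (sphere 0 s) (sphere 0 s) z z'"
  shows "\<exists>S b. open S \<and> 0 \<in> S \<and> S \<subseteq> W \<and> (\<forall>i. Ck_on r (b i) S) \<and>
    (\<forall>w\<in>S. z w \<bullet> (N w *v z w) = (\<Sum>i\<in>UNIV. b i w * (w $ i)\<^sup>2))"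
proof -
  have q: "z w \<bullet> (N w *v z w) = (\<Sum>i\<in>UNIV. D w i * (w $ i)\<^sup>2)" if "w \<in> W" for w
  proof -
    have "transpose (T w) *v z w = w"
      unfolding z_eq[OF that] by (rule orthogonal_matrixD(4)[OF T[OF that]])
    then show ?thesis unfolding N_eq[OF that] spec_mat_inner by (simp add: power2_eq_square mult.assoc)
  qed
  have contN: "isCont N 0"
    using Ck_on_imp_continuous_on[OF N] W by (simp add: continuous_on_eq_continuous_at)
  define L where "L = range (D 0)"
  have L: "finite L" by (simp add: L_def)
  obtain \<eta> where \<eta>: "\<eta> > 0" "\<And>x y. x \<in> L \<Longrightarrow> y \<in> L \<Longrightarrow> x \<noteq> y \<Longrightarrow> 2 * \<eta> \<le> \<bar>x - y\<bar>"
    using finite_real_separated[OF L] by blast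
  have "\<forall>\<^sub>F w in nhds 0. (\<forall>x. norm (N w *v x - N 0 *v x) \<le> (\<eta>/2) * norm x) \<and> w \<in> W"
    using \<eta> W by (intro eventually_conj matrix_vector_mult_small contN eventually_nhds_in_open) auto
  then obtain e where e: "e > 0" "\<And>w x. norm w < e \<Longrightarrow> norm (N w *v x - N 0 *v x) \<le> (\<eta>/2) * norm x"
    "\<And>w. norm w < e \<Longrightarrow> w \<in> W"
    unfolding eventually_nhds_metric by auto
  define S where "S = ball (0::real^'n) e"
  have S: "open S" "0 \<in> S" "S \<subseteq> W" using e by (auto simp: S_def)
  \<comment> \<open>positive exactly for the eigenvalues of \<open>N w\<close> close to \<open>l\<close>\<close>
  define C where "C l w i = \<eta>\<^sup>2 - (D w i - l)\<^sup>2" for l w i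
  define c :: "real \<Rightarrow> real^'n \<Rightarrow> 'n \<Rightarrow> real" where "c l w i = (if C l w i > 0 then 1 else 0)" for l w i
  define Pi where "Pi l w = spec_mat (T w) (c l w)" for l w
  \<comment> \<open>Eigenvalues of \<open>N w\<close> lie within \<eta>/2 of \<open>L\<close>, whose
    members are 2\<eta> apart. Their distance to \<open>l\<close> is therefore at most \<eta>/2 or
    at least 3\<eta>/2, so \<open>C l w i\<close> is at least 3/4 or at most -5/4 of the square of
    \<eta>.\<close>
  have gap: "3/4 * \<eta>\<^sup>2 \<le> \<bar>C l w i\<bar>" if "l \<in> L" "w \<in> S" for l w i
  proof -
    have w: "norm w < e" "w \<in> W" using that(2) S by (auto simp: S_def)
    obtain j where j: "\<bar>D w i - D 0 j\<bar> \<le> \<eta>/2"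
      using eigenvalue_near[OF T[OF w(2)] T[OF W(2)], of "D w" "D 0" "\<eta>/2"] e(2)[OF w(1)]
      unfolding N_eq[OF w(2)] N_eq[OF W(2)] by blast
    show ?thesis
    proof (cases "D 0 j = l")
      case True
      then have "(D w i - l)\<^sup>2 \<le> (\<eta>/2)\<^sup>2"
        using j \<eta>(1) by (intro power2_le_iff_abs_le[THEN iffD2]) auto
      then have "(D w i - l)\<^sup>2 \<le> \<eta>\<^sup>2 / 4" by (simp add: power_divide)
      then show ?thesis unfolding C_def by linarith
    next
      case False
      have "2 * \<eta> \<le> \<bar>D 0 j - l\<bar>" using \<eta>(2)[OF _ that(1) False] by (simp add: L_def)
      then have "3/2 * \<eta> \<le> \<bar>D w i - l\<bar>" using j by linarith
      then have "(3/2 * \<eta>)\<^sup>2 \<le> \<bar>D w i - l\<bar>\<^sup>2" using \<eta> by (intro power_mono) auto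
      then have "9/4 * \<eta>\<^sup>2 \<le> (D w i - l)\<^sup>2" by (simp add: power_mult_distrib power_divide)
      then show ?thesis using zero_le_power2[of \<eta>] unfolding C_def by linarith
    qed
  qed
  have CC: "Ck_on r (\<lambda>w. spec_mat (T w) (C l w)) S" for l
  proof -
    \<comment> \<open>The matrix with eigenvalues \<open>C l w\<close> is a polynomial in
      \<open>N w\<close>, hence regular independently of the choice of eigenvectors.\<close>
    have "Ck_on r (\<lambda>w. mat (\<eta>\<^sup>2) + (-1) *\<^sub>R ((N w + mat (- l)) ** (N w + mat (- l)))) S"
      using Ck_on_subset[OF N S(3)]
      by (intro Ck_on_add Ck_on_scaleR Ck_on_matrix_mult Ck_on_const S)
    then show ?thesis
    proof (rule Ck_on_cong[OF _ S(1)])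
      fix w assume "w \<in> S"
      then have w: "w \<in> W" using S by blast
      note const = spec_mat_const[OF T[OF w], symmetric]
      show "mat (\<eta>\<^sup>2) + (-1) *\<^sub>R ((N w + mat (- l)) ** (N w + mat (- l))) = spec_mat (T w) (C l w)"
        unfolding N_eq[OF w] const spec_mat_add spec_mat_mult[OF T[OF w]] spec_mat_scaleR
        by (simp add: C_def[abs_def] power2_eq_square algebra_simps)
    qed
  qed
  have CP: "Ck_on r (Pi l) S" if "l \<in> L" for l
    unfolding Pi_def[abs_def] c_def[abs_def]
    by (rule Ck_on_spectral_projection[OF S(1) _ _ gap[OF that] CC]) (use \<eta> T S in auto)
  have "\<exists>A. \<forall>\<^sub>F w in nhds 0. z w \<bullet> (Pi l w *v z w) = (\<Sum>i\<in>A. (w $ i)\<^sup>2)" if "l \<in> L" for l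
    unfolding Pi_def
  proof (rule projection_subset_constant[OF S(1,2) _ _ _ _ _ sph])
    show "continuous_on S (\<lambda>w. spec_mat (T w) (c l w))"
      using Ck_on_imp_continuous_on[OF CP[OF that]] by (simp add: Pi_def[abs_def])
    show "continuous_on S z" using Ck_on_imp_continuous_on[OF z] continuous_on_subset S(3) by blast
  qed (use T z_eq S(3) in \<open>auto simp: c_def\<close>)
  then have "\<forall>l\<in>L. \<exists>A. \<forall>\<^sub>F w in nhds 0. z w \<bullet> (Pi l w *v z w) = (\<Sum>i\<in>A. (w $ i)\<^sup>2)" ..
  from bchoice[OF this]
  obtain A where A: "\<And>l. l \<in> L \<Longrightarrow> \<forall>\<^sub>F w in nhds 0. z w \<bullet> (Pi l w *v z w) = (\<Sum>i\<in>A l. (w $ i)\<^sup>2)"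
    by blast
  \<comment> \<open>The weight of coordinate \<open>i\<close> collects the eigenvalues
    \<open>l\<close> of \<open>N 0\<close> whose subset contains \<open>i\<close>.\<close>
  define \<kappa> where "\<kappa> i = (\<Sum>l\<in>L. if i \<in> A l then l else 0)" for i
  define K where "K w = (\<Sum>l\<in>L. l *\<^sub>R Pi l w)" for w
  interpret mv: bounded_bilinear "\<lambda>(A::real^'n^'n) (x::real^'n). A *v x"
    by (rule bounded_bilinear_matrix_vector_mult)
  have "\<forall>\<^sub>F w in nhds 0. \<forall>l\<in>L. z w \<bullet> (Pi l w *v z w) = (\<Sum>i\<in>A l. (w $ i)\<^sup>2)"
    using A by (intro eventually_ball_finite L) auto
  then have "\<forall>\<^sub>F w in nhds 0. z w \<bullet> (K w *v z w) = (\<Sum>i\<in>UNIV. \<kappa> i * (w $ i)\<^sup>2)"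
  proof eventually_elim
    case (elim w)
    have "z w \<bullet> (K w *v z w) = (\<Sum>l\<in>L. l * (z w \<bullet> (Pi l w *v z w)))"
      unfolding K_def mv.sum_left mv.scaleR_left by (simp add: inner_sum_right)
    also have "\<dots> = (\<Sum>l\<in>L. \<Sum>i\<in>UNIV. (if i \<in> A l then l else 0) * (w $ i)\<^sup>2)"
    proof (rule sum.cong[OF refl])
      fix l assume l: "l \<in> L"
      have "(\<Sum>i\<in>UNIV. (if i \<in> A l then l else 0) * (w $ i)\<^sup>2) = (\<Sum>i\<in>A l. l * (w $ i)\<^sup>2)"
        by (rule sum.mono_neutral_cong_right) auto
      then show "l * (z w \<bullet> (Pi l w *v z w)) = (\<Sum>i\<in>UNIV. (if i \<in> A l then l else 0) * (w $ i)\<^sup>2)"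
        using elim l by (simp add: sum_distrib_left)
    qed
    also have "\<dots> = (\<Sum>i\<in>UNIV. \<kappa> i * (w $ i)\<^sup>2)"
      unfolding \<kappa>_def sum_distrib_right by (rule sum.swap)
    finally show ?case .
  qed
  then have "\<forall>\<^sub>F w in nhds 0. z w \<bullet> (K w *v z w) = (\<Sum>i\<in>UNIV. \<kappa> i * (w $ i)\<^sup>2) \<and> w \<in> S"
    using S by (intro eventually_conj eventually_nhds_in_open) auto
  then obtain S' where S': "open S'" "0 \<in> S'" "S' \<subseteq> S"
    and K_form: "\<And>w. w \<in> S' \<Longrightarrow> z w \<bullet> (K w *v z w) = (\<Sum>i\<in>UNIV. \<kappa> i * (w $ i)\<^sup>2)"
    unfolding eventually_nhds by blast
  have S'W: "S' \<subseteq> W" using S'(3) S(3) by blast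
  have K: "Ck_on r K S'"
    unfolding K_def[abs_def]
    by (intro Ck_on_sum Ck_on_scaleR Ck_on_const S' Ck_on_subset[OF CP S'(3)])
  define B where "B w = N w - K w" for w
  have B: "Ck_on r B S'"
    unfolding B_def[abs_def] by (intro Ck_on_diff S' K Ck_on_subset[OF N S'W])
  \<comment> \<open>At the origin \<open>Pi l\<close> selects exactly the eigenvalues equal to
    \<open>l\<close>, so \<open>K 0\<close> is the spectral decomposition of
    \<open>N 0\<close>.\<close>
  have "K 0 = N 0"
  proof -
    have "(\<Sum>l\<in>L. l * c l 0 i) = D 0 i" for i
    proof -
      have i: "D 0 i \<in> L" by (simp add: L_def)
      have "l * c l 0 i = (if l = D 0 i then D 0 i else 0)" if "l \<in> L" for l
      proof (cases "l = D 0 i")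
        case True
        then show ?thesis using \<eta> by (simp add: c_def C_def)
      next
        case False
        have "(2 * \<eta>)\<^sup>2 \<le> \<bar>D 0 i - l\<bar>\<^sup>2" using \<eta>(2)[OF i that] \<eta>(1) False by (intro power_mono) auto
        then have "C l 0 i \<le> - 3 * \<eta>\<^sup>2" by (simp add: C_def power_mult_distrib)
        then have "\<not> C l 0 i > 0" using zero_le_power2[of \<eta>] by linarith
        then show ?thesis using False by (simp add: c_def)
      qed
      then have "(\<Sum>l\<in>L. l * c l 0 i) = (\<Sum>l\<in>L. if l = D 0 i then D 0 i else 0)"
        by (rule sum.cong[OF refl])
      then show ?thesis using i L by simp
    qed
    then show ?thesis
      unfolding K_def Pi_def N_eq[OF W(2)] by (simp add: spec_mat_scaleR spec_mat_sum[OF L])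
  qed
  then have B0: "B 0 = 0" by (simp add: B_def)
  define E where "E w = z w \<bullet> (B w *v z w)" for w
  have E_eq: "E w = z w \<bullet> (N w *v z w) - (\<Sum>i\<in>UNIV. \<kappa> i * (w $ i)\<^sup>2)" if "w \<in> S'" for w
    unfolding E_def B_def mv.diff_left inner_diff_right K_form[OF that] ..
  have nz: "norm (z w) = norm w" if "w \<in> S'" for w
    using z_eq orthogonal_matrixD(6)[OF T] that S'W by auto
  obtain p where p: "poly_fun p" "Ord_on True r (real (r + 2)) (\<lambda>w. E w - p w) S'"
    using Ord_on_quadratic_form[OF S'(1,2) Ck_on_subset[OF z S'W] nz B B0] unfolding E_def by blast
  \<comment> \<open>Single eigenvalues may be irregular in \<open>w\<close>, but their sum is the
    trace, and on the sign lines only this sum is seen.\<close>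
  define \<tau> where "\<tau> w = trace (N w) - (\<Sum>i\<in>UNIV. \<kappa> i)" for w
  have \<tau>: "Ck_on r \<tau> S'"
    unfolding \<tau>_def[abs_def] trace_def
    by (intro Ck_on_diff Ck_on_sum Ck_on_const S' Ck_on_nth Ck_on_subset[OF N S'W])
  have line: "\<forall>\<^sub>F t in at_right 0. E (t *\<^sub>R sign_vec Bs) = t\<^sup>2 * \<tau> (t *\<^sub>R sign_vec Bs)" for Bs :: "'n set"
  proof -
    have "((\<lambda>t. t *\<^sub>R (sign_vec Bs :: real^'n)) \<longlongrightarrow> 0) (at_right 0)"
      by (auto intro!: tendsto_eq_intros)
    then have "\<forall>\<^sub>F t in at_right 0. t *\<^sub>R (sign_vec Bs :: real^'n) \<in> S'"
      using S'(1,2) by (rule topological_tendstoD)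
    then show ?thesis
    proof eventually_elim
      case (elim t)
      let ?w = "t *\<^sub>R (sign_vec Bs :: real^'n)"
      have wW: "?w \<in> W" using elim S'W by blast
      have sq: "(?w $ i)\<^sup>2 = t\<^sup>2" for i
        using sign_vec_square[of Bs i] by (simp add: power_mult_distrib power2_eq_square)
      have "E ?w = (\<Sum>i\<in>UNIV. D ?w i * t\<^sup>2) - (\<Sum>i\<in>UNIV. \<kappa> i * t\<^sup>2)"
        unfolding E_eq[OF elim] q[OF wW] sq ..
      also have "\<dots> = t\<^sup>2 * \<tau> ?w"
        unfolding \<tau>_def N_eq[OF wW] trace_spec_mat[OF T[OF wW]]
        unfolding sum_distrib_right[symmetric] by (simp add: algebra_simps)
      finally show ?case .
    qed
  qed
  have "z 0 = 0" using z_eq[OF W(2)] by simp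
  then have E0: "E 0 = 0" by (simp add: E_def)
  obtain b where b: "\<And>i. Ck_on r (b i) S'" "\<And>w. w \<in> S' \<Longrightarrow> E w = (\<Sum>i\<in>UNIV. b i w * (w $ i)\<^sup>2)"
    using weighted_squares[OF S'(1,2) p E0 \<tau> line] by blast
  have "Ck_on r (\<lambda>w. \<kappa> i + b i w) S'" for i
    by (intro Ck_on_add Ck_on_const S' b)
  moreover have "z w \<bullet> (N w *v z w) = (\<Sum>i\<in>UNIV. (\<kappa> i + b i w) * (w $ i)\<^sup>2)" if "w \<in> S'" for w
    using E_eq[OF that] b(2)[OF that] by (simp add: distrib_right sum.distrib)
  ultimately show ?thesis
    using S' S'W by (intro exI[of _ S'] exI[of _ "\<lambda>i w. \<kappa> i + b i w"]) auto
qed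

section \<open>Cutoff and passage to the whole domain\<close>

lemma Ck_on_cutoff:
  fixes d :: real
  assumes "d > 0"
  obtains \<zeta> :: "'a::euclidean_space \<Rightarrow> real" where "Ck_on r \<zeta> UNIV" "\<And>w. 0 \<le> \<zeta> w" "\<And>w. \<zeta> w \<le> 1"
    "\<And>w. norm w \<le> d \<Longrightarrow> \<zeta> w = 1" "\<And>w. 3/2 * d \<le> norm w \<Longrightarrow> \<zeta> w = 0"
proof
  define m :: "real \<Rightarrow> real" where "m x = max 0 x ^ Suc r" for x
  \<comment> \<open>the inner truncation makes \<open>\<zeta>\<close> constant near the origin, the outer one far from it\<close>
  define \<zeta> where "\<zeta> w = m (1 - m ((w \<bullet> w) / d\<^sup>2 - 1))" for w :: 'a
  have m: "Ck_on r m UNIV" unfolding m_def[abs_def] by (rule Ck_on_max0_power)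
  have m_bounds: "0 \<le> m x" "x \<le> 1 \<Longrightarrow> m x \<le> 1" "1 \<le> x \<Longrightarrow> 1 \<le> m x" "x \<le> 0 \<Longrightarrow> m x = 0" "m 1 = 1" for x
    by (auto simp: m_def power_le_one one_le_power simp del: power_Suc)
  have "Ck_on r (\<lambda>w::'a. (w \<bullet> w) * (1 / d\<^sup>2) - 1) UNIV"
    by (intro Ck_on_diff Ck_on_mult Ck_on_inner Ck_on_ident Ck_on_const open_UNIV)
  then have "Ck_on r (\<lambda>w::'a. m ((w \<bullet> w) * (1 / d\<^sup>2) - 1)) UNIV"
    by (rule Ck_on_compose[OF open_UNIV open_UNIV _ _ m]) simp
  then have "Ck_on r (\<lambda>w::'a. 1 - m ((w \<bullet> w) * (1 / d\<^sup>2) - 1)) UNIV"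
    by (intro Ck_on_diff Ck_on_const open_UNIV)
  then have "Ck_on r (\<lambda>w::'a. m (1 - m ((w \<bullet> w) * (1 / d\<^sup>2) - 1))) UNIV"
    by (rule Ck_on_compose[OF open_UNIV open_UNIV _ _ m]) simp
  then show "Ck_on r \<zeta> UNIV" by (simp add: \<zeta>_def[abs_def])
  show "0 \<le> \<zeta> w" "\<zeta> w \<le> 1" for w using m_bounds(1,2) by (auto simp: \<zeta>_def)
  show "\<zeta> w = 1" if "norm w \<le> d" for w
  proof -
    have "w \<bullet> w \<le> d\<^sup>2" using that by (simp add: dot_square_norm power_mono)
    then have "(w \<bullet> w) / d\<^sup>2 - 1 \<le> 0" using assms by (simp add: divide_le_eq)
    then show ?thesis by (simp add: \<zeta>_def m_bounds(4,5))
  qed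
  show "\<zeta> w = 0" if "3/2 * d \<le> norm w" for w
  proof -
    have "(3/2 * d)\<^sup>2 \<le> w \<bullet> w"
      unfolding dot_square_norm using that assms by (intro power_mono) auto
    then have "9 * d\<^sup>2 \<le> 4 * (w \<bullet> w)" by (simp add: power_mult_distrib power_divide)
    \<comment> \<open>The radius factor 3/2 is chosen because its square exceeds 2, where the inner
      truncation reaches 1.\<close>
    then have "2 * d\<^sup>2 \<le> w \<bullet> w" using zero_le_power2[of d] by linarith
    then have "1 \<le> (w \<bullet> w) / d\<^sup>2 - 1" using assms by (simp add: le_divide_eq)
    then have "1 - m ((w \<bullet> w) / d\<^sup>2 - 1) \<le> 0" using m_bounds(3) by simp
    then show ?thesis unfolding \<zeta>_def by (rule m_bounds(4))
  qed
qed

theorem diagonal_form: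
  fixes z :: "real^'n \<Rightarrow> real^'n" and T :: "real^'n \<Rightarrow> real^'n^'n" and D :: "real^'n \<Rightarrow> 'n \<Rightarrow> real"
  assumes W: "open W" "0 \<in> W" and z: "Ck_on r z W" and N: "Ck_on r N W"
    and T: "\<And>w. w \<in> W \<Longrightarrow> orthogonal_matrix (T w)"
    and N_eq: "\<And>w. w \<in> W \<Longrightarrow> N w = spec_mat (T w) (D w)"
    and D: "\<And>w i. w \<in> W \<Longrightarrow> 0 < D w i"
    and z_eq: "\<And>w. w \<in> W \<Longrightarrow> z w = T w *v w"
    and sph: "\<delta> > 0" "\<And>s. 0 < s \<Longrightarrow> s < \<delta> \<Longrightarrow> \<exists>z'. homeomorphism (sphere 0 s) (sphere 0 s) z z'"
  shows "\<exists>\<beta>. (\<forall>i. Ck_on r (\<beta> i) W) \<and> (\<forall>w\<in>W. (\<forall>i. 0 < \<beta> i w) \<and>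
    z w \<bullet> (N w *v z w) = (\<Sum>i\<in>UNIV. \<beta> i w * (w $ i)\<^sup>2))"
proof -
  define q where "q w = z w \<bullet> (N w *v z w)" for w
  have ww: "w \<bullet> w = (\<Sum>i\<in>UNIV. (w $ i)\<^sup>2)" for w :: "real^'n"
    by (simp add: inner_vec_def power2_eq_square)
  have Tz: "transpose (T w) *v z w = w" if "w \<in> W" for w
    unfolding z_eq[OF that] by (rule orthogonal_matrixD(4)[OF T[OF that]])
  have q: "q w = (\<Sum>i\<in>UNIV. D w i * (w $ i)\<^sup>2)" if "w \<in> W" for w
    unfolding q_def N_eq[OF that] spec_mat_inner Tz[OF that] by (simp add: power2_eq_square mult.assoc)
  have q_pos: "0 < q w" if "w \<in> W" "w \<noteq> 0" for w
  proof -
    obtain k where "w $ k \<noteq> 0" using \<open>w \<noteq> 0\<close> by (metis vec_eq_iff zero_index)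
    then show ?thesis
      unfolding q[OF that(1)]
      by (intro sum_pos2[of UNIV k] mult_nonneg_nonneg less_imp_le[OF D[OF that(1)]] zero_le_power2)
        (use D[OF that(1)] in auto)
  qed
  have contN: "isCont N 0"
    using Ck_on_imp_continuous_on[OF N] W by (simp add: continuous_on_eq_continuous_at)
  obtain S b where S: "open S" "0 \<in> S" "S \<subseteq> W" and b: "\<And>i. Ck_on r (b i) S"
    and qb: "\<And>w. w \<in> S \<Longrightarrow> q w = (\<Sum>i\<in>UNIV. b i w * (w $ i)\<^sup>2)"
    using local_diagonal_form[OF W z N T N_eq z_eq sph] unfolding q_def by blast
  have b_cont: "isCont (b i) 0" for i
    using Ck_on_imp_continuous_on[OF b] S by (simp add: continuous_on_eq_continuous_at)
  define m where "m = Min (range (D 0))"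
  have m: "0 < m" "\<And>i. m \<le> D 0 i" using D[OF W(2)] by (auto simp: m_def)
  \<comment> \<open>On the half-axis \<open>i\<close> only the weight \<open>b i\<close> is visible,
    with \<open>q\<close> equal to it times t^2. Positive definiteness of \<open>N 0\<close>, with
    half of its constant \<open>m\<close> spent on the change from \<open>N 0\<close> to
    \<open>N w\<close>, bounds this below by m/2 times t^2.\<close>
  have b0: "0 < b i 0" for i
  proof -
    have "\<forall>\<^sub>F w in nhds 0. (\<forall>x. norm (N w *v x - N 0 *v x) \<le> m/2 * norm x) \<and> w \<in> S"
      using m S by (intro eventually_conj matrix_vector_mult_small contN eventually_nhds_in_open) auto
    moreover have lim: "((\<lambda>t. axis i t) \<longlongrightarrow> (0::real^'n)) (at_right (0::real))"
    proof -
      have "((\<lambda>t. t *\<^sub>R axis i (1::real)) \<longlongrightarrow> 0) (at_right (0::real))" by (auto intro!: tendsto_eq_intros)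
      moreover have "t *\<^sub>R axis i 1 = (axis i t :: real^'n)" for t by (simp add: vec_eq_iff axis_def)
      ultimately show ?thesis by simp
    qed
    ultimately have "\<forall>\<^sub>F t in at_right 0. (\<forall>x. norm (N (axis i t) *v x - N 0 *v x) \<le> m/2 * norm x) \<and> axis i t \<in> S"
      by (rule eventually_compose_filterlim)
    moreover have "\<forall>\<^sub>F t in at_right (0::real). 0 < t" by (rule eventually_at_right_less)
    ultimately have "\<forall>\<^sub>F t in at_right 0. m/2 \<le> b i (axis i t)"
    proof eventually_elim
      case (elim t)
      let ?w = "axis i t" and ?x = "z (axis i t)"
      have w: "?w \<in> S" "?w \<in> W" using elim S by auto
      have nx: "norm ?x = t" using elim orthogonal_matrixD(6)[OF T[OF w(2)]] by (simp add: z_eq[OF w(2)])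
      have "m * (?x \<bullet> ?x) \<le> ?x \<bullet> (N 0 *v ?x)"
      proof -
        let ?y = "transpose (T 0) *v ?x"
        have "?x \<bullet> ?x = ?y \<bullet> ?y"
          unfolding dot_square_norm orthogonal_matrixD(5)[OF T[OF W(2)]] ..
        then have "m * (?x \<bullet> ?x) = (\<Sum>i\<in>UNIV. m * (?y $ i * ?y $ i))"
          by (simp only: inner_vec_def[of ?y] inner_real_def sum_distrib_left)
        also have "\<dots> \<le> (\<Sum>i\<in>UNIV. D 0 i * (?y $ i * ?y $ i))"
          using m by (intro sum_mono mult_right_mono) auto
        finally show ?thesis unfolding N_eq[OF W(2)] spec_mat_inner by (simp only: mult.assoc)
      qed
      moreover have "\<bar>?x \<bullet> (N ?w *v ?x - N 0 *v ?x)\<bar> \<le> norm ?x * (m/2 * norm ?x)"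
        by (rule order_trans[OF Cauchy_Schwarz_ineq2 mult_left_mono]) (use elim in blast, rule norm_ge_zero)
      ultimately have "m * t\<^sup>2 - m/2 * t\<^sup>2 \<le> q ?w"
        unfolding q_def dot_square_norm nx inner_diff_right power2_eq_square abs_le_iff
        by (simp add: algebra_simps)
      moreover have "q ?w = b i ?w * t\<^sup>2"
      proof -
        have "q ?w = (\<Sum>j\<in>UNIV. if j = i then b i ?w * t\<^sup>2 else 0)"
          unfolding qb[OF w(1)] by (rule sum.cong) (auto simp: axis_def)
        then show ?thesis by simp
      qed
      ultimately have "m/2 * t\<^sup>2 \<le> b i ?w * t\<^sup>2" by simp
      then show ?case using elim by simp
    qed
    moreover have "((\<lambda>t. b i (axis i t)) \<longlongrightarrow> b i 0) (at_right 0)"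
      by (rule isCont_tendsto_compose[OF b_cont lim])
    ultimately have "m/2 \<le> b i 0" by (intro tendsto_lowerbound[of "\<lambda>t. b i (axis i t)"]) auto
    then show ?thesis using m by simp
  qed
  have "\<forall>\<^sub>F w in nhds 0. (\<forall>i\<in>UNIV. 0 < b i w) \<and> w \<in> S"
  proof (intro eventually_conj eventually_ball_finite ballI)
    show "\<forall>\<^sub>F w in nhds 0. 0 < b i w" for i
      using b_cont[of i] b0[of i] unfolding isCont_def tendsto_at_iff_tendsto_nhds
      by (rule order_tendstoD(1))
  qed (use S in \<open>auto intro: eventually_nhds_in_open\<close>)
  then obtain e where e: "e > 0" "\<And>w i. norm w < e \<Longrightarrow> 0 < b i w" "\<And>w. norm w < e \<Longrightarrow> w \<in> S"
    unfolding eventually_nhds_metric by auto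
  define d where "d = e / 2"
  have d: "d > 0" "3/2 * d < e" using e by (auto simp: d_def)
  obtain \<zeta> :: "real^'n \<Rightarrow> real" where \<zeta>: "Ck_on r \<zeta> UNIV" "\<And>w. 0 \<le> \<zeta> w" "\<And>w. \<zeta> w \<le> 1"
    "\<And>w. norm w \<le> d \<Longrightarrow> \<zeta> w = 1" "\<And>w. 3/2 * d \<le> norm w \<Longrightarrow> \<zeta> w = 0"
    using Ck_on_cutoff[OF d(1)] by blast
  have inS: "norm w < e" if "\<zeta> w \<noteq> 0" for w using \<zeta>(5)[of w] that d by linarith
  \<comment> \<open>A convex combination of two families of positive weights that both reproduce
    \<open>q\<close>. At the origin the ratio has coefficient 0.\<close>
  define \<beta> where "\<beta> i w = \<zeta> w * b i w + (1 - \<zeta> w) * (q w / (w \<bullet> w))" for i w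
  have q_Ck: "Ck_on r q W"
    unfolding q_def[abs_def] by (intro Ck_on_inner Ck_on_matrix_vector_mult W z N)
  have ratio: "Ck_on r (\<lambda>w. q w / (w \<bullet> w)) (W - {0})"
    using W by (intro Ck_on_divide Ck_on_inner Ck_on_ident Ck_on_subset[OF q_Ck]) (auto intro: open_Diff)
  have "Ck_on r (\<beta> i) W" for i
  proof (rule Ck_on_local)
    fix w assume w: "w \<in> W"
    \<comment> \<open>\<open>\<beta> i\<close> is \<open>b i\<close> in the first region and the
      ratio in the third. Both occur only in the second, which avoids the singularity of the ratio
      at the origin.\<close>
    consider "norm w < d" | "w \<noteq> 0" "norm w < e" | "3/2 * d < norm w" using d e by fastforce
    then show "\<exists>U. open U \<and> w \<in> U \<and> Ck_on r (\<beta> i) U"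
    proof cases
      case 1
      have "ball 0 d \<subseteq> S" using e(3) d by auto
      then have "Ck_on r (\<beta> i) (ball 0 d)"
        by (intro Ck_on_cong[OF Ck_on_subset[OF b]]) (auto simp: \<beta>_def \<zeta>(4))
      then show ?thesis using 1 by (intro exI[of _ "ball 0 d"]) auto
    next
      case 2
      have U: "open (ball 0 e - {0 :: real^'n})" "ball 0 e - {0} \<subseteq> S" "ball 0 e - {0} \<subseteq> W - {0}"
        using e(3) S(3) by auto
      have "Ck_on r (\<beta> i) (ball 0 e - {0})"
        unfolding \<beta>_def[abs_def]
        by (intro Ck_on_add Ck_on_mult Ck_on_diff Ck_on_const U(1) Ck_on_subset[OF b U(2)]
            Ck_on_subset[OF ratio U(3)] Ck_on_subset[OF \<zeta>(1) subset_UNIV])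
      then show ?thesis using 2 U by (intro exI[of _ "ball 0 e - {0}"]) auto
    next
      case 3
      have U: "open (W - cball 0 (3/2 * d))" "W - cball 0 (3/2 * d) \<subseteq> W - {0}"
        using W d by (auto intro: open_Diff)
      have "Ck_on r (\<beta> i) (W - cball 0 (3/2 * d))"
        by (rule Ck_on_cong[OF Ck_on_subset[OF ratio U(2)] U(1)]) (auto simp: \<beta>_def \<zeta>(5))
      then show ?thesis using 3 w U by (intro exI[of _ "W - cball 0 (3/2 * d)"]) auto
    qed
  qed
  moreover have "0 < \<beta> i w" if w: "w \<in> W" for i w
  proof (cases "w = 0")
    case True
    then show ?thesis using \<zeta>(4)[of 0] d b0 by (simp add: \<beta>_def)
  next
    case False
    have ratio_pos: "0 < q w / (w \<bullet> w)" using q_pos[OF w False] False by simp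
    show ?thesis
    proof (cases "\<zeta> w = 0")
      case True
      then show ?thesis using ratio_pos by (simp add: \<beta>_def)
    next
      case False
      then have "0 < \<zeta> w * b i w" using \<zeta>(2)[of w] e(2)[OF inS] by simp
      moreover have "0 \<le> (1 - \<zeta> w) * (q w / (w \<bullet> w))"
        using \<zeta>(3)[of w] ratio_pos by (intro mult_nonneg_nonneg) auto
      ultimately show ?thesis by (simp add: \<beta>_def)
    qed
  qed
  moreover have "q w = (\<Sum>i\<in>UNIV. \<beta> i w * (w $ i)\<^sup>2)" if w: "w \<in> W" for w
  proof -
    have "(\<Sum>i\<in>UNIV. \<beta> i w * (w $ i)\<^sup>2) =
        \<zeta> w * (\<Sum>i\<in>UNIV. b i w * (w $ i)\<^sup>2) + (1 - \<zeta> w) * (q w / (w \<bullet> w)) * (w \<bullet> w)"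
      unfolding \<beta>_def ww[of w] by (simp add: distrib_right sum.distrib sum_distrib_left mult.assoc)
    also have "\<zeta> w * (\<Sum>i\<in>UNIV. b i w * (w $ i)\<^sup>2) = \<zeta> w * q w"
      using qb[OF e(3)[OF inS]] by (cases "\<zeta> w = 0") auto
    also have "(1 - \<zeta> w) * (q w / (w \<bullet> w)) * (w \<bullet> w) = (1 - \<zeta> w) * q w"
      using q[OF w] by (cases "w = 0") auto
    finally show ?thesis by (simp add: algebra_simps)
  qed
  ultimately show ?thesis unfolding q_def by (intro exI[of _ \<beta>]) blast
qed


section \<open>The composed isomorphism and its normal form\<close>

lemma diag_mat_spec_mat: "diag_mat D \<Longrightarrow> T ** D ** transpose T = spec_mat T (\<lambda>i. D $ i $ i)"
proof -
  assume "diag_mat D"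
  then have "(\<chi> i j. if i = j then D $ i $ i else 0) = D" by (auto simp: diag_mat_def vec_eq_iff)
  then show ?thesis by (simp add: spec_mat_def)
qed

lemma Ck_iso_compose:
  assumes \<phi>: "Ck_iso k \<phi> U V" and \<theta>: "Ck_iso k \<theta> V W" and U: "open U" and V: "open V" and W: "open W"
  shows "Ck_iso k (\<theta> \<circ> \<phi>) U W"
    and "\<And>w. w \<in> W \<Longrightarrow> inv_into U (\<theta> \<circ> \<phi>) w = inv_into U \<phi> (inv_into V \<theta> w)"
proof -
  have b: "bij_betw \<phi> U V" "bij_betw \<theta> V W" using \<phi> \<theta> by (auto simp: Ck_iso_def)
  then have im: "\<phi> ` U = V" "\<theta> ` V = W" "inv_into V \<theta> ` W = V"
    using bij_betw_inv_into[OF b(2)] by (auto simp: bij_betw_def)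
  show inv: "inv_into U (\<theta> \<circ> \<phi>) w = inv_into U \<phi> (inv_into V \<theta> w)" if "w \<in> W" for w
    using inv_into_comp[of \<theta> \<phi> U w] b that im by (simp add: bij_betw_def)
  have "Ck_on k (\<lambda>w. inv_into U \<phi> (inv_into V \<theta> w)) W"
    by (rule Ck_on_compose[OF W V]) (use \<phi> \<theta> im in \<open>auto simp: Ck_iso_def\<close>)
  then have "Ck_on k (inv_into U (\<theta> \<circ> \<phi>)) W"
    by (rule Ck_on_cong[OF _ W]) (simp add: inv)
  moreover have "Ck_on k (\<lambda>x. \<theta> (\<phi> x)) U"
    by (rule Ck_on_compose[OF U V]) (use \<phi> \<theta> im in \<open>auto simp: Ck_iso_def\<close>)
  ultimately show "Ck_iso k (\<theta> \<circ> \<phi>) U W"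
    using bij_betw_trans[OF b] by (simp add: Ck_iso_def comp_def)
qed

lemma norm_preserving_homeomorphism_sphere:
  fixes \<theta> :: "'a::real_normed_vector \<Rightarrow> 'a"
  assumes b: "bij_betw \<theta> V W" and c: "continuous_on V \<theta>" "continuous_on W (inv_into V \<theta>)"
    and norm: "\<And>x. x \<in> V \<Longrightarrow> norm (\<theta> x) = norm x"
    and sub: "sphere 0 s \<subseteq> V" "sphere 0 s \<subseteq> W"
  shows "homeomorphism (sphere 0 s) (sphere 0 s) (inv_into V \<theta>) \<theta>"
proof -
  have inv: "inv_into V \<theta> w \<in> V" "\<theta> (inv_into V \<theta> w) = w" if "w \<in> W" for w
    using b that by (auto simp: bij_betw_def inv_into_into f_inv_into_f)
  have \<theta>: "\<theta> x \<in> W" "inv_into V \<theta> (\<theta> x) = x" if "x \<in> V" for x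
    using b that by (auto simp: bij_betw_def)
  have "norm (inv_into V \<theta> w) = norm w" if "w \<in> W" for w
    using norm[OF inv(1)[OF that]] inv(2)[OF that] by simp
  then show ?thesis
    by (intro homeomorphismI continuous_on_subset[OF c(1)] continuous_on_subset[OF c(2)])
      (use sub inv \<theta> norm in \<open>auto simp: subset_iff\<close>)
qed

theorem theorem11:
  fixes f :: "real^'n \<Rightarrow> real^'n" and g :: "real^'n \<Rightarrow> real^'m^'n" and h :: "real^'n \<Rightarrow> real^'m"
    and Q R :: "real^'m^'m"
    and H H_hat :: "real^'n \<Rightarrow> real"
    and k :: nat
    and U V :: "(real^'n) set" and \<phi> \<theta> :: "real^'n \<Rightarrow> real^'n"
    and M D T :: "real^'n \<Rightarrow> real^'n^'n"
  assumes "continuous_on UNIV f" and "continuous_on UNIV g" and "continuous_on UNIV h"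
    and "f 0 = 0"
    and solutions_exist: "\<And>z0 u. u \<in> L2_controls \<Longrightarrow> \<exists>z. plant_solution f g z0 u z"
    and "sym_pos_semidef Q" and "sym_pos_semidef R" and "invertible R"
    and H_hat_def: "H_hat = value_fun f g h Q R"
    and "\<And>z0. admissible f g h Q R z0 \<noteq> {}"
    and "Ck_on 1 H_hat UNIV"
    and "optimal_feedback f g h Q R (\<lambda>z. - (matrix_inv R *v (transpose (g z) *v grad H_hat z)))"
    and "is_passive f g h H"
    and "k \<ge> 2" and "Ck_on (k + 2) H UNIV" and "Ck_on k H_hat UNIV"
    and "H 0 = 0" and "H_hat 0 = 0" and "grad H 0 = 0"
    and "sym_pos_def (hess H 0)" and "sym_pos_def (hess H_hat 0)"
    and "open U" and "0 \<in> U" and "open V" and "0 \<in> V"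
    and "Ck_iso k \<phi> U V" and "\<phi> 0 = 0"
    and "Ck_on (k - 2) M V" and "\<And>x. x \<in> V \<Longrightarrow> sym_pos_def (M x)"
    and "\<And>x. x \<in> V \<Longrightarrow> H (inv_into U \<phi> x) = 1/2 * (x \<bullet> x)"
    and "\<And>x. x \<in> V \<Longrightarrow> H_hat (inv_into U \<phi> x) = 1/2 * (x \<bullet> (M x *v x))"
    and "\<And>x. x \<in> V \<Longrightarrow> M x = T x ** D x ** transpose (T x)"
    and "\<And>x. x \<in> V \<Longrightarrow> diag_mat (D x)" and "\<And>x. x \<in> V \<Longrightarrow> orthogonal_matrix (T x)"
    and "\<And>x. x \<in> V \<Longrightarrow> \<theta> x = transpose (T x) *v x"
    and "Ck_iso (k - 2) \<theta> V (\<theta> ` V)"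
  shows "Ck_iso (k - 2) (\<theta> \<circ> \<phi>) U (\<theta> ` V) \<and> (\<theta> \<circ> \<phi>) 0 = 0 \<and>
    (\<forall>w \<in> \<theta> ` V. H (inv_into U (\<theta> \<circ> \<phi>) w) = 1/2 * (w \<bullet> w)) \<and>
    (\<exists>\<Sigma> :: real^'n \<Rightarrow> real^'n^'n.
       Ck_on (k - 2) \<Sigma> (\<theta> ` V) \<and>
       (\<forall>w \<in> \<theta> ` V. diag_mat (\<Sigma> w) \<and> (\<forall>i. \<Sigma> w $ i $ i > 0) \<and>
          H_hat (inv_into U (\<theta> \<circ> \<phi>) w) = 1/2 * (w \<bullet> (\<Sigma> w *v w))))"
proof -
  note \<phi>_iso = \<open>Ck_iso k \<phi> U V\<close> and \<theta>_iso = \<open>Ck_iso (k - 2) \<theta> V (\<theta> ` V)\<close>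
    and V = \<open>open V\<close> \<open>0 \<in> V\<close> and U = \<open>open U\<close> \<open>0 \<in> U\<close>
  define W where "W = \<theta> ` V"
  define z where "z = inv_into V \<theta>"
  have \<theta>: "\<theta> x = transpose (T x) *v x" and T: "orthogonal_matrix (T x)" and D: "diag_mat (D x)"
    and M: "M x = T x ** D x ** transpose (T x)" and M_pos: "sym_pos_def (M x)" if "x \<in> V" for x
    using assms that by blast+
  have b\<theta>: "bij_betw \<theta> V W" and c\<theta>: "Ck_on (k - 2) \<theta> V" and cz: "Ck_on (k - 2) z W"
    using \<theta>_iso by (auto simp: Ck_iso_def W_def z_def)
  \<comment> \<open>For k = 2 the map \<theta> is only a homeomorphism, so openness of its image
    comes from invariance of domain.\<close>
  have W: "open W"
    unfolding W_def
    by (rule invariance_of_domain[OF Ck_on_imp_continuous_on[OF c\<theta>] V(1)]) (use b\<theta> in \<open>auto simp: bij_betw_def\<close>)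
  have zV: "z w \<in> V" "\<theta> (z w) = w" if "w \<in> W" for w
    using that by (auto simp: W_def z_def inv_into_into f_inv_into_f)
  have \<theta>0: "\<theta> 0 = 0" using \<theta>[OF V(2)] by simp
  then have W0: "0 \<in> W" using V(2) by (force simp: W_def)
  have norm_\<theta>: "norm (\<theta> x) = norm x" if "x \<in> V" for x
    unfolding \<theta>[OF that] by (rule orthogonal_matrixD(5)[OF T[OF that]])
  have z_eq: "z w = T (z w) *v w" if "w \<in> W" for w
    using orthogonal_matrixD(3)[OF T[OF zV(1)[OF that]], of "z w"] zV[OF that] \<theta>[OF zV(1)[OF that]] by simp
  have M_spec: "M (z w) = spec_mat (T (z w)) (\<lambda>i. D (z w) $ i $ i)" if "w \<in> W" for w
    unfolding M[OF zV(1)[OF that]] by (rule diag_mat_spec_mat[OF D[OF zV(1)[OF that]]])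
  have D_pos: "0 < D (z w) $ i $ i" if "w \<in> W" for w i
  proof -
    let ?T = "T (z w)"
    note o = orthogonal_matrixD[OF T[OF zV(1)[OF that]]]
    \<comment> \<open>Testing positive definiteness of \<open>M (z w)\<close> on its eigenvector
      number \<open>i\<close> isolates one diagonal entry.\<close>
    let ?x = "?T *v axis i 1"
    have "norm ?x = 1" by (simp only: o(6) norm_axis_1)
    then have "?x \<noteq> 0" by (metis norm_zero zero_neq_one)
    then have "0 < ?x \<bullet> (M (z w) *v ?x)"
      using M_pos[OF zV(1)[OF that]] by (simp add: sym_pos_def_def)
    also have "\<dots> = (\<Sum>j\<in>UNIV. D (z w) $ j $ j * axis i 1 $ j * axis i 1 $ j)"
      unfolding M_spec[OF that] spec_mat_inner o(4) ..
    also have "\<dots> = (\<Sum>j\<in>UNIV. if j = i then D (z w) $ i $ i else 0)"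
      by (rule sum.cong) (auto simp: axis_def)
    finally show ?thesis by simp
  qed
  obtain \<delta> where \<delta>: "\<delta> > 0" "ball 0 \<delta> \<subseteq> V \<inter> W"
    using open_contains_ball[of "V \<inter> W"] V W W0 by blast
  have sph: "\<exists>z'. homeomorphism (sphere 0 s) (sphere 0 s) z z'" if "0 < s" "s < \<delta>" for s
  proof -
    have "sphere 0 s \<subseteq> V" "sphere 0 s \<subseteq> W" using \<delta>(2) that by (auto simp: subset_iff)
    from norm_preserving_homeomorphism_sphere[OF b\<theta> Ck_on_imp_continuous_on[OF c\<theta>]
        Ck_on_imp_continuous_on[OF cz, unfolded z_def] norm_\<theta> this]
    show ?thesis unfolding z_def by blast
  qed
  have cN: "Ck_on (k - 2) (\<lambda>w. M (z w)) W"
    by (rule Ck_on_compose[OF W V(1) cz]) (use zV \<open>Ck_on (k - 2) M V\<close> in auto)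
  obtain \<beta> where \<beta>: "\<And>i. Ck_on (k - 2) (\<beta> i) W" "\<And>w i. w \<in> W \<Longrightarrow> 0 < \<beta> i w"
    "\<And>w. w \<in> W \<Longrightarrow> z w \<bullet> (M (z w) *v z w) = (\<Sum>i\<in>UNIV. \<beta> i w * (w $ i)\<^sup>2)"
    using diagonal_form[OF W W0 cz cN T[OF zV(1)] M_spec D_pos z_eq \<delta>(1) sph] by blast
  define \<Sigma> :: "real^'n \<Rightarrow> real^'n^'n" where "\<Sigma> w = (\<chi> i j. if i = j then \<beta> i w else 0)" for w
  have "Ck_iso (k - 2) \<phi> U V" using \<phi>_iso by (auto simp: Ck_iso_def intro: Ck_on_le[of k _ _ "k - 2"])
  note comp = Ck_iso_compose[OF this \<theta>_iso[folded W_def] U(1) V(1) W, folded z_def]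
  have "Ck_on (k - 2) \<Sigma> W"
  proof (intro Ck_on_vec W)
    show "Ck_on (k - 2) (\<lambda>w. \<Sigma> w $ i $ j) W" for i j
      by (cases "i = j") (simp_all add: \<Sigma>_def \<beta>(1))
  qed
  \<comment> \<open>Pointwise orthogonality of \<open>T\<close> makes \<theta> preserve norms, so
    the first normal form survives the change of coordinates.\<close>
  moreover have "H (inv_into U (\<theta> \<circ> \<phi>) w) = 1/2 * (w \<bullet> w)" if "w \<in> W" for w
    using assms(30)[OF zV(1)[OF that]] norm_\<theta>[OF zV(1)[OF that]] zV(2)[OF that]
    by (simp add: comp(2)[OF that] dot_square_norm)
  moreover have "H_hat (inv_into U (\<theta> \<circ> \<phi>) w) = 1/2 * (w \<bullet> (\<Sigma> w *v w))" if "w \<in> W" for w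
  proof -
    have "w \<bullet> (\<Sigma> w *v w) = (\<Sum>i\<in>UNIV. \<beta> i w * (w $ i)\<^sup>2)"
      by (simp add: \<Sigma>_def inner_vec_def matrix_vector_mult_def if_distrib if_distribR power2_eq_square mult_ac
          cong: if_cong)
    then show ?thesis
      using assms(31)[OF zV(1)[OF that]] \<beta>(3)[OF that] by (simp add: comp(2)[OF that])
  qed
  ultimately show ?thesis
    using comp(1) \<beta>(2) \<theta>0 \<open>\<phi> 0 = 0\<close> unfolding W_def[symmetric]
    by (intro conjI exI[of _ \<Sigma>]) (auto simp: diag_mat_def \<Sigma>_def)
qed

end
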